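(* Let $\partial\Omega\subset\mathbb{R}^3$ be a (ring) torus of revolution, i.e. the surface obtained by rotating a circle of radius $a$ about an axis in its plane at distance $r_0>a$ from its center. Then the Neumann–Poincar\'e operator $\mathcal{K}^*_{\partial\Omega}$, regarded as a compact self-adjoint operator on $H^{-1/2}(\partial\Omega)$ equipped with the inner product $\langle\cdot,\cdot\rangle_*$, has infinitely many negative eigenvalues and infinitely many positive eigenvalues.
   Context: For a bounded domain $\Omega\subset\mathbb{R}^3$ with smooth boundary, the Neumann–Poincar\'e operator is $\mathcal{K}^*_{\partial\Omega}[\varphi](\mathbf{x})=\frac{1}{4\pi}\int_{\partial\Omega}\frac{(\mathbf{x}-\mathbf{y})\cdot\nu_{\mathbf{x}}}{|\mathbf{x}-\mathbf{y}|^3}\varphi(\mathbf{y})\,d\sigma(\mathbf{y})$, $\mathbf{x}\in\partial\Omega$, where $\nu_{\mathbf{x}}$ is the outward unit normal. The single layer potential is $\mathcal{S}_{\partial\Omega}[\varphi](\mathbf{x})=\int_{\partial\Omega}\frac{1}{4\pi|\mathbf{x}-\mathbf{y}|}\varphi(\mathbf{y})\,d\sigma(\mathbf{y})$. On $H^{-1/2}(\partial\Omega)$ the form $\langle\varphi,\psi\rangle_*:=(\varphi,\mathcal{S}_{\partial\Omega}[\psi])$ (with $(\cdot,\cdot)$ the $H^{-1/2}$–$H^{1/2}$ pairing) is an inner product whose norm is equivalent to the $H^{-1/2}(\partial\Omega)$ norm, and $\mathcal{K}^*_{\partial\Omega}$ is compact and self-adjoint with respect to it. *)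

theory Defs
  imports "HOL-Analysis.Analysis"
begin

definition torus_param :: "real \<Rightarrow> real \<Rightarrow> real \<times> real \<Rightarrow> real^3" where
  "torus_param r0 a t = (case t of (th, ph) \<Rightarrow>
     vector [(r0 + a * cos ph) * cos th, (r0 + a * cos ph) * sin th, a * sin ph])"

definition torus_normal :: "real \<times> real \<Rightarrow> real^3" where
  "torus_normal t = (case t of (th, ph) \<Rightarrow>
     vector [cos ph * cos th, cos ph * sin th, sin ph])"

definition torus_jac :: "real \<Rightarrow> real \<Rightarrow> real \<times> real \<Rightarrow> real" where
  "torus_jac r0 a t = a * (r0 + a * cos (snd t))"

text \<open>General torus of revolution = image of the standard one under a rigid motion
  x \<mapsto> g x + b, g an orthogonal transformation.\<close>
definition tor_point :: "(real^3 \<Rightarrow> real^3) \<Rightarrow> real^3 \<Rightarrow> real \<Rightarrow> real \<Rightarrow> real \<times> real \<Rightarrow> real^3" where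
  "tor_point g b r0 a t = g (torus_param r0 a t) + b"

definition tor_normal :: "(real^3 \<Rightarrow> real^3) \<Rightarrow> real \<times> real \<Rightarrow> real^3" where
  "tor_normal g t = g (torus_normal t)"

definition torus_surface :: "(real^3 \<Rightarrow> real^3) \<Rightarrow> real^3 \<Rightarrow> real \<Rightarrow> real \<Rightarrow> (real^3) set" where
  "torus_surface g b r0 a = range (tor_point g b r0 a)"

definition NP_kernel :: "real^3 \<Rightarrow> real^3 \<Rightarrow> real^3 \<Rightarrow> real" where
  "NP_kernel x y nu = ((x - y) \<bullet> nu) / (4 * pi * norm (x - y) ^ 3)"

definition NP_torus :: "(real^3 \<Rightarrow> real^3) \<Rightarrow> real^3 \<Rightarrow> real \<Rightarrow> real \<Rightarrow> (real^3 \<Rightarrow> real)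
    \<Rightarrow> real \<times> real \<Rightarrow> real" where
  "NP_torus g b r0 a psi t =
     (LINT s : {0..2*pi} \<times> {0..2*pi} | lborel.
        NP_kernel (tor_point g b r0 a t) (tor_point g b r0 a s) (tor_normal g t)
        * psi (tor_point g b r0 a s) * torus_jac r0 a s)"

definition NP_torus_eigenvalue :: "(real^3 \<Rightarrow> real^3) \<Rightarrow> real^3 \<Rightarrow> real \<Rightarrow> real \<Rightarrow> real \<Rightarrow> bool" where
  "NP_torus_eigenvalue g b r0 a lam \<longleftrightarrow>
     (\<exists>psi. continuous_on (torus_surface g b r0 a) psi
          \<and> (\<exists>x\<in>torus_surface g b r0 a. psi x \<noteq> 0)
          \<and> (\<forall>t. NP_torus g b r0 a psi t = lam * psi (tor_point g b r0 a t)))"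

end

theory Submission
  imports Defs "HOL-Complex_Analysis.Great_Picard"
begin

text \<open>Restrict the operator to densities depending only on the angle \<open>\<phi>\<close> along the rotated circle.
  In a conformal angle \<open>\<eta>\<close> for \<open>\<phi>\<close> the squared chord length is \<open>4 \<rho> \<rho>' X\<close>, where \<open>\<rho>\<close> is the
  distance to the axis and \<open>X\<close> depends only on \<open>\<theta> - \<theta>'\<close> and \<open>\<eta> - \<eta>'\<close>. After conjugation with
  \<open>\<rho>\<close> to the power 3/2, the operator is therefore \<open>(\<rho> A - r0 B) / (16 pi R0)\<close> with even
  convolutions \<open>A\<close>, \<open>B\<close> and \<open>\<rho> = R0\<^sup>2 / (r0 - a cos \<eta>)\<close>. Multiplied by \<open>1 / \<rho>\<close>, the eigenvalue
  equation on odd functions of \<open>\<eta>\<close> becomes a three-term recurrence for the sine coefficients, which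
  symmetrises to a compact self-adjoint operator on square-summable sequences. The Fourier coefficients
  satisfy \<open>a\<^sub>n > 0\<close>, \<open>a\<^sub>n \<rightarrow> 0\<close> and \<open>b\<^sub>n / a\<^sub>n \<rightarrow> 1\<close>, so at high frequencies its quadratic form is that
  of multiplication by \<open>\<rho> - r0 = a cos \<phi>\<close>. This function takes both signs: hence the form is positive,
  and also negative, on infinite-dimensional subspaces, spanned by long blocks of constant or of
  alternating coefficients.\<close>


section \<open>Compact self-adjoint operators\<close>

text \<open>The eigenvalue predicate asks for a continuous density that satisfies the equation at
  every parameter, whereas compactness yields only square-summable coefficients; the bridge is that
  a bounded solution of the three-term relation is already absolutely summable. Multiplication by
  \<rho> is not banded in the sine basis but its inverse is, so the eigenvalue equation is kept as a
  pair (f, p), where p holds the coefficients of A F / (r0 - a cos \<eta>). On odd functions the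
  mode 0 is absent and cos \<eta> acts exactly as a half-line Jacobi matrix. With a_n = d_n^2 and
  x_n = d_n f_n the pair becomes the symmetric operator D (R0^2 R - r0 G) D, where R inverts r0 - a
  cos \<eta> and G has the entries b_n / a_n. As D has no bounded inverse, test vectors v are not
  chosen directly: p is chosen as a combination of blocks, and v is recovered from D v = (r0 - a cos
  \<eta>) p, whose right side has finite support. The limit of b_n / a_n is obtained quantitatively,
  from a_n at least c/n and a_n - b_n of order 1/n^2.\<close>

definition selfadjoint_op :: "('a::real_inner \<Rightarrow> 'a) \<Rightarrow> bool" where
  "selfadjoint_op T \<longleftrightarrow> (\<forall>x y. T x \<bullet> y = x \<bullet> T y)"

definition compact_op :: "('a::real_normed_vector \<Rightarrow> 'b::real_normed_vector) \<Rightarrow> bool" where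
  "compact_op T \<longleftrightarrow> (\<forall>X. (\<forall>n::nat. norm (X n) \<le> 1) \<longrightarrow>
     (\<exists>r. strict_mono r \<and> convergent (\<lambda>n. T (X (r n)))))"

text \<open>The Rayleigh quotient attains its supremum \<open>\<mu>\<close> over the unit ball of
  \<open>E\<close>. Along a maximising sequence the semidefinite operator
  \<open>B = \<mu> - T\<close> tends to 0, and since \<open>X n\<close> is
  \<open>B (X n) + T (X n)\<close> divided by \<open>\<mu>\<close>, compactness of \<open>T\<close>
  itself supplies a limit. The invariant closed subspace \<open>E\<close> allows iteration on
  orthogonal complements.\<close>

lemma compact_selfadjoint_positive_eigenvector:
  fixes T :: "'a::real_inner \<Rightarrow> 'a"
  assumes T: "bounded_linear T" and sa: "selfadjoint_op T" and comp: "compact_op T"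
    and E: "subspace E" "closed E" and inv: "\<And>x. x \<in> E \<Longrightarrow> T x \<in> E"
    and v: "v \<in> E" "v \<bullet> T v > 0"
  shows "\<exists>x\<in>E. \<exists>\<mu>>0. norm x = 1 \<and> T x = \<mu> *\<^sub>R x"
proof -
  interpret T: bounded_linear T by fact
  obtain K where K: "K > 0" "\<And>x. norm (T x) \<le> norm x * K"
    using T.pos_bounded by blast
  define S where "S = (\<lambda>x. x \<bullet> T x) ` {x\<in>E. norm x \<le> 1}"
  define \<mu> where "\<mu> = Sup S"
  have quad_le: "\<bar>x \<bullet> T x\<bar> \<le> K * (norm x)\<^sup>2" for x
  proof -
    have "\<bar>x \<bullet> T x\<bar> \<le> norm x * norm (T x)" by (rule Cauchy_Schwarz_ineq2)
    also have "\<dots> \<le> norm x * (norm x * K)" by (intro mult_left_mono K) auto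
    finally show ?thesis by (simp add: power2_eq_square mult_ac)
  qed
  have bdd: "bdd_above S"
    unfolding S_def
  proof (rule bdd_aboveI2)
    fix x assume "x \<in> {x\<in>E. norm x \<le> 1}"
    then have "(norm x)\<^sup>2 \<le> 1" by (simp add: power_le_one)
    then have "K * (norm x)\<^sup>2 \<le> K" using K(1) by simp
    then show "x \<bullet> T x \<le> K" using quad_le[of x] by linarith
  qed
  have v0: "v \<noteq> 0" using v(2) by (auto simp: T.zero)
  have le_mu: "x \<bullet> T x \<le> \<mu>" if "x \<in> E" "norm x \<le> 1" for x
    unfolding \<mu>_def by (rule cSup_upper[OF _ bdd]) (use that in \<open>auto simp: S_def\<close>)
  have le_mu2: "x \<bullet> T x \<le> \<mu> * (norm x)\<^sup>2" if "x \<in> E" for x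
  proof (cases "x = 0")
    case False
    have "(x /\<^sub>R norm x) \<bullet> T (x /\<^sub>R norm x) \<le> \<mu>"
      by (rule le_mu) (use False that E in \<open>auto intro: subspace_scale\<close>)
    then have "(x \<bullet> T x) / (norm x)\<^sup>2 \<le> \<mu>"
      by (simp add: T.scaleR power2_eq_square field_simps)
    then show ?thesis using False by (simp add: field_simps)
  qed (simp add: T.zero)
  have mu_pos: "\<mu> > 0"
  proof -
    have "0 < v \<bullet> T v" by fact
    also have "\<dots> \<le> \<mu> * (norm v)\<^sup>2" by (rule le_mu2) fact
    finally show ?thesis using v0 by (simp add: zero_less_mult_iff)
  qed
  have ne: "S \<noteq> {}" unfolding S_def using E subspace_0 by force
  have "\<exists>x\<in>E. norm x \<le> 1 \<and> x \<bullet> T x > \<mu> - 1 / Suc n" for n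
  proof -
    have "\<mu> - 1 / Suc n < Sup S" unfolding \<mu>_def by simp
    then show ?thesis
      using less_cSupD[OF ne] unfolding S_def by fastforce
  qed
  then obtain X where X: "\<And>n. X n \<in> E" "\<And>n. norm (X n) \<le> 1" "\<And>n. X n \<bullet> T (X n) > \<mu> - 1 / Suc n"
    by metis
  define B where "B x = \<mu> *\<^sub>R x - T x" for x
  have B_E: "B x \<in> E" if "x \<in> E" for x
    unfolding B_def using that E inv by (intro subspace_diff subspace_scale) auto
  have B_add: "B (x + y) = B x + B y" and B_scale: "B (c *\<^sub>R x) = c *\<^sub>R B x" for x y c
    by (simp_all add: B_def T.add T.scaleR algebra_simps)
  have B_sa: "B x \<bullet> y = x \<bullet> B y" for x y
    using sa by (simp add: B_def selfadjoint_op_def inner_diff_left inner_diff_right)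
  have B_pos: "0 \<le> x \<bullet> B x" if "x \<in> E" for x
    using le_mu2[OF that] by (simp add: B_def inner_diff_right power2_norm_eq_inner)
  have B_norm: "norm (B x) \<le> (\<mu> + K) * norm x" for x
  proof -
    have "norm (B x) \<le> norm (\<mu> *\<^sub>R x) + norm (T x)" unfolding B_def by (rule norm_triangle_ineq4)
    then show ?thesis using K(2)[of x] mu_pos by (simp add: algebra_simps)
  qed
  \<comment> \<open>Cauchy--Schwarz for the positive semidefinite form of \<open>B\<close>, applied to \<open>x\<close> and \<open>B x\<close>.\<close>
  have B_CS: "(norm (B x))\<^sup>2 \<le> (\<mu> + K) * (x \<bullet> B x)" if x: "x \<in> E" for x
  proof (cases "B x = 0")
    case False
    \<comment> \<open>This value minimises \<open>- 2 * c + c\<^sup>2 * (\<mu> + K)\<close>, the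
      resulting coefficient of \<open>(norm (B x))\<^sup>2\<close>.\<close>
    define c where "c = 1 / (\<mu> + K)"
    have c: "c > 0" "c * (\<mu> + K) = 1" using mu_pos K(1) by (auto simp: c_def)
    let ?y = "x - c *\<^sub>R B x"
    have B_y: "B ?y = B x - c *\<^sub>R B (B x)"
      by (simp add: B_def T.add T.diff T.scaleR algebra_simps)
    have "0 \<le> ?y \<bullet> B ?y" using x E B_E by (intro B_pos subspace_diff subspace_scale) auto
    also have "\<dots> = x \<bullet> B x - 2 * c * (norm (B x))\<^sup>2 + c\<^sup>2 * (B x \<bullet> B (B x))"
      by (simp add: B_y inner_diff_left inner_diff_right power2_norm_eq_inner B_sa[of x "B x", symmetric]
          power2_eq_square[of c]) (simp add: algebra_simps)
    also have "B x \<bullet> B (B x) \<le> (\<mu> + K) * (norm (B x))\<^sup>2"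
    proof -
      have "B x \<bullet> B (B x) \<le> norm (B x) * norm (B (B x))" by (rule norm_cauchy_schwarz)
      also have "\<dots> \<le> norm (B x) * ((\<mu> + K) * norm (B x))" by (intro mult_left_mono B_norm) auto
      finally show ?thesis by (simp add: power2_eq_square mult_ac)
    qed
    then have "x \<bullet> B x - 2 * c * (norm (B x))\<^sup>2 + c\<^sup>2 * (B x \<bullet> B (B x))
        \<le> x \<bullet> B x - 2 * c * (norm (B x))\<^sup>2 + c\<^sup>2 * ((\<mu> + K) * (norm (B x))\<^sup>2)"
      using c by (intro add_left_mono mult_left_mono) auto
    also have "\<dots> = x \<bullet> B x - c * (norm (B x))\<^sup>2"
    proof -
      have "c\<^sup>2 * ((\<mu> + K) * (norm (B x))\<^sup>2) = c * (c * (\<mu> + K)) * (norm (B x))\<^sup>2"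
        by (simp add: power2_eq_square[of c])
      then show ?thesis by (simp add: c(2))
    qed
    finally have "c * (norm (B x))\<^sup>2 \<le> x \<bullet> B x" by simp
    then show ?thesis using mu_pos K(1) by (simp add: c_def field_simps)
  qed (use that B_pos mu_pos K in \<open>auto intro!: mult_nonneg_nonneg\<close>)
  have "(\<lambda>n. B (X n)) \<longlonglongrightarrow> 0"
  proof -
    have "(norm (B (X n)))\<^sup>2 \<le> (\<mu> + K) * (1 / Suc n)" for n
    proof -
      have "X n \<bullet> B (X n) = \<mu> * (norm (X n))\<^sup>2 - X n \<bullet> T (X n)"
        by (simp add: B_def inner_diff_right power2_norm_eq_inner)
      also have "\<dots> \<le> \<mu> * 1 - X n \<bullet> T (X n)"
        using X(2)[of n] mu_pos by (intro diff_right_mono mult_left_mono) (auto simp: power_le_one)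
      also have "\<dots> \<le> 1 / Suc n" using X(3)[of n] by simp
      finally have "(\<mu> + K) * (X n \<bullet> B (X n)) \<le> (\<mu> + K) * (1 / Suc n)"
        using mu_pos K(1) by (intro mult_left_mono) auto
      then show ?thesis using B_CS[OF X(1)[of n]] by linarith
    qed
    moreover have "(\<lambda>n. (\<mu> + K) * (1 / Suc n)) \<longlonglongrightarrow> (\<mu> + K) * 0"
      by (intro tendsto_intros LIMSEQ_Suc[OF lim_1_over_n])
    ultimately have "(\<lambda>n. (norm (B (X n)))\<^sup>2) \<longlonglongrightarrow> 0"
      using tendsto_sandwich[OF always_eventually always_eventually tendsto_const[of 0],
          of "\<lambda>n. (norm (B (X n)))\<^sup>2" "\<lambda>n. (\<mu> + K) * (1 / Suc n)"] by simp
    then have "(\<lambda>n. sqrt ((norm (B (X n)))\<^sup>2)) \<longlonglongrightarrow> sqrt 0" by (rule tendsto_real_sqrt)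
    then show ?thesis by (simp add: tendsto_norm_zero_iff)
  qed
  obtain r y where r: "strict_mono r" and y: "(\<lambda>n. T (X (r n))) \<longlonglongrightarrow> y"
    using comp X(2) unfolding compact_op_def convergent_def by meson
  have "(\<lambda>n. B (X (r n))) \<longlonglongrightarrow> 0"
    using LIMSEQ_subseq_LIMSEQ[OF \<open>(\<lambda>n. B (X n)) \<longlonglongrightarrow> 0\<close> r] by (simp add: o_def)
  then have "(\<lambda>n. (B (X (r n)) + T (X (r n))) /\<^sub>R \<mu>) \<longlonglongrightarrow> (0 + y) /\<^sub>R \<mu>"
    by (intro tendsto_intros y)
  then have lim: "(\<lambda>n. X (r n)) \<longlonglongrightarrow> y /\<^sub>R \<mu>"
    using mu_pos by (simp add: B_def)
  define z where "z = y /\<^sub>R \<mu>"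
  have zE: "z \<in> E"
    unfolding z_def by (rule closed_sequentially[OF E(2) _ lim]) (use X in auto)
  have "(\<lambda>n. T (X (r n))) \<longlonglongrightarrow> T z"
    unfolding z_def by (rule T.tendsto[OF lim])
  then have "y = T z" by (rule LIMSEQ_unique[OF y])
  then have Tz: "T z = \<mu> *\<^sub>R z"
    using mu_pos by (simp add: z_def)
  have "(\<lambda>n. X (r n) \<bullet> T (X (r n))) \<longlonglongrightarrow> z \<bullet> y"
    unfolding z_def by (intro tendsto_intros lim y)
  moreover have "(\<lambda>n. \<mu> - 1 / Suc (r n)) \<longlonglongrightarrow> \<mu> - 0"
    using LIMSEQ_subseq_LIMSEQ[OF LIMSEQ_Suc[OF lim_1_over_n] r]
    by (intro tendsto_intros) (simp add: o_def)
  ultimately have "\<mu> - 0 \<le> z \<bullet> y"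
    by (intro LIMSEQ_le) (use X(3) in \<open>auto intro: less_imp_le\<close>)
  then have z0: "z \<noteq> 0" using mu_pos by auto
  show ?thesis
  proof (intro bexI exI conjI)
    show "\<mu> > 0" by fact
    show "z /\<^sub>R norm z \<in> E" using zE E by (intro subspace_scale)
    show "norm (z /\<^sub>R norm z) = 1" using z0 by simp
    show "T (z /\<^sub>R norm z) = \<mu> *\<^sub>R (z /\<^sub>R norm z)" by (simp add: T.scaleR Tz)
  qed
qed

text \<open>Positivity somewhere in every complement of finite codimension lets orthonormal
  eigenvectors be chosen one after another, each in the invariant complement of its predecessors.
  Finitely many distinct eigenvalues would keep all \<open>\<mu> n\<close> above some
  \<open>\<delta> > 0\<close>; the images \<open>T (X n)\<close> would then have mutual distance at
  least \<open>\<delta>\<close>, against compactness. Hence values are counted, not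
  multiplicities.\<close>

lemma compact_selfadjoint_infinitely_many_positive_eigenvalues:
  fixes T :: "'a::real_inner \<Rightarrow> 'a"
  assumes T: "bounded_linear T" and sa: "selfadjoint_op T" and comp: "compact_op T"
    and pos: "\<And>F. finite F \<Longrightarrow> \<exists>v. (\<forall>f\<in>F. f \<bullet> v = 0) \<and> v \<bullet> T v > 0"
  shows "infinite {\<mu>. \<mu> > 0 \<and> (\<exists>x. x \<noteq> 0 \<and> T x = \<mu> *\<^sub>R x)}" (is "infinite ?\<Lambda>")
proof
  assume fin: "finite ?\<Lambda>"
  interpret T: bounded_linear T by fact
  define P where "P X n x \<longleftrightarrow> (\<exists>\<mu>>0. norm x = 1 \<and> T x = \<mu> *\<^sub>R x) \<and> (\<forall>m<n. X m \<bullet> x = 0)"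
    for X :: "nat \<Rightarrow> 'a" and n x
  have "\<exists>X. \<forall>n. P X n (X n)"
  proof (rule dependent_wellorder_choice)
    fix n and X :: "nat \<Rightarrow> 'a" assume X: "\<And>m. m < n \<Longrightarrow> P X m (X m)"
    define E where "E = {x. \<forall>m<n. X m \<bullet> x = 0}"
    have sub: "subspace E"
      by (auto simp: E_def subspace_def inner_add_right)
    have "E = (\<Inter>m\<in>{..<n}. {x. X m \<bullet> x = 0})" by (auto simp: E_def)
    moreover have "closed {x. X m \<bullet> x = 0}" for m
      by (intro closed_Collect_eq continuous_intros)
    ultimately have cl: "closed E" by auto
    obtain v where v: "\<forall>f\<in>X ` {..<n}. f \<bullet> v = 0" "v \<bullet> T v > 0"
      using pos[of "X ` {..<n}"] by auto
    have inv: "T x \<in> E" if x: "x \<in> E" for x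
      unfolding E_def
    proof (intro CollectI allI impI)
      fix m assume m: "m < n"
      then obtain \<mu> where "T (X m) = \<mu> *\<^sub>R X m" using X unfolding P_def by blast
      moreover have "X m \<bullet> T x = T (X m) \<bullet> x" using sa by (simp add: selfadjoint_op_def)
      ultimately show "X m \<bullet> T x = 0" using x m by (simp add: E_def)
    qed
    show "\<exists>x. P X n x"
      using compact_selfadjoint_positive_eigenvector[OF T sa comp sub cl inv, of v] v
      unfolding P_def E_def by auto
  qed (auto simp: P_def)
  then obtain X where X: "\<And>n. P X n (X n)" by blast
  then obtain \<mu> where \<mu>: "\<And>n. \<mu> n > 0" "\<And>n. T (X n) = \<mu> n *\<^sub>R X n" and nX: "\<And>n. norm (X n) = 1"
    unfolding P_def by metis
  have orth: "X m \<bullet> X n = 0" if "m \<noteq> n" for m n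
    using X[of m] X[of n] that unfolding P_def by (metis inner_commute linorder_neqE_nat)
  have in\<Lambda>: "\<mu> n \<in> ?\<Lambda>" for n
    using \<mu>[of n] nX[of n] by (auto intro!: exI[of _ "X n"])
  define \<delta> where "\<delta> = Min ?\<Lambda>"
  have ne: "?\<Lambda> \<noteq> {}" using in\<Lambda> by blast
  have \<delta>: "\<delta> > 0" using Min_in[OF fin ne] unfolding \<delta>_def by blast
  have \<delta>_le: "\<delta> \<le> \<mu> n" for n unfolding \<delta>_def by (rule Min_le[OF fin in\<Lambda>])
  obtain r where r: "strict_mono r" and "convergent (\<lambda>n. T (X (r n)))"
    using comp nX unfolding compact_op_def by (metis order_refl)
  then have "Cauchy (\<lambda>n. T (X (r n)))" by (simp add: convergent_Cauchy)
  then obtain N where N: "\<And>m n. m \<ge> N \<Longrightarrow> n \<ge> N \<Longrightarrow> norm (T (X (r m)) - T (X (r n))) < \<delta>"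
    using \<delta> unfolding Cauchy_iff by meson
  let ?m = "r N" and ?n = "r (Suc N)"
  have "?m \<noteq> ?n" using r by (metis less_irrefl lessI strict_mono_less)
  then have "(norm (T (X ?m) - T (X ?n)))\<^sup>2 = (\<mu> ?m)\<^sup>2 + (\<mu> ?n)\<^sup>2"
    using nX[of ?m] nX[of ?n] orth[of ?m ?n] orth[of ?n ?m]
    by (simp add: \<mu>(2) power2_norm_eq_inner inner_diff_left inner_diff_right norm_eq_1)
      (simp add: power2_eq_square)
  moreover have "\<delta>\<^sup>2 \<le> (\<mu> ?m)\<^sup>2" using \<delta> \<delta>_le by (intro power_mono) auto
  moreover have "(norm (T (X ?m) - T (X ?n)))\<^sup>2 < \<delta>\<^sup>2"
    using N[of N "Suc N"] by (intro power_strict_mono) auto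
  ultimately show False by (smt (verit) zero_le_power2)
qed

text \<open>Infinite dimension is expressed as containment in no finite span, a form that survives
  intersection with a hyperplane: one vector \<open>v0\<close> off the hyperplane restores all of
  \<open>V\<close>.\<close>

lemma infinite_dimensional_subspace_meets_orthogonal:
  fixes V :: "'a::real_inner set"
  assumes "finite F" "subspace V" "\<And>B. finite B \<Longrightarrow> \<not> V \<subseteq> span B"
  shows "\<exists>v\<in>V. v \<noteq> 0 \<and> (\<forall>f\<in>F. f \<bullet> v = 0)"
  using assms
proof (induction F arbitrary: V rule: finite_induct)
  case empty
  have "\<not> V \<subseteq> {0}" using empty(2)[of "{}"] by simp
  then show ?case by auto
next
  case (insert f F)
  define W where "W = V \<inter> {x. f \<bullet> x = 0}"
  have "subspace W"
    using insert.prems(1) by (auto simp: W_def subspace_def inner_add_right)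
  moreover have "\<not> W \<subseteq> span B" if B: "finite B" for B
  proof
    assume W: "W \<subseteq> span B"
    have "V \<noteq> W" using W insert.prems(2)[OF B] by auto
    then obtain v0 where v0: "v0 \<in> V" "f \<bullet> v0 \<noteq> 0" unfolding W_def by auto
    have "V \<subseteq> span (insert v0 B)"
    proof
      fix v assume v: "v \<in> V"
      define c where "c = (f \<bullet> v) / (f \<bullet> v0)"
      have "v - c *\<^sub>R v0 \<in> W"
        using v v0 insert.prems(1)
        by (auto simp: W_def c_def inner_diff_right intro!: subspace_diff subspace_scale)
      then have "v - c *\<^sub>R v0 \<in> span B" using W by blast
      then show "v \<in> span (insert v0 B)" unfolding span_insert by blast
    qed
    then show False using insert.prems(2)[of "insert v0 B"] B by auto
  qed
  ultimately obtain v where "v \<in> W" "v \<noteq> 0" "\<forall>g\<in>F. g \<bullet> v = 0"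
    using insert.IH[of W] by blast
  then show ?case by (auto simp: W_def)
qed

section \<open>The Hilbert space of square-summable sequences\<close>

lemma summable_square_add:
  fixes x y :: "nat \<Rightarrow> real"
  assumes "summable (\<lambda>n. (x n)\<^sup>2)" "summable (\<lambda>n. (y n)\<^sup>2)"
  shows "summable (\<lambda>n. (x n + y n)\<^sup>2)"
proof (rule summable_comparison_test')
  show "summable (\<lambda>n. 2 * (x n)\<^sup>2 + 2 * (y n)\<^sup>2)"
    using assms by (intro summable_add summable_mult)
  show "norm ((x n + y n)\<^sup>2) \<le> 2 * (x n)\<^sup>2 + 2 * (y n)\<^sup>2" for n
    unfolding real_norm_def abs_power2 using sum_squares_bound[of "x n" "y n"] by (simp add: power2_sum)
qed

lemma summable_square_mult:
  fixes x y :: "nat \<Rightarrow> real"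
  assumes "summable (\<lambda>n. (x n)\<^sup>2)" "summable (\<lambda>n. (y n)\<^sup>2)"
  shows "summable (\<lambda>n. x n * y n)"
proof (rule summable_comparison_test')
  show "summable (\<lambda>n. (x n)\<^sup>2 + (y n)\<^sup>2)"
    using assms by (intro summable_add)
  show "norm (x n * y n) \<le> (x n)\<^sup>2 + (y n)\<^sup>2" for n
    using sum_squares_bound[of "\<bar>x n\<bar>" "\<bar>y n\<bar>"] mult_nonneg_nonneg[of "\<bar>x n\<bar>" "\<bar>y n\<bar>"]
    by (simp add: abs_mult del: mult_nonneg_nonneg)
qed

text \<open>A type of its own makes the classes \<open>real_inner\<close> and
  \<open>complete_space\<close> available to the abstract lemmas and to the contraction argument. In
  the application coordinate \<open>n\<close> stands for frequency \<open>n + 1\<close>, since sine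
  series start at frequency 1.\<close>

typedef ell2 = "{x :: nat \<Rightarrow> real. summable (\<lambda>n. (x n)\<^sup>2)}"
  morphisms coord Abs_ell2
  by (rule exI[of _ "\<lambda>n. 0"]) simp

setup_lifting type_definition_ell2

lemma summable_coord: "summable (\<lambda>n. (coord x n)\<^sup>2)"
  using coord[of x] by simp

lemma coord_Abs_ell2: "summable (\<lambda>n. (x n)\<^sup>2) \<Longrightarrow> coord (Abs_ell2 x) = x"
  by (simp add: Abs_ell2_inverse)

lemma ell2_eqI: "(\<And>n. coord x n = coord y n) \<Longrightarrow> x = y"
  by (simp add: coord_inject[symmetric] fun_eq_iff)

instantiation ell2 :: real_inner
begin

lift_definition zero_ell2 :: ell2 is "\<lambda>n. 0" by simp
lift_definition plus_ell2 :: "ell2 \<Rightarrow> ell2 \<Rightarrow> ell2" is "\<lambda>x y n. x n + y n"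
  by (rule summable_square_add)
lift_definition uminus_ell2 :: "ell2 \<Rightarrow> ell2" is "\<lambda>x n. - x n" by simp
lift_definition minus_ell2 :: "ell2 \<Rightarrow> ell2 \<Rightarrow> ell2" is "\<lambda>x y n. x n - y n"
  using summable_square_add[of _ "\<lambda>n. - _ n"] by simp
lift_definition scaleR_ell2 :: "real \<Rightarrow> ell2 \<Rightarrow> ell2" is "\<lambda>c x n. c * x n"
  by (simp add: power_mult_distrib summable_mult)
definition inner_ell2 :: "ell2 \<Rightarrow> ell2 \<Rightarrow> real" where
  "inner_ell2 x y = (\<Sum>n. coord x n * coord y n)"
definition norm_ell2 :: "ell2 \<Rightarrow> real" where "norm_ell2 x = sqrt (x \<bullet> x)"
definition sgn_ell2 :: "ell2 \<Rightarrow> ell2" where "sgn_ell2 x = inverse (norm x) *\<^sub>R x"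
definition dist_ell2 :: "ell2 \<Rightarrow> ell2 \<Rightarrow> real" where "dist_ell2 x y = norm (x - y)"
definition [code del]:
  "(uniformity :: (ell2 \<times> ell2) filter) = (INF e\<in>{0 <..}. principal {(x, y). dist x y < e})"
definition open_ell2 :: "ell2 set \<Rightarrow> bool" where
  "open_ell2 U \<longleftrightarrow> (\<forall>x\<in>U. \<forall>\<^sub>F (x', y) in uniformity. x' = x \<longrightarrow> y \<in> U)"

instance
proof
  fix x y z :: ell2 and c :: real
  have summ: "summable (\<lambda>n. coord x n * coord y n)" for x y
    by (intro summable_square_mult summable_coord)
  show "x \<bullet> y = y \<bullet> x" by (simp add: inner_ell2_def mult.commute)
  show "(x + y) \<bullet> z = x \<bullet> z + y \<bullet> z"
    by (simp add: inner_ell2_def plus_ell2.rep_eq distrib_right suminf_add summ)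
  show "(c *\<^sub>R x) \<bullet> y = c * (x \<bullet> y)"
    by (simp add: inner_ell2_def scaleR_ell2.rep_eq mult.assoc suminf_mult summ)
  show "0 \<le> x \<bullet> x"
    unfolding inner_ell2_def by (intro suminf_nonneg summ) simp
  show "(x \<bullet> x = 0) = (x = 0)"
    unfolding inner_ell2_def using suminf_eq_zero_iff[OF summ[of x x]]
    by (auto simp: zero_ell2.rep_eq intro: ell2_eqI)
qed (auto simp: norm_ell2_def sgn_ell2_def dist_ell2_def uniformity_ell2_def open_ell2_def
      plus_ell2.rep_eq zero_ell2.rep_eq uminus_ell2.rep_eq minus_ell2.rep_eq scaleR_ell2.rep_eq
      algebra_simps intro: ell2_eqI)

end

lemma coord_simps [simp]:
  "coord 0 n = 0" "coord (x + y) n = coord x n + coord y n" "coord (- x) n = - coord x n"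
  "coord (x - y) n = coord x n - coord y n" "coord (c *\<^sub>R x) n = c * coord x n"
  by (simp_all add: plus_ell2.rep_eq zero_ell2.rep_eq uminus_ell2.rep_eq minus_ell2.rep_eq
      scaleR_ell2.rep_eq)

lemma inner_ell2_sums: "(\<lambda>n. coord x n * coord y n) sums (x \<bullet> y)"
  unfolding inner_ell2_def by (intro summable_sums summable_square_mult summable_coord)

lemma norm_ell2_sums: "(\<lambda>n. (coord x n)\<^sup>2) sums (norm x)\<^sup>2"
  using inner_ell2_sums[of x x] by (simp add: power2_norm_eq_inner power2_eq_square[of "coord x _"])

lemma sum_coord_le_norm: "(\<Sum>i<M. (coord x i)\<^sup>2) \<le> (norm x)\<^sup>2"
  unfolding sums_unique[OF norm_ell2_sums] by (intro sum_le_suminf summable_coord) auto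

lemma abs_coord_le_norm: "\<bar>coord x n\<bar> \<le> norm x"
proof -
  have "(coord x n)\<^sup>2 \<le> (\<Sum>i<Suc n. (coord x i)\<^sup>2)" by (simp add: sum_nonneg)
  also have "\<dots> \<le> (norm x)\<^sup>2" by (rule sum_coord_le_norm)
  finally show ?thesis by (simp add: abs_le_square_iff[symmetric])
qed

lemma norm_ell2_le:
  assumes "\<And>n. \<bar>coord x n\<bar> \<le> \<bar>coord y n\<bar>"
  shows "norm x \<le> norm y"
proof -
  have "(norm x)\<^sup>2 \<le> (norm y)\<^sup>2"
    by (rule sums_le[OF _ norm_ell2_sums norm_ell2_sums]) (use assms in \<open>simp add: abs_le_square_iff\<close>)
  then show ?thesis by simp
qed

text \<open>Coordinatewise limits exist at once; bounds on partial sums that are uniform in their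
  length then give both square-summability of the limit and convergence in norm.\<close>

instance ell2 :: complete_space
proof
  fix X :: "nat \<Rightarrow> ell2" assume X: "Cauchy X"
  have "Cauchy (\<lambda>k. coord (X k) n)" for n
  proof (rule CauchyI)
    fix e :: real assume "e > 0"
    then obtain M where "\<forall>j\<ge>M. \<forall>k\<ge>M. norm (X j - X k) < e" using X unfolding Cauchy_iff by blast
    then show "\<exists>M. \<forall>m\<ge>M. \<forall>k\<ge>M. norm (coord (X m) n - coord (X k) n) < e"
      using abs_coord_le_norm[of "_ - _" n] by (metis coord_simps(4) order_le_less_trans real_norm_def)
  qed
  then have "\<exists>l. (\<lambda>k. coord (X k) n) \<longlonglongrightarrow> l" for n
    using Cauchy_convergent convergent_def by blast
  then obtain l where l: "\<And>n. (\<lambda>k. coord (X k) n) \<longlonglongrightarrow> l n" by metis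
  have part: "\<exists>N. \<forall>j\<ge>N. \<forall>M. (\<Sum>i<M. (coord (X j) i - l i)\<^sup>2) \<le> e\<^sup>2" if "e > 0" for e
  proof -
    obtain N where N: "\<And>j k. j \<ge> N \<Longrightarrow> k \<ge> N \<Longrightarrow> norm (X j - X k) < e"
      using X \<open>e > 0\<close> unfolding Cauchy_iff by blast
    have "(\<Sum>i<M. (coord (X j) i - l i)\<^sup>2) \<le> e\<^sup>2" if j: "j \<ge> N" for j M
    proof (rule tendsto_le[OF _ tendsto_const])
      show "(\<lambda>k. \<Sum>i<M. (coord (X j) i - coord (X k) i)\<^sup>2) \<longlonglongrightarrow> (\<Sum>i<M. (coord (X j) i - l i)\<^sup>2)"
        by (intro tendsto_intros l)
      show "\<forall>\<^sub>F k in sequentially. (\<Sum>i<M. (coord (X j) i - coord (X k) i)\<^sup>2) \<le> e\<^sup>2"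
        using eventually_ge_at_top[of N]
      proof eventually_elim
        case (elim k)
        have "(\<Sum>i<M. (coord (X j - X k) i)\<^sup>2) \<le> (norm (X j - X k))\<^sup>2" by (rule sum_coord_le_norm)
        also have "\<dots> \<le> e\<^sup>2" using N[OF j elim] by (intro power_mono) auto
        finally show ?case by simp
      qed
    qed simp
    then show ?thesis by blast
  qed
  obtain N where N: "\<And>M. (\<Sum>i<M. (coord (X N) i - l i)\<^sup>2) \<le> 1\<^sup>2"
    using part[of 1] by auto
  have "summable (\<lambda>i. (coord (X N) i - l i)\<^sup>2)"
    by (rule summableI_nonneg_bounded[of _ "1\<^sup>2"]) (use N in auto)
  then have "summable (\<lambda>i. (coord (X N) i + (- (coord (X N) i - l i)))\<^sup>2)"
    by (intro summable_square_add summable_coord) (simp add: power2_commute)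
  then have suml: "summable (\<lambda>i. (l i)\<^sup>2)" by simp
  define L where "L = Abs_ell2 l"
  have L: "coord L i = l i" for i by (simp add: L_def coord_Abs_ell2 suml)
  have "X \<longlonglongrightarrow> L"
  proof (rule LIMSEQ_I)
    fix r :: real assume r: "r > 0"
    obtain N where N: "\<And>j M. j \<ge> N \<Longrightarrow> (\<Sum>i<M. (coord (X j) i - l i)\<^sup>2) \<le> (r/2)\<^sup>2"
      using part[of "r/2"] r by auto
    have "norm (X j - L) < r" if j: "j \<ge> N" for j
    proof -
      have "(norm (X j - L))\<^sup>2 \<le> (r/2)\<^sup>2"
        unfolding sums_unique[OF norm_ell2_sums]
        by (rule suminf_le_const[OF summable_coord]) (use N[OF j] in \<open>simp add: L\<close>)
      then have "norm (X j - L) \<le> r/2" by (rule power2_le_imp_le) (use r in simp)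
      then show ?thesis using r by linarith
    qed
    then show "\<exists>no. \<forall>n\<ge>no. norm (X n - L) < r" by blast
  qed
  then show "convergent X" by (auto simp: convergent_def)
qed

subsection \<open>Diagonal operators and the free Jacobi operator\<close>

text \<open>Meaningful for bounded \<open>d\<close>: otherwise the product sequence may fail to be
  square-summable, and \<open>Abs_ell2\<close> is then unspecified. Boundedness of \<open>d\<close>
  is therefore secured before each use.\<close>

definition diag_op :: "(nat \<Rightarrow> real) \<Rightarrow> ell2 \<Rightarrow> ell2" where
  "diag_op d x = Abs_ell2 (\<lambda>n. d n * coord x n)"

lemma coord_diag_op:
  assumes "Bseq d"
  shows "coord (diag_op d x) n = d n * coord x n"
proof -
  obtain K where K: "\<And>n. \<bar>d n\<bar> \<le> K" using assms unfolding Bseq_def by auto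
  have "summable (\<lambda>n. (d n * coord x n)\<^sup>2)"
  proof (rule summable_comparison_test')
    show "summable (\<lambda>n. K\<^sup>2 * (coord x n)\<^sup>2)" by (intro summable_mult summable_coord)
    show "norm ((d n * coord x n)\<^sup>2) \<le> K\<^sup>2 * (coord x n)\<^sup>2" for n
      using power_mono[OF K, of n 2] by (simp add: power_mult_distrib mult_right_mono)
  qed
  then show ?thesis by (simp add: diag_op_def coord_Abs_ell2)
qed

lemma bounded_linear_diag_op:
  assumes d: "Bseq d"
  shows "bounded_linear (diag_op d)"
proof -
  obtain K where K: "K > 0" "\<And>n. \<bar>d n\<bar> \<le> K" using assms unfolding Bseq_def by auto
  show ?thesis
  proof (rule bounded_linear_intro[where K = K])
    show "diag_op d (x + y) = diag_op d x + diag_op d y" for x y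
      by (rule ell2_eqI) (simp add: coord_diag_op[OF d] algebra_simps)
    show "diag_op d (c *\<^sub>R x) = c *\<^sub>R diag_op d x" for x c
      by (rule ell2_eqI) (simp add: coord_diag_op[OF d] algebra_simps)
    show "norm (diag_op d x) \<le> norm x * K" for x
    proof -
      have "norm (diag_op d x) \<le> norm (K *\<^sub>R x)"
        by (rule norm_ell2_le) (use K in \<open>auto simp: coord_diag_op[OF d] abs_mult intro!: mult_right_mono\<close>)
      then show ?thesis using K(1) by (simp add: mult.commute)
    qed
  qed
qed

lemma selfadjoint_diag_op: "Bseq d \<Longrightarrow> selfadjoint_op (diag_op d)"
  by (simp add: selfadjoint_op_def inner_ell2_def coord_diag_op mult_ac)

text \<open>Serves two ends: a small tail bound \<open>e\<close> yields compactness, and on vectors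
  that vanish below \<open>M\<close> the head disappears, so that the operator acts with norm at
  most \<open>e\<close>.\<close>

lemma norm_diag_op_head_tail:
  assumes d: "Bseq d" and e: "\<And>i. i \<ge> M \<Longrightarrow> \<bar>d i\<bar> \<le> e"
  shows "(norm (diag_op d x))\<^sup>2 \<le> (\<Sum>i<M. (d i * coord x i)\<^sup>2) + e\<^sup>2 * (norm x)\<^sup>2"
proof (rule sums_le)
  show "(\<lambda>i. (coord (diag_op d x) i)\<^sup>2) sums (norm (diag_op d x))\<^sup>2" by (rule norm_ell2_sums)
  show "(\<lambda>i. (if i \<in> {..<M} then (d i * coord x i)\<^sup>2 else 0) + e\<^sup>2 * (coord x i)\<^sup>2) sums
      ((\<Sum>i<M. (d i * coord x i)\<^sup>2) + e\<^sup>2 * (norm x)\<^sup>2)"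
    by (intro sums_add sums_mult norm_ell2_sums sums_If_finite_set) simp
  fix i
  show "(coord (diag_op d x) i)\<^sup>2
      \<le> (if i \<in> {..<M} then (d i * coord x i)\<^sup>2 else 0) + e\<^sup>2 * (coord x i)\<^sup>2"
  proof (cases "i < M")
    case False
    then have "(d i)\<^sup>2 \<le> e\<^sup>2" using power_mono[OF e, of i 2] by simp
    then show ?thesis using False by (simp add: coord_diag_op[OF d] power_mult_distrib mult_right_mono)
  qed (simp add: coord_diag_op[OF d])
qed

lemma compact_diag_op:
  assumes "d \<longlonglongrightarrow> 0"
  shows "compact_op (diag_op d)"
  unfolding compact_op_def
proof (intro allI impI)
  fix X :: "nat \<Rightarrow> ell2" assume X: "\<forall>n. norm (X n) \<le> 1"
  have d: "Bseq d" using assms by (intro convergent_imp_Bseq convergentI)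
  interpret D: bounded_linear "diag_op d" by (rule bounded_linear_diag_op[OF d])
  have bd: "norm (coord (X n) i) \<le> 1" for n i
    using abs_coord_le_norm[of "X n" i] X by (auto intro: order_trans)
  obtain r where r: "strict_mono r" "\<And>i. i \<in> UNIV \<Longrightarrow> \<exists>l. (\<lambda>n. coord (X (r n)) i) \<longlonglongrightarrow> l"
    by (rule function_convergent_subsequence[of "UNIV :: nat set" "\<lambda>n. coord (X n)" 1]) (use bd in blast)+
  have "Cauchy (\<lambda>n. diag_op d (X (r n)))"
  proof (rule CauchyI)
    fix e :: real assume e: "e > 0"
    \<comment> \<open>With \<open>norm ?y \<le> 2\<close> the tail contributes at most
      \<open>(e/4)\<^sup>2 * 2\<^sup>2 = e\<^sup>2 / 4\<close> and the head less than
      \<open>e\<^sup>2 / 2\<close>, together less than \<open>e\<^sup>2\<close>.\<close>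
    obtain M where M: "\<And>i. i \<ge> M \<Longrightarrow> \<bar>d i\<bar> \<le> e/4"
      using LIMSEQ_D[OF assms, of "e/4"] e by (auto intro: less_imp_le)
    obtain l where l: "\<And>i. (\<lambda>n. coord (X (r n)) i) \<longlonglongrightarrow> l i" using r(2) by (metis UNIV_I)
    have "(\<lambda>n. \<Sum>i<M. (d i * (coord (X (r n)) i - l i))\<^sup>2) \<longlonglongrightarrow> (\<Sum>i<M. (d i * (l i - l i))\<^sup>2)"
      by (intro tendsto_intros l)
    then have "\<forall>\<^sub>F n in sequentially. (\<Sum>i<M. (d i * (coord (X (r n)) i - l i))\<^sup>2) < e\<^sup>2 / 8"
      using e by (intro order_tendstoD) auto
    then obtain N where N: "\<And>n. n \<ge> N \<Longrightarrow> (\<Sum>i<M. (d i * (coord (X (r n)) i - l i))\<^sup>2) < e\<^sup>2 / 8"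
      by (auto simp: eventually_sequentially)
    have "norm (diag_op d (X (r m)) - diag_op d (X (r n))) < e" if mn: "m \<ge> N" "n \<ge> N" for m n
    proof -
      let ?y = "X (r m) - X (r n)"
      have ny: "(norm ?y)\<^sup>2 \<le> 2\<^sup>2"
      proof (rule power_mono)
        show "norm ?y \<le> 2"
          using norm_triangle_ineq4[of "X (r m)" "X (r n)"] X[rule_format, of "r m"] X[rule_format, of "r n"]
          by linarith
      qed simp
      have "(\<Sum>i<M. (d i * coord ?y i)\<^sup>2) \<le> (\<Sum>i<M. 2 * (d i * (coord (X (r m)) i - l i))\<^sup>2
           + 2 * (d i * (coord (X (r n)) i - l i))\<^sup>2)"
      proof (rule sum_mono)
        fix i
        have "(a - b)\<^sup>2 \<le> 2 * a\<^sup>2 + 2 * b\<^sup>2" for a b :: real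
          using zero_le_power2[of "a + b"] by (simp add: power2_eq_square algebra_simps)
        from this[of "d i * (coord (X (r m)) i - l i)" "d i * (coord (X (r n)) i - l i)"]
        show "(d i * coord ?y i)\<^sup>2 \<le> 2 * (d i * (coord (X (r m)) i - l i))\<^sup>2
           + 2 * (d i * (coord (X (r n)) i - l i))\<^sup>2"
          by (simp add: algebra_simps)
      qed
      also have "\<dots> < e\<^sup>2 / 2"
        using N[OF mn(1)] N[OF mn(2)] by (simp add: sum.distrib sum_distrib_left[symmetric])
      finally have "(norm (diag_op d ?y))\<^sup>2 < e\<^sup>2 / 2 + (e/4)\<^sup>2 * (norm ?y)\<^sup>2"
        using norm_diag_op_head_tail[OF d M, of M ?y] by simp
      also have "\<dots> \<le> e\<^sup>2 / 2 + (e/4)\<^sup>2 * 2\<^sup>2"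
        using ny by (intro add_left_mono mult_left_mono) auto
      also have "\<dots> \<le> e\<^sup>2" by (simp add: power_divide)
      finally have "norm (diag_op d ?y) < e" by (rule power2_less_imp_less) (use e in simp)
      then show ?thesis by (simp add: D.diff)
    qed
    then show "\<exists>M. \<forall>m\<ge>M. \<forall>n\<ge>M. norm (diag_op d (X (r m)) - diag_op d (X (r n))) < e" by blast
  qed
  then show "\<exists>r. strict_mono r \<and> convergent (\<lambda>n. diag_op d (X (r n)))"
    using r(1) Cauchy_convergent by blast
qed

definition shift_left :: "ell2 \<Rightarrow> ell2" where
  "shift_left x = Abs_ell2 (\<lambda>n. coord x (Suc n))"

definition shift_right :: "ell2 \<Rightarrow> ell2" where
  "shift_right x = Abs_ell2 (\<lambda>n. case n of 0 \<Rightarrow> 0 | Suc m \<Rightarrow> coord x m)"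

text \<open>Multiplication by cos x, acting on the coefficients of sin ((n + 1) x): twice cos x sin
  (k x) is sin ((k + 1) x) + sin ((k - 1) x), and sin 0 = 0 accounts for the zero entry at the
  boundary.\<close>

definition free_jacobi :: "ell2 \<Rightarrow> ell2" where
  "free_jacobi x = (1/2) *\<^sub>R (shift_left x + shift_right x)"

lemma coord_shift_left [simp]: "coord (shift_left x) n = coord x (Suc n)"
  unfolding shift_left_def
  by (subst coord_Abs_ell2) (use summable_coord[of x] in \<open>simp_all add: summable_Suc_iff[of "\<lambda>n. (coord x n)\<^sup>2"]\<close>)

lemma coord_shift_right [simp]:
  "coord (shift_right x) n = (case n of 0 \<Rightarrow> 0 | Suc m \<Rightarrow> coord x m)"
  unfolding shift_right_def
  by (subst coord_Abs_ell2, subst summable_Suc_iff[symmetric]) (use summable_coord[of x] in simp_all)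

lemma coord_free_jacobi:
  "coord (free_jacobi x) n = (coord x (Suc n) + (case n of 0 \<Rightarrow> 0 | Suc m \<Rightarrow> coord x m)) / 2"
  by (simp add: free_jacobi_def)

lemma norm_shift_left: "norm (shift_left x) \<le> norm x"
proof -
  have "(\<lambda>n. (coord x (Suc n))\<^sup>2) sums (norm (shift_left x))\<^sup>2"
    using norm_ell2_sums[of "shift_left x"] by simp
  then have "(\<lambda>n. (coord x n)\<^sup>2) sums ((norm (shift_left x))\<^sup>2 + (coord x 0)\<^sup>2)"
    by (rule sums_Suc)
  then have "(norm x)\<^sup>2 = (norm (shift_left x))\<^sup>2 + (coord x 0)\<^sup>2"
    using norm_ell2_sums sums_unique2 by blast
  then have "(norm (shift_left x))\<^sup>2 \<le> (norm x)\<^sup>2" by simp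
  then show ?thesis by simp
qed

lemma norm_shift_right: "norm (shift_right x) = norm x"
proof -
  have "(\<lambda>n. (coord (shift_right x) (Suc n))\<^sup>2) sums (norm x)\<^sup>2"
    using norm_ell2_sums[of x] by simp
  then have "(\<lambda>n. (coord (shift_right x) n)\<^sup>2) sums (norm x)\<^sup>2"
    by (subst (asm) sums_Suc_iff) simp
  then have "(norm (shift_right x))\<^sup>2 = (norm x)\<^sup>2"
    using norm_ell2_sums sums_unique2 by blast
  then show ?thesis by simp
qed

lemma inner_shift_left: "shift_left x \<bullet> y = x \<bullet> shift_right y"
proof -
  have "(\<lambda>n. coord x (Suc n) * coord (shift_right y) (Suc n)) sums (shift_left x \<bullet> y)"
    using inner_ell2_sums[of "shift_left x" y] by simp
  then have "(\<lambda>n. coord x n * coord (shift_right y) n) sums (shift_left x \<bullet> y)"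
    by (subst (asm) sums_Suc_iff[of "\<lambda>n. coord x n * coord (shift_right y) n"]) simp
  then show ?thesis using inner_ell2_sums sums_unique2 by blast
qed

lemma norm_free_jacobi: "norm (free_jacobi x) \<le> norm x"
  using norm_triangle_ineq[of "shift_left x" "shift_right x"] norm_shift_left[of x] norm_shift_right[of x]
  by (simp add: free_jacobi_def)

lemma bounded_linear_free_jacobi: "bounded_linear free_jacobi"
proof (rule bounded_linear_intro[where K = 1])
  show "free_jacobi (x + y) = free_jacobi x + free_jacobi y" for x y
    by (rule ell2_eqI) (simp add: coord_free_jacobi field_simps split: nat.splits)
  show "free_jacobi (c *\<^sub>R x) = c *\<^sub>R free_jacobi x" for x c
    by (rule ell2_eqI) (simp add: coord_free_jacobi field_simps split: nat.splits)
qed (simp add: norm_free_jacobi)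

lemma selfadjoint_free_jacobi: "selfadjoint_op free_jacobi"
proof -
  have "free_jacobi x \<bullet> y = x \<bullet> free_jacobi y" for x y
    using inner_shift_left[of x y] inner_shift_left[of y x]
    by (simp add: free_jacobi_def inner_add_left inner_add_right inner_commute)
  then show ?thesis by (simp add: selfadjoint_op_def)
qed

text \<open>For \<open>C = free_jacobi\<close> the operator \<open>J\<close> is multiplication by r
  - a cos x in sine coefficients, and \<open>R\<close> is multiplication by the reciprocal. The
  contraction principle with factor \<open>a / r\<close> solves \<open>J x = y\<close>; the lower
  bound \<open>r - a\<close> on \<open>J\<close> gives injectivity and bounds
  \<open>R\<close>.\<close>

lemma contraction_resolvent_exists:
  fixes C :: "'a::{real_inner, complete_space} \<Rightarrow> 'a"
  assumes C: "bounded_linear C" "selfadjoint_op C" "\<And>x. norm (C x) \<le> norm x" and a: "0 < a" "a < r"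
  obtains R where "bounded_linear R" "selfadjoint_op R"
    "\<And>x. r *\<^sub>R R x - a *\<^sub>R C (R x) = x" "\<And>x. R (r *\<^sub>R x - a *\<^sub>R C x) = x"
proof -
  interpret C: bounded_linear C by fact
  define J where "J x = r *\<^sub>R x - a *\<^sub>R C x" for x
  have J_diff: "J (x - y) = J x - J y" and J_add: "J (x + y) = J x + J y"
    and J_scale: "J (c *\<^sub>R x) = c *\<^sub>R J x" for x y c
    by (simp_all add: J_def C.diff C.add C.scaleR algebra_simps)
  have lower: "(r - a) * norm x \<le> norm (J x)" for x
  proof -
    have "norm (r *\<^sub>R x) - norm (a *\<^sub>R C x) \<le> norm (J x)" unfolding J_def by (rule norm_triangle_ineq2)
    moreover have "a * norm (C x) \<le> a * norm x" using C(3) a by (intro mult_left_mono) auto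
    moreover have "norm (r *\<^sub>R x) = r * norm x" "norm (a *\<^sub>R C x) = a * norm (C x)" using a by simp_all
    ultimately have "r * norm x - a * norm x \<le> norm (J x)" by linarith
    then show ?thesis by (simp add: left_diff_distrib)
  qed
  have inj: "x = y" if "J x = J y" for x y
    using lower[of "x - y"] that a by (simp add: J_diff mult_le_0_iff)
  have "\<exists>x. J x = y" for y
  proof -
    have "\<exists>!x. (y + a *\<^sub>R C x) /\<^sub>R r = x"
    proof (rule banach_fix_type[where c = "a / r"])
      show "\<forall>x z. dist ((y + a *\<^sub>R C x) /\<^sub>R r) ((y + a *\<^sub>R C z) /\<^sub>R r) \<le> a / r * dist x z"
      proof (intro allI)
        fix x z
        have "(y + a *\<^sub>R C x) /\<^sub>R r - (y + a *\<^sub>R C z) /\<^sub>R r = (a / r) *\<^sub>R C (x - z)"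
          by (simp add: C.diff algebra_simps divide_inverse)
        then show "dist ((y + a *\<^sub>R C x) /\<^sub>R r) ((y + a *\<^sub>R C z) /\<^sub>R r) \<le> a / r * dist x z"
          using a C(3)[of "x - z"] by (simp add: dist_norm divide_right_mono mult_left_mono)
      qed
    qed (use a in auto)
    then obtain x where "(y + a *\<^sub>R C x) /\<^sub>R r = x" by blast
    then have "r *\<^sub>R x = r *\<^sub>R ((y + a *\<^sub>R C x) /\<^sub>R r)" by simp
    then have "r *\<^sub>R x = y + a *\<^sub>R C x" using a by (simp only: scaleR_scaleR) simp
    then show ?thesis by (auto simp: J_def intro!: exI[of _ x])
  qed
  then obtain R where R: "\<And>y. J (R y) = y" by metis
  have RJ: "R (J x) = x" for x by (rule inj) (rule R)
  have "bounded_linear R"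
  proof (rule bounded_linear_intro[where K = "1 / (r - a)"])
    show "R (x + y) = R x + R y" for x y by (rule inj) (simp add: R J_add)
    show "R (c *\<^sub>R x) = c *\<^sub>R R x" for x c by (rule inj) (simp add: R J_scale)
    show "norm (R x) \<le> norm x * (1 / (r - a))" for x
      using lower[of "R x"] a by (simp add: R field_simps)
  qed
  moreover have "selfadjoint_op R"
    unfolding selfadjoint_op_def
  proof (intro allI)
    fix x y
    have "J u \<bullet> v = u \<bullet> J v" for u v
      using C(2) by (simp add: J_def selfadjoint_op_def inner_diff_left inner_diff_right)
    from this[of "R x" "R y"] show "R x \<bullet> y = x \<bullet> R y" by (simp add: R)
  qed
  ultimately show ?thesis using that R RJ unfolding J_def by blast
qed

section \<open>A Jacobi pencil\<close>

lemma compact_op_compose: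
  assumes T: "compact_op T" and L: "bounded_linear L"
  shows "compact_op (\<lambda>x. L (T x))"
  unfolding compact_op_def
proof (intro allI impI)
  fix X :: "nat \<Rightarrow> 'a" assume "\<forall>n. norm (X n) \<le> 1"
  then obtain r y where "strict_mono r" and y: "(\<lambda>n. T (X (r n))) \<longlonglongrightarrow> y"
    using T unfolding compact_op_def convergent_def by blast
  moreover have "(\<lambda>n. L (T (X (r n)))) \<longlonglongrightarrow> L y"
    by (rule bounded_linear.tendsto[OF L y])
  ultimately show "\<exists>r. strict_mono r \<and> convergent (\<lambda>n. L (T (X (r n))))"
    by (auto simp: convergent_def)
qed

text \<open>Summing the inequality over \<open>i < M\<close> bounds the partial sum
  \<open>?S\<close> by \<open>2 * c * (?S + B)\<close>, which bounds \<open>?S\<close> itself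
  because \<open>2 * c < 1\<close>.\<close>

lemma summable_of_strict_midpoint_bound:
  fixes y :: "nat \<Rightarrow> real"
  assumes y: "\<And>i. 0 \<le> y i" "\<And>i. y i \<le> B" and c: "0 \<le> c" "c < 1/2"
    and mid: "\<And>i. y (Suc i) \<le> c * (y (Suc (Suc i)) + y i)"
  shows "summable y"
proof -
  have "summable (\<lambda>i. y (Suc i))"
  proof (rule summableI_nonneg_bounded)
    fix M
    let ?S = "\<Sum>i<M. y (Suc i)"
    have tel: "(\<Sum>i<M. z (Suc i)) = (\<Sum>i<M. z i) + z M - z 0" for z :: "nat \<Rightarrow> real"
      by (induction M) auto
    have "?S \<le> (\<Sum>i<M. c * (y (Suc (Suc i)) + y i))" by (intro sum_mono mid)
    also have "\<dots> = c * ((\<Sum>i<M. y (Suc (Suc i))) + (\<Sum>i<M. y i))"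
      by (simp add: sum_distrib_left[symmetric] sum.distrib)
    also have "\<dots> \<le> c * ((?S + B) + (?S + B))"
    proof (intro mult_left_mono add_mono)
      show "(\<Sum>i<M. y (Suc (Suc i))) \<le> ?S + B"
        using tel[of "\<lambda>i. y (Suc i)"] y(1)[of "Suc 0"] y(2)[of "Suc M"] by simp
      show "(\<Sum>i<M. y i) \<le> ?S + B"
        using tel[of y] y(1)[of M] y(2)[of 0] by simp
    qed (fact c)
    finally have "(1 - 2 * c) * ?S \<le> 2 * c * B" by (simp add: algebra_simps)
    then show "?S \<le> 2 * c * B / (1 - 2 * c)" using c by (simp add: field_simps)
  qed (use y in auto)
  then show ?thesis by (simp only: summable_Suc_iff)
qed

text \<open>Turns square-summable solutions into absolutely summable ones, as continuous
  eigenfunctions require. For large \<open>n\<close> the factor \<open>lam + r * \<beta> n\<close>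
  stays away from 0, so the first equation bounds \<open>f\<close> by \<open>K\<close> times
  \<open>p\<close>. Then \<open>\<alpha> n * f n\<close> costs at most \<open>(r - a) / 2\<close>
  times \<open>p\<close>, and the second equation becomes the midpoint bound with
  \<open>c = a / (r + a)\<close>.\<close>

lemma jacobi_pencil_decay:
  fixes f p \<alpha> \<beta> :: "nat \<Rightarrow> real"
  assumes a: "0 < a" "a < r" and \<alpha>: "\<And>n. 0 < \<alpha> n" "\<alpha> \<longlonglongrightarrow> 0" and \<beta>: "\<beta> \<longlonglongrightarrow> 0"
    and lam: "lam \<noteq> 0" and p: "\<And>n. \<bar>p n\<bar> \<le> B"
    and eq1: "\<And>n. lam * f n = (r\<^sup>2 - a\<^sup>2) * p n - r * \<beta> n * f n"
    and eq2: "\<And>n. r * p n - a * ((p (Suc n) + (case n of 0 \<Rightarrow> 0 | Suc m \<Rightarrow> p m)) / 2) = \<alpha> n * f n"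
  shows "summable (\<lambda>n. \<bar>p n\<bar>)" "summable (\<lambda>n. \<bar>f n\<bar>)"
proof -
  define K where "K = 2 * (r\<^sup>2 - a\<^sup>2) / \<bar>lam\<bar>"
  have ra: "a\<^sup>2 < r\<^sup>2" using a by (intro power_strict_mono) auto
  have K: "K > 0" using ra lam by (simp add: K_def)
  have "(\<lambda>n. lam + r * \<beta> n) \<longlonglongrightarrow> lam + r * 0" by (intro tendsto_intros \<beta>)
  then have "(\<lambda>n. \<bar>lam + r * \<beta> n\<bar>) \<longlonglongrightarrow> \<bar>lam\<bar>" by (simp add: tendsto_rabs)
  then have ev1: "\<forall>\<^sub>F n in sequentially. \<bar>lam + r * \<beta> n\<bar> > \<bar>lam\<bar> / 2"
    using lam by (intro order_tendstoD) auto
  have "(\<lambda>n. \<alpha> n * K) \<longlonglongrightarrow> 0 * K" by (intro tendsto_intros \<alpha>)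
  then have ev2: "\<forall>\<^sub>F n in sequentially. \<alpha> n * K < (r - a) / 2"
    using a by (intro order_tendstoD) auto
  obtain N where N: "\<And>n. n \<ge> N \<Longrightarrow> \<bar>lam + r * \<beta> n\<bar> > \<bar>lam\<bar> / 2" "\<And>n. n \<ge> N \<Longrightarrow> \<alpha> n * K < (r - a) / 2"
    using eventually_conj[OF ev1 ev2] by (auto simp: eventually_sequentially)
  have f_le: "\<bar>f n\<bar> \<le> K * \<bar>p n\<bar>" if "n \<ge> N" for n
  proof -
    have "(lam + r * \<beta> n) * f n = (r\<^sup>2 - a\<^sup>2) * p n" using eq1[of n] by (simp add: algebra_simps)
    then have "\<bar>lam + r * \<beta> n\<bar> * \<bar>f n\<bar> = (r\<^sup>2 - a\<^sup>2) * \<bar>p n\<bar>"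
      using ra by (metis abs_mult abs_of_pos diff_gt_0_iff_gt)
    moreover have "\<bar>lam\<bar> / 2 * \<bar>f n\<bar> \<le> \<bar>lam + r * \<beta> n\<bar> * \<bar>f n\<bar>"
      using N(1)[OF that] by (intro mult_right_mono) auto
    ultimately show ?thesis using lam by (simp add: K_def field_simps)
  qed
  have mid: "\<bar>p (Suc n)\<bar> \<le> a / (r + a) * (\<bar>p (Suc (Suc n))\<bar> + \<bar>p n\<bar>)" if n: "n \<ge> N" for n
  proof -
    have "r * p (Suc n) = a * ((p (Suc (Suc n)) + p n) / 2) + \<alpha> (Suc n) * f (Suc n)"
      using eq2[of "Suc n"] by simp
    then have "\<bar>r * p (Suc n)\<bar> \<le> \<bar>a * ((p (Suc (Suc n)) + p n) / 2)\<bar> + \<bar>\<alpha> (Suc n) * f (Suc n)\<bar>"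
      by (simp only: abs_triangle_ineq)
    also have "\<bar>a * ((p (Suc (Suc n)) + p n) / 2)\<bar> \<le> a / 2 * (\<bar>p (Suc (Suc n))\<bar> + \<bar>p n\<bar>)"
      using a by (simp add: abs_mult mult_left_mono)
    also have "\<bar>\<alpha> (Suc n) * f (Suc n)\<bar> \<le> \<alpha> (Suc n) * (K * \<bar>p (Suc n)\<bar>)"
      using f_le[of "Suc n"] \<alpha>(1)[of "Suc n"] n by (simp add: abs_mult)
    also have "\<dots> \<le> (r - a) / 2 * \<bar>p (Suc n)\<bar>"
      unfolding mult.assoc[symmetric] using N(2)[of "Suc n"] n by (intro mult_right_mono) auto
    finally have "(r + a) * \<bar>p (Suc n)\<bar> \<le> a * (\<bar>p (Suc (Suc n))\<bar> + \<bar>p n\<bar>)"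
      using a by (simp add: abs_mult field_simps)
    then show ?thesis using a by (simp add: field_simps)
  qed
  have "summable (\<lambda>i. \<bar>p (i + N)\<bar>)"
  proof (rule summable_of_strict_midpoint_bound[where c = "a / (r + a)" and B = B])
    show "\<bar>p (Suc i + N)\<bar> \<le> a / (r + a) * (\<bar>p (Suc (Suc i) + N)\<bar> + \<bar>p (i + N)\<bar>)" for i
      using mid[of "i + N"] by simp
    show "a / (r + a) < 1/2" using a by (simp add: field_simps)
  qed (use a p in auto)
  then show sp: "summable (\<lambda>n. \<bar>p n\<bar>)"
    by (subst (asm) summable_iff_shift[of "\<lambda>n. \<bar>p n\<bar>"])
  show "summable (\<lambda>n. \<bar>f n\<bar>)"
    by (rule summable_comparison_test'[OF summable_mult[OF sp], of N]) (use f_le in auto)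
qed

section \<open>Test vectors: separated blocks that are almost eigenvectors of the free Jacobi
  operator\<close>

context
  fixes s :: real and L M :: nat
  assumes s: "s = 1 \<or> s = -1" and L: "L \<ge> 1"
begin

text \<open>The offset \<open>M + 1\<close> keeps the blocks clear of the low indices even after a
  coupling of neighbours. The period \<open>L + 4\<close> leaves gaps of four indices, so the
  errors, which spill one index beyond each end of a block, have disjoint supports too.\<close>

definition blk_start :: "nat \<Rightarrow> nat" where "blk_start k = M + 1 + k * (L + 4)"

text \<open>A truncation of the sequence \<open>s ^ n\<close>, which is bounded but not
  square-summable and satisfies \<open>(x (n+1) + x (n-1)) / 2 = s * x n\<close>.\<close>

definition blk :: "nat \<Rightarrow> ell2" where
  "blk k = Abs_ell2 (\<lambda>n. if blk_start k \<le> n \<and> n < blk_start k + L then s ^ n else 0)"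

lemma coord_blk: "coord (blk k) n = (if blk_start k \<le> n \<and> n < blk_start k + L then s ^ n else 0)"
  unfolding blk_def
  by (subst coord_Abs_ell2)
    (auto intro!: summable_finite[of "{blk_start k..<blk_start k + L}"])

lemma blk_start_separated:
  assumes "k \<noteq> l"
  shows "blk_start k + L + 3 < blk_start l \<or> blk_start l + L + 3 < blk_start k"
proof -
  have "blk_start k + L + 3 < blk_start l" if "k < l" for k l
  proof -
    have "Suc k * (L + 4) \<le> l * (L + 4)" using that by (intro mult_le_mono1) simp
    then show ?thesis unfolding blk_start_def by simp
  qed
  then show ?thesis using assms by (metis linorder_neqE_nat)
qed

lemma blk_err_support:
  assumes "n \<notin> {blk_start k - 1, blk_start k, blk_start k + L - 1, blk_start k + L}"
  shows "coord (free_jacobi (blk k) - s *\<^sub>R blk k) n = 0"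
proof (cases n)
  case 0
  then show ?thesis using assms by (auto simp: coord_free_jacobi coord_blk blk_start_def)
next
  case (Suc m)
  have s2: "s * s = 1" using s by auto
  have "s ^ Suc n = s * s ^ n" "s * s ^ n = s ^ m" using Suc s2 by (simp_all add: mult.assoc[symmetric])
  moreover have "(blk_start k \<le> n \<and> n < blk_start k + L \<longrightarrow>
       blk_start k \<le> Suc n \<and> Suc n < blk_start k + L \<and> blk_start k \<le> m \<and> m < blk_start k + L) \<and>
     (\<not> (blk_start k \<le> n \<and> n < blk_start k + L) \<longrightarrow>
       \<not> (blk_start k \<le> Suc n \<and> Suc n < blk_start k + L) \<and> \<not> (blk_start k \<le> m \<and> m < blk_start k + L))"
    using assms Suc L by auto
  ultimately show ?thesis by (auto simp: coord_free_jacobi coord_blk Suc)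
qed

lemma abs_coord_blk: "\<bar>coord (blk k) n\<bar> \<le> 1"
  using s by (auto simp: coord_blk power_abs[symmetric])

lemma norm_blk: "(norm (blk k))\<^sup>2 = L"
proof -
  have "s\<^sup>2 = 1" using s by auto
  then have "(s ^ n)\<^sup>2 = 1" for n by (simp only: power_commutes power_mult[symmetric] mult.commute[of n 2])
      (simp only: power_mult power_one)
  then have "(\<lambda>n. (coord (blk k) n)\<^sup>2) = (\<lambda>n. if n \<in> {blk_start k..<blk_start k + L} then 1 else 0)"
    by (auto simp: coord_blk fun_eq_iff)
  then have "(\<lambda>n. (coord (blk k) n)\<^sup>2) sums (\<Sum>n\<in>{blk_start k..<blk_start k + L}. 1)"
    using sums_If_finite_set[of "{blk_start k..<blk_start k + L}" "\<lambda>n. 1::real"] by simp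
  then have "(norm (blk k))\<^sup>2 = (\<Sum>n\<in>{blk_start k..<blk_start k + L}. 1)"
    by (rule sums_unique2[OF norm_ell2_sums])
  then show ?thesis by simp
qed

text \<open>Inside a block \<open>s * s = 1\<close> makes the neighbours average to \<open>s\<close>
  times the entry, so only four boundary entries survive, each of modulus at most 2. The bound 16
  does not grow with \<open>L\<close>, whereas the squared norm of the block is
  \<open>L\<close>.\<close>

lemma norm_blk_err: "(norm (free_jacobi (blk k) - s *\<^sub>R blk k))\<^sup>2 \<le> 16"
proof -
  let ?e = "free_jacobi (blk k) - s *\<^sub>R blk k"
  let ?A = "{blk_start k - 1, blk_start k, blk_start k + L - 1, blk_start k + L}"
  have le2: "(coord ?e n)\<^sup>2 \<le> 4" for n
  proof -
    have "\<bar>coord (free_jacobi (blk k)) n\<bar> \<le> 1"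
      using abs_coord_blk[of k "Suc n"] abs_coord_blk[of k "n - 1"]
      by (auto simp: coord_free_jacobi split: nat.splits)
    moreover have "\<bar>s * coord (blk k) n\<bar> \<le> 1" using abs_coord_blk[of k n] s by auto
    ultimately have "\<bar>coord ?e n\<bar> \<le> 2" by simp
    then have "\<bar>coord ?e n\<bar>\<^sup>2 \<le> 2\<^sup>2" by (intro power_mono) auto
    then show ?thesis by simp
  qed
  have "(\<lambda>n. (coord ?e n)\<^sup>2) sums (\<Sum>n\<in>?A. (coord ?e n)\<^sup>2)"
    using blk_err_support[of _ k] by (intro sums_finite) (auto simp del: coord_simps)
  then have "(norm ?e)\<^sup>2 = (\<Sum>n\<in>?A. (coord ?e n)\<^sup>2)"
    using norm_ell2_sums sums_unique2 by blast
  also have "\<dots> \<le> (\<Sum>n\<in>?A. 4)" by (intro sum_mono le2)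
  also have "\<dots> \<le> 16"
  proof -
    have "card ?A \<le> 4" by (intro card_insert_le_m1) auto
    then show ?thesis by simp
  qed
  finally show ?thesis .
qed

lemma inner_ell2_disjoint:
  assumes "\<And>n. coord x n = 0 \<or> coord y n = 0"
  shows "x \<bullet> y = 0"
proof -
  have "(\<lambda>n. coord x n * coord y n) = (\<lambda>n. 0)" using assms by auto
  then show ?thesis by (simp add: inner_ell2_def)
qed

lemma inner_blk: "k \<noteq> l \<Longrightarrow> blk k \<bullet> blk l = 0"
  using blk_start_separated[of k l] by (intro inner_ell2_disjoint) (auto simp: coord_blk)

lemma inner_blk_err:
  assumes "k \<noteq> l"
  shows "(free_jacobi (blk k) - s *\<^sub>R blk k) \<bullet> (free_jacobi (blk l) - s *\<^sub>R blk l) = 0"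
proof (rule inner_ell2_disjoint)
  fix n
  have "\<not> (n \<in> {blk_start k - 1, blk_start k, blk_start k + L - 1, blk_start k + L}
      \<and> n \<in> {blk_start l - 1, blk_start l, blk_start l + L - 1, blk_start l + L})"
    using blk_start_separated[OF assms] by (auto simp del: One_nat_def)
  then show "coord (free_jacobi (blk k) - s *\<^sub>R blk k) n = 0
      \<or> coord (free_jacobi (blk l) - s *\<^sub>R blk l) n = 0"
    using blk_err_support[of n k] blk_err_support[of n l] by blast
qed

lemma blk_nonzero: "blk k \<noteq> 0"
  using norm_blk[of k] L by auto

lemma inj_blk: "inj blk"
proof (rule injI)
  fix k l assume "blk k = blk l"
  then show "k = l" using inner_blk[of k l] blk_nonzero[of l] by auto
qed

lemma span_blk_not_finite_dimensional:
  assumes "finite B"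
  shows "\<not> range blk \<subseteq> span B"
proof
  assume sub: "range blk \<subseteq> span B"
  have "pairwise orthogonal (range blk)"
    by (auto simp: pairwise_def orthogonal_def dest!: inner_blk intro: inner_blk)
  then have "independent (range blk)"
    by (intro pairwise_orthogonal_independent) (use blk_nonzero in \<open>auto simp: image_iff\<close>)
  then have "finite (range blk)" using independent_span_bound[OF assms _ sub] by blast
  then show False using inj_blk finite_imageD by blast
qed

text \<open>The blocks are mutually orthogonal and so are their errors; Pythagoras therefore carries
  the relative error \<open>16 / L\<close> of one block over to every linear combination, whatever
  the number of blocks.\<close>

lemma span_blk_almost_eigenvector:
  assumes "p \<in> span (range blk)"
  shows "(norm (free_jacobi p - s *\<^sub>R p))\<^sup>2 \<le> 16 / L * (norm p)\<^sup>2"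
proof -
  interpret C: bounded_linear free_jacobi by (rule bounded_linear_free_jacobi)
  obtain t c where t: "finite t" "t \<subseteq> range blk" "p = (\<Sum>x\<in>t. c x *\<^sub>R x)"
    using assms unfolding span_explicit by blast
  obtain A where A: "t = blk ` A" using t(2) by (auto simp: subset_image_iff)
  have injA: "inj_on blk A" using inj_blk by (rule inj_on_subset) simp
  have finA: "finite A" using t(1) A injA by (simp add: finite_image_iff)
  define d where "d k = c (blk k)" for k
  have p: "p = (\<Sum>k\<in>A. d k *\<^sub>R blk k)"
    using t(3) by (simp add: A sum.reindex[OF injA] d_def)
  have e: "free_jacobi p - s *\<^sub>R p = (\<Sum>k\<in>A. d k *\<^sub>R (free_jacobi (blk k) - s *\<^sub>R blk k))"
    by (simp add: p C.sum C.scaleR scaleR_sum_right sum_subtractf[symmetric] scaleR_diff_right mult.commute)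
  have "(norm (free_jacobi p - s *\<^sub>R p))\<^sup>2
      = (\<Sum>k\<in>A. (norm (d k *\<^sub>R (free_jacobi (blk k) - s *\<^sub>R blk k)))\<^sup>2)"
    unfolding e using inner_blk_err
    by (intro norm_sum_Pythagorean finA) (auto simp: pairwise_def orthogonal_def)
  also have "\<dots> \<le> (\<Sum>k\<in>A. (d k)\<^sup>2 * 16)"
    by (intro sum_mono) (use norm_blk_err in \<open>simp add: power_mult_distrib mult_left_mono\<close>)
  also have "\<dots> = 16 / L * (\<Sum>k\<in>A. (norm (d k *\<^sub>R blk k))\<^sup>2)"
    using L by (simp add: power_mult_distrib norm_blk sum_distrib_left mult_ac)
  also have "(\<Sum>k\<in>A. (norm (d k *\<^sub>R blk k))\<^sup>2) = (norm p)\<^sup>2"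
    unfolding p using inner_blk
    by (intro norm_sum_Pythagorean[symmetric] finA) (auto simp: pairwise_def orthogonal_def)
  finally show ?thesis .
qed

lemma span_blk_vanishes:
  assumes "p \<in> span (range blk)" "n \<le> M"
  shows "coord p n = 0"
proof -
  have "range blk \<subseteq> {p. coord p n = 0}" using assms(2) by (auto simp: coord_blk blk_start_def)
  moreover have "subspace {p. coord p n = 0}" by (auto simp: subspace_def)
  ultimately show ?thesis using assms(1) span_minimal by blast
qed

end


text \<open>In the application \<open>d\<close> tends to 0, so division by \<open>d\<close> may
  destroy square-summability; finite support of \<open>q\<close> prevents this.\<close>

lemma diag_op_cancel_support:
  assumes d: "\<And>n. d n \<noteq> 0" "Bseq d" and N: "\<And>n. n \<ge> N \<Longrightarrow> coord q n = 0"
  shows "\<exists>v. diag_op d v = q"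
proof -
  have "summable (\<lambda>n. (coord q n / d n)\<^sup>2)"
    by (rule summable_finite[of "{..<N}"]) (use N in \<open>auto simp: not_less\<close>)
  then have "diag_op d (Abs_ell2 (\<lambda>n. coord q n / d n)) = q"
    by (intro ell2_eqI) (simp add: coord_diag_op d coord_Abs_ell2)
  then show ?thesis by blast
qed

text \<open>On a block of constant (\<open>s = 1\<close>) or alternating (\<open>s = -1\<close>) sign the operator \<open>free_jacobi\<close>
  acts almost like \<open>s\<close>, which turns the quadratic form into \<open>s a (r - a s)\<^sup>2\<close> times the squared norm.\<close>

lemma jacobi_pencil_form_sign:
  fixes s a r :: real and p q \<delta> :: "'a::real_inner"
  assumes a: "0 < a" "a < r" and s: "s = 1 \<or> s = -1" and p: "p \<noteq> 0"
    and \<epsilon>: "\<epsilon> = a * (r - a)\<^sup>2 / (20 * r ^ 3)"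
    and e: "norm (Cp - s *\<^sub>R p) \<le> \<epsilon> * norm p" and Cp: "norm Cp \<le> norm p"
    and q: "q = r *\<^sub>R p - a *\<^sub>R Cp" and \<delta>: "norm (\<delta> - q) \<le> \<epsilon> * norm q"
  shows "0 < s * (q \<bullet> ((r\<^sup>2 - a\<^sup>2) *\<^sub>R p - r *\<^sub>R \<delta>))"
proof -
  define e where "e = Cp - s *\<^sub>R p"
  define P where "P = (norm p)\<^sup>2"
  define j where "j = r - a * s"
  have s2: "s * s = 1" using s by auto
  have P: "P > 0" using p by (simp add: P_def)
  have r3: "r ^ 3 > 0" using a by simp
  have \<epsilon>0: "\<epsilon> \<ge> 0" unfolding \<epsilon> using a by simp
  have "a * (r - a)\<^sup>2 \<le> r * r\<^sup>2" using a by (intro mult_mono power_mono) auto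
  then have \<epsilon>1: "\<epsilon> \<le> 1" unfolding \<epsilon> using r3 by (simp add: power3_eq_cube power2_eq_square)
  have q_eq: "q = j *\<^sub>R p - a *\<^sub>R e" by (simp add: q e_def j_def algebra_simps)
  have ep: "\<bar>e \<bullet> p\<bar> \<le> \<epsilon> * P"
  proof -
    have "\<bar>e \<bullet> p\<bar> \<le> norm e * norm p" by (rule Cauchy_Schwarz_ineq2)
    also have "\<dots> \<le> \<epsilon> * norm p * norm p" using e by (intro mult_right_mono) (auto simp: e_def)
    finally show ?thesis by (simp add: P_def power2_eq_square mult.assoc)
  qed
  have ee: "e \<bullet> e \<le> \<epsilon> * P"
  proof -
    have "e \<bullet> e = (norm e)\<^sup>2" by (simp add: power2_norm_eq_inner)
    also have "\<dots> \<le> (\<epsilon> * norm p)\<^sup>2" using e by (intro power_mono) (auto simp: e_def)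
    also have "\<dots> = \<epsilon> * (\<epsilon> * P)" by (simp add: P_def power2_eq_square mult_ac)
    also have "\<dots> \<le> 1 * (\<epsilon> * P)" using \<epsilon>0 \<epsilon>1 P by (intro mult_right_mono) auto
    finally show ?thesis by simp
  qed
  have nq: "norm q \<le> 2 * r * norm p"
  proof -
    have "norm q \<le> norm (r *\<^sub>R p) + norm (a *\<^sub>R Cp)" unfolding q by (rule norm_triangle_ineq4)
    also have "norm (a *\<^sub>R Cp) \<le> r * norm p" using a Cp by (simp add: mult_mono)
    finally show ?thesis using a by simp
  qed
  have qd: "\<bar>q \<bullet> (\<delta> - q)\<bar> \<le> \<epsilon> * (4 * r\<^sup>2 * P)"
  proof -
    have "\<bar>q \<bullet> (\<delta> - q)\<bar> \<le> norm q * norm (\<delta> - q)" by (rule Cauchy_Schwarz_ineq2)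
    also have "\<dots> \<le> norm q * (\<epsilon> * norm q)" using \<delta> by (intro mult_left_mono) auto
    also have "\<dots> = \<epsilon> * (norm q)\<^sup>2" by (simp add: power2_eq_square)
    also have "\<dots> \<le> \<epsilon> * (2 * r * norm p)\<^sup>2" using \<epsilon>0 nq by (intro mult_left_mono power_mono) auto
    finally show ?thesis by (simp add: power_mult_distrib P_def mult.assoc)
  qed
  have j2: "(r - a)\<^sup>2 \<le> j\<^sup>2" using s a by (intro power_mono) (auto simp: j_def)
  have j_le: "0 \<le> j" "j \<le> 2 * r" using s a by (auto simp: j_def)
  \<comment> \<open>Leading term: with \<open>Cp\<close> equal to \<open>s\<close> times
    \<open>p\<close> and \<open>\<delta> = q\<close> the form is
    \<open>j * (r\<^sup>2 - a\<^sup>2 - r * j) * P\<close>. As \<open>s * s = 1\<close>, the bracket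
    factors as \<open>a * s * j\<close>, which is the source of the sign.\<close>
  have main: "s * (j * (r\<^sup>2 - a\<^sup>2 - r * j)) = a * j\<^sup>2"
  proof -
    have "r\<^sup>2 - a\<^sup>2 - r * j = a * s * j" using s by (auto simp: j_def power2_eq_square algebra_simps)
    then show ?thesis using s2 by (simp add: power2_eq_square)
  qed
  define w where "w = - ((r\<^sup>2 - a\<^sup>2) * a * (e \<bullet> p)) + 2 * r * j * a * (e \<bullet> p) - r * a\<^sup>2 * (e \<bullet> e) - r * (q \<bullet> (\<delta> - q))"
  have h1: "q \<bullet> ((r\<^sup>2 - a\<^sup>2) *\<^sub>R p - r *\<^sub>R \<delta>) = (r\<^sup>2 - a\<^sup>2) * (q \<bullet> p) - r * (q \<bullet> q) - r * (q \<bullet> (\<delta> - q))"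
    by (simp add: inner_diff_right algebra_simps)
  have h2: "q \<bullet> p = j * P - a * (e \<bullet> p)"
    by (simp add: q_eq inner_diff_left P_def power2_norm_eq_inner)
  have h3: "q \<bullet> q = j\<^sup>2 * P - 2 * j * a * (e \<bullet> p) + a\<^sup>2 * (e \<bullet> e)"
    by (simp add: q_eq inner_diff_left inner_diff_right P_def power2_norm_eq_inner inner_commute[of p e])
      (simp add: power2_eq_square algebra_simps)
  have "q \<bullet> ((r\<^sup>2 - a\<^sup>2) *\<^sub>R p - r *\<^sub>R \<delta>) = j * (r\<^sup>2 - a\<^sup>2 - r * j) * P + w"
    unfolding h1 h2 h3 w_def by (simp add: power2_eq_square algebra_simps)
  then have form: "s * (q \<bullet> ((r\<^sup>2 - a\<^sup>2) *\<^sub>R p - r *\<^sub>R \<delta>)) = a * j\<^sup>2 * P + s * w"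
    using main by (simp add: distrib_left mult.assoc[symmetric])
  \<comment> \<open>The four terms of \<open>w\<close> cost 1, 4, 1 and 4 times
    \<open>r ^ 3 * \<epsilon> * P\<close>; the 20 in \<open>\<epsilon>\<close> makes the total half
    of \<open>a * (r - a)\<^sup>2 * P\<close>, which the leading term exceeds.\<close>
  have "\<bar>w\<bar> \<le> \<epsilon> * P * (10 * r ^ 3)"
  proof -
    let ?x = "e \<bullet> p"
    have ar: "a * r\<^sup>2 \<le> r ^ 3" "a\<^sup>2 \<le> r\<^sup>2" "r * a\<^sup>2 \<le> r ^ 3" "2 * r * j * a \<le> 4 * r ^ 3" "(r\<^sup>2 - a\<^sup>2) * a \<le> r ^ 3"
    proof -
      show 1: "a * r\<^sup>2 \<le> r ^ 3" using a by (simp add: power3_eq_cube power2_eq_square mult_right_mono)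
      show 2: "a\<^sup>2 \<le> r\<^sup>2" using a by (intro power_mono) auto
      show "r * a\<^sup>2 \<le> r ^ 3" using 2 a by (simp add: power3_eq_cube power2_eq_square mult_left_mono)
      have "2 * r * j * a \<le> 2 * r * (2 * r) * r" using a j_le by (intro mult_mono) auto
      then show "2 * r * j * a \<le> 4 * r ^ 3" by (simp add: power3_eq_cube)
      have "0 \<le> a ^ 3" using a by simp
      then have "(r\<^sup>2 - a\<^sup>2) * a \<le> a * r\<^sup>2" by (simp add: power3_eq_cube power2_eq_square algebra_simps)
      then show "(r\<^sup>2 - a\<^sup>2) * a \<le> r ^ 3" using 1 by simp
    qed
    have "\<bar>(r\<^sup>2 - a\<^sup>2) * a * ?x\<bar> \<le> r ^ 3 * (\<epsilon> * P)"
      unfolding abs_mult[of _ ?x] using ar a ep r3 by (intro mult_mono) (auto simp: abs_mult)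
    moreover have "\<bar>2 * r * j * a * ?x\<bar> \<le> 4 * r ^ 3 * (\<epsilon> * P)"
      unfolding abs_mult[of _ ?x] using ar a ep r3 j_le by (intro mult_mono) (auto simp: abs_mult)
    moreover have "\<bar>r * a\<^sup>2 * (e \<bullet> e)\<bar> \<le> r ^ 3 * (\<epsilon> * P)"
      unfolding abs_mult[of _ "e \<bullet> e"] using ar a ee r3 by (intro mult_mono) (auto simp: abs_mult)
    moreover have "\<bar>r * (q \<bullet> (\<delta> - q))\<bar> \<le> r * (\<epsilon> * (4 * r\<^sup>2 * P))"
      unfolding abs_mult using a qd by (intro mult_mono) auto
    moreover have "r * (\<epsilon> * (4 * r\<^sup>2 * P)) = 4 * r ^ 3 * (\<epsilon> * P)" by (simp add: power3_eq_cube power2_eq_square)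
    moreover have "\<bar>w\<bar> \<le> \<bar>(r\<^sup>2 - a\<^sup>2) * a * ?x\<bar> + \<bar>2 * r * j * a * ?x\<bar> + \<bar>r * a\<^sup>2 * (e \<bullet> e)\<bar> + \<bar>r * (q \<bullet> (\<delta> - q))\<bar>"
      unfolding w_def by linarith
    ultimately have "\<bar>w\<bar> \<le> 10 * (r ^ 3 * (\<epsilon> * P))" by linarith
    then show ?thesis by (simp only: mult_ac)
  qed
  also have "\<epsilon> * P * (10 * r ^ 3) = a * (r - a)\<^sup>2 * P / 2"
    unfolding \<epsilon> using r3 by (simp add: field_simps)
  also have "\<dots> < a * (r - a)\<^sup>2 * P" using a P by simp
  also have "\<dots> \<le> a * j\<^sup>2 * P" using j2 a P by (intro mult_right_mono mult_left_mono) auto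
  finally have "\<bar>s * w\<bar> < a * j\<^sup>2 * P" using s by auto
  then show ?thesis unfolding form by linarith
qed


text \<open>With \<open>d = sqrt \<alpha>\<close> and \<open>x = d f\<close> the two equations
  become \<open>T x = \<mu> x\<close>, where \<open>p = R (D x)\<close>; the operator
  \<open>G\<close> carries the quotients \<open>\<beta> / \<alpha>\<close> and is close to the
  identity at high frequencies. The factor \<open>s\<close> in \<open>T\<close> reduces negative
  eigenvalues to positive ones.\<close>

theorem jacobi_pencil_infinitely_many_eigenvalues:
  fixes \<alpha> \<beta> :: "nat \<Rightarrow> real"
  assumes a: "0 < a" "a < r" and s: "s = 1 \<or> s = (-1::real)"
    and \<alpha>: "\<And>n. 0 < \<alpha> n" "\<alpha> \<longlonglongrightarrow> 0" and \<beta>: "(\<lambda>n. \<beta> n / \<alpha> n) \<longlonglongrightarrow> 1"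
  shows "infinite {\<mu>. \<mu> > 0 \<and> (\<exists>f p. (\<exists>n. f n \<noteq> 0) \<and> summable (\<lambda>n. \<bar>f n\<bar>) \<and> summable (\<lambda>n. \<bar>p n\<bar>) \<and>
     (\<forall>n. s * \<mu> * f n = (r\<^sup>2 - a\<^sup>2) * p n - r * \<beta> n * f n) \<and>
     (\<forall>n. r * p n - a * ((p (Suc n) + (case n of 0 \<Rightarrow> 0 | Suc m \<Rightarrow> p m)) / 2) = \<alpha> n * f n))}"
    (is "infinite ?S")
proof -
  define d where "d n = sqrt (\<alpha> n)" for n
  define \<gamma> where "\<gamma> n = \<beta> n / \<alpha> n" for n
  have d0: "d \<longlonglongrightarrow> 0" unfolding d_def using tendsto_real_sqrt[OF \<alpha>(2)] by simp
  have d: "Bseq d" using d0 by (intro convergent_imp_Bseq convergentI)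
  have dn: "d n > 0" "d n * d n = \<alpha> n" for n using \<alpha>(1)[of n] by (simp_all add: d_def)
  have \<gamma>1: "\<gamma> \<longlonglongrightarrow> 1" unfolding \<gamma>_def by (rule \<beta>)
  then have \<gamma>: "Bseq \<gamma>" by (intro convergent_imp_Bseq convergentI)
  have "(\<lambda>n. \<gamma> n * \<alpha> n) \<longlonglongrightarrow> 1 * 0" by (intro tendsto_intros \<gamma>1 \<alpha>)
  then have \<beta>0: "\<beta> \<longlonglongrightarrow> 0" using \<alpha>(1) by (simp add: \<gamma>_def less_imp_neq[symmetric])
  have s2: "s * s = 1" using s by auto
  define D where "D = diag_op d"
  define G where "G = diag_op \<gamma>"
  interpret D: bounded_linear D unfolding D_def by (rule bounded_linear_diag_op[OF d])
  interpret G: bounded_linear G unfolding G_def by (rule bounded_linear_diag_op[OF \<gamma>])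
  interpret C: bounded_linear free_jacobi by (rule bounded_linear_free_jacobi)
  have coord_D: "coord (D x) n = d n * coord x n" for x n by (simp add: D_def coord_diag_op[OF d])
  have coord_G: "coord (G x) n = \<gamma> n * coord x n" for x n by (simp add: G_def coord_diag_op[OF \<gamma>])
  have sa_D: "D x \<bullet> y = x \<bullet> D y" and sa_G: "G x \<bullet> y = x \<bullet> G y" for x y
    using selfadjoint_diag_op[OF d] selfadjoint_diag_op[OF \<gamma>]
    by (simp_all add: selfadjoint_op_def D_def G_def)
  obtain R where R: "bounded_linear R" "selfadjoint_op R"
    and JR: "\<And>x. r *\<^sub>R R x - a *\<^sub>R free_jacobi (R x) = x"
    and RJ: "\<And>x. R (r *\<^sub>R x - a *\<^sub>R free_jacobi x) = x"
    using contraction_resolvent_exists[OF bounded_linear_free_jacobi selfadjoint_free_jacobi norm_free_jacobi a]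
    by blast
  interpret R: bounded_linear R by fact
  have sa_R: "R x \<bullet> y = x \<bullet> R y" for x y using R(2) by (simp add: selfadjoint_op_def)
  define K where "K x = (r\<^sup>2 - a\<^sup>2) *\<^sub>R R x - r *\<^sub>R G x" for x
  define T where "T x = s *\<^sub>R D (K (D x))" for x
  have K: "bounded_linear K"
    unfolding K_def
    by (intro bounded_linear_sub bounded_linear_const_scaleR R(1) G.bounded_linear_axioms)
  have T: "bounded_linear T" and "compact_op T"
  proof -
    have sDK: "bounded_linear (\<lambda>x. s *\<^sub>R D (K x))"
      by (intro bounded_linear_const_scaleR bounded_linear_compose[OF D.bounded_linear_axioms K])
    show "bounded_linear T"
      unfolding T_def using bounded_linear_compose[OF sDK D.bounded_linear_axioms] by simp
    have "compact_op D" unfolding D_def by (rule compact_diag_op[OF d0])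
    then show "compact_op T"
      unfolding T_def by (rule compact_op_compose[OF _ sDK])
  qed
  have "selfadjoint_op T"
    unfolding selfadjoint_op_def T_def K_def
    by (simp add: sa_D D.diff D.scaleR inner_diff_left inner_diff_right sa_R sa_G)
  define \<epsilon> where "\<epsilon> = a * (r - a)\<^sup>2 / (20 * r ^ 3)"
  have \<epsilon>: "\<epsilon> > 0" unfolding \<epsilon>_def using a by simp
  have "(\<lambda>n. \<bar>\<gamma> n - 1\<bar>) \<longlonglongrightarrow> \<bar>1 - 1\<bar>" by (intro tendsto_intros \<gamma>1)
  then have "\<forall>\<^sub>F n in sequentially. \<bar>\<gamma> n - 1\<bar> < \<epsilon>" using \<epsilon> by (intro order_tendstoD) auto
  then obtain M where M: "\<And>n. n \<ge> M \<Longrightarrow> \<bar>\<gamma> n - 1\<bar> \<le> \<epsilon>"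
    by (auto simp: eventually_sequentially intro: less_imp_le)
  \<comment> \<open>Blocks are taken so long that their relative error \<open>16 / L\<close> is at
    most \<open>\<epsilon>\<^sup>2\<close>, the tolerance of
    \<open>jacobi_pencil_form_sign\<close>.\<close>
  obtain L where "real L \<ge> 16 / \<epsilon>\<^sup>2 + 1" using real_arch_simple by blast
  moreover have "16 / \<epsilon>\<^sup>2 > 0" using \<epsilon> by simp
  ultimately have "real L \<ge> 1" and L2: "real L \<ge> 16 / \<epsilon>\<^sup>2" by linarith+
  then have L1: "L \<ge> 1" by simp
  have L3: "16 / L \<le> \<epsilon>\<^sup>2" using L1 L2 \<epsilon> by (simp add: field_simps)
  define b where "b = blk s L M"
  define J where "J x = r *\<^sub>R x - a *\<^sub>R free_jacobi x" for x
  have J: "bounded_linear J"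
    unfolding J_def
    by (intro bounded_linear_sub bounded_linear_const_scaleR bounded_linear_ident bounded_linear_free_jacobi)
  have coord_J: "coord (J x) n = r * coord x n - a * ((coord x (Suc n) + (case n of 0 \<Rightarrow> 0 | Suc m \<Rightarrow> coord x m)) / 2)"
    for x n by (simp add: J_def coord_free_jacobi)
  \<comment> \<open>Test vectors are prescribed through their images:
    \<open>D (v k) = J (b k)\<close> gives \<open>R (D (v k)) = b k\<close>, so the quadratic form
    can be evaluated on the blocks.\<close>
  have "\<exists>v. D v = J (b k)" for k
    unfolding D_def
  proof (rule diag_op_cancel_support[OF _ d])
    show "d n \<noteq> 0" for n using dn(1)[of n] by simp
    show "coord (J (b k)) n = 0" if "n \<ge> blk_start L M k + L + 1" for n
      using that by (auto simp: coord_J b_def coord_blk[OF s L1] split: nat.splits)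
  qed
  then obtain v where v: "\<And>k. D (v k) = J (b k)" by metis
  have pos: "\<exists>x. (\<forall>f\<in>F. f \<bullet> x = 0) \<and> x \<bullet> T x > 0" if F: "finite F" for F
  proof -
    \<comment> \<open>A finite span containing all \<open>v k\<close> would be carried by
      \<open>R\<close> after \<open>D\<close> to a finite span containing all blocks.\<close>
    have "\<not> span (range v) \<subseteq> span B" if B: "finite B" for B
    proof
      assume sub: "span (range v) \<subseteq> span B"
      have lin: "linear (\<lambda>x. R (D x))"
        using bounded_linear.linear[OF bounded_linear_compose[OF R(1) D.bounded_linear_axioms]] .
      have "b k \<in> span ((\<lambda>x. R (D x)) ` B)" for k
      proof -
        have "v k \<in> span B" using sub span_superset by blast
        then have "R (D (v k)) \<in> span ((\<lambda>x. R (D x)) ` B)"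
          unfolding linear_span_image[OF lin] by blast
        then show ?thesis by (simp add: v J_def RJ)
      qed
      then show False
        using span_blk_not_finite_dimensional[OF s L1, of "(\<lambda>x. R (D x)) ` B" M] B
        by (auto simp: b_def)
    qed
    then obtain x where x: "x \<in> span (range v)" "x \<noteq> 0" "\<forall>f\<in>F. f \<bullet> x = 0"
      using infinite_dimensional_subspace_meets_orthogonal[OF F subspace_span] by blast
    have "\<exists>p\<in>span (range b). D x = J p"
      using x(1)
    proof (induction rule: span_induct)
      case base
      show ?case
        unfolding subspace_def
      proof (intro conjI ballI allI)
        show "0 \<in> {x. \<exists>p\<in>span (range b). D x = J p}"
          by (auto intro!: bexI[of _ 0] span_zero simp: D.zero bounded_linear.linear[OF J] linear_0)
      next
        fix x y assume "x \<in> {x. \<exists>p\<in>span (range b). D x = J p}" "y \<in> {x. \<exists>p\<in>span (range b). D x = J p}"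
        then obtain p p' where "p \<in> span (range b)" "p' \<in> span (range b)" "D x = J p" "D y = J p'" by auto
        then show "x + y \<in> {x. \<exists>p\<in>span (range b). D x = J p}"
          by (auto intro!: bexI[of _ "p + p'"] span_add simp: D.add linear_add[OF bounded_linear.linear[OF J]])
      next
        fix c x assume "x \<in> {x. \<exists>p\<in>span (range b). D x = J p}"
        then obtain p where "p \<in> span (range b)" "D x = J p" by auto
        then show "c *\<^sub>R x \<in> {x. \<exists>p\<in>span (range b). D x = J p}"
          by (auto intro!: bexI[of _ "c *\<^sub>R p"] span_scale simp: D.scaleR linear_scale[OF bounded_linear.linear[OF J]])
      qed
    next
      case (step x)
      then show ?case using v span_superset by blast
    qed
    then obtain p where p: "p \<in> span (range b)" "D x = J p" by blast
    have "D x \<noteq> 0"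
    proof
      assume "D x = 0"
      then have "coord x n = 0" for n using coord_D[of x n] dn(1)[of n] by simp
      then show False using x(2) by (auto intro: ell2_eqI)
    qed
    then have p0: "p \<noteq> 0" using p(2) by (auto simp: J_def C.zero)
    let ?q = "J p"
    \<comment> \<open>\<open>J\<close> couples neighbouring indices: \<open>p\<close> vanishes up to
      \<open>M\<close> inclusive, so \<open>J p\<close> vanishes below \<open>M\<close>, where
      \<open>\<gamma>\<close> is not controlled.\<close>
    have q0: "coord ?q n = 0" if "n < M" for n
      using span_blk_vanishes[OF s L1, of p M] p(1) that
      by (auto simp: coord_J b_def split: nat.splits)
    have "x \<bullet> T x = s * (?q \<bullet> ((r\<^sup>2 - a\<^sup>2) *\<^sub>R p - r *\<^sub>R G ?q))"
    proof -
      have "x \<bullet> T x = s * (D x \<bullet> K (D x))" by (simp add: T_def sa_D)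
      then show ?thesis using RJ[of p] by (simp add: p(2) K_def J_def)
    qed
    moreover have "0 < s * (?q \<bullet> ((r\<^sup>2 - a\<^sup>2) *\<^sub>R p - r *\<^sub>R G ?q))"
    proof (rule jacobi_pencil_form_sign[OF a s p0 \<epsilon>_def _ norm_free_jacobi J_def])
      have "(norm (free_jacobi p - s *\<^sub>R p))\<^sup>2 \<le> 16 / L * (norm p)\<^sup>2"
        using span_blk_almost_eigenvector[OF s L1] p(1) unfolding b_def by blast
      also have "\<dots> \<le> \<epsilon>\<^sup>2 * (norm p)\<^sup>2" by (intro mult_right_mono L3) auto
      finally have "(norm (free_jacobi p - s *\<^sub>R p))\<^sup>2 \<le> (\<epsilon> * norm p)\<^sup>2" by (simp only: power_mult_distrib)
      then show "norm (free_jacobi p - s *\<^sub>R p) \<le> \<epsilon> * norm p"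
        by (rule power2_le_imp_le) (use \<epsilon> in simp)
      have \<gamma>': "Bseq (\<lambda>n. \<gamma> n - 1)"
        by (intro convergent_imp_Bseq convergentI[OF tendsto_diff[OF \<gamma>1 tendsto_const]])
      have "G ?q - ?q = diag_op (\<lambda>n. \<gamma> n - 1) ?q"
        by (rule ell2_eqI) (simp add: coord_G coord_diag_op[OF \<gamma>'] left_diff_distrib)
      moreover have "(norm (diag_op (\<lambda>n. \<gamma> n - 1) ?q))\<^sup>2 \<le> (\<epsilon> * norm ?q)\<^sup>2"
        using norm_diag_op_head_tail[OF \<gamma>' M, of M ?q] q0 by (simp add: power_mult_distrib)
      then have "norm (diag_op (\<lambda>n. \<gamma> n - 1) ?q) \<le> \<epsilon> * norm ?q"
        by (rule power2_le_imp_le) (use \<epsilon> in simp)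
      ultimately show "norm (G ?q - ?q) \<le> \<epsilon> * norm ?q" by simp
    qed
    ultimately show ?thesis using x(3) by auto
  qed
  have "infinite {\<mu>. \<mu> > 0 \<and> (\<exists>x. x \<noteq> 0 \<and> T x = \<mu> *\<^sub>R x)}"
    by (rule compact_selfadjoint_infinitely_many_positive_eigenvalues) fact+
  moreover have "{\<mu>. \<mu> > 0 \<and> (\<exists>x. x \<noteq> 0 \<and> T x = \<mu> *\<^sub>R x)} \<subseteq> ?S"
  proof (intro subsetI CollectI)
    fix \<mu> assume "\<mu> \<in> {\<mu>. \<mu> > 0 \<and> (\<exists>x. x \<noteq> 0 \<and> T x = \<mu> *\<^sub>R x)}"
    then obtain x where \<mu>: "\<mu> > 0" and x: "x \<noteq> 0" "T x = \<mu> *\<^sub>R x" by auto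
    define f where "f n = coord x n / d n" for n
    define P where "P = R (D x)"
    have Dx: "coord (D x) n = \<alpha> n * f n" for n
      using dn[of n] by (simp add: coord_D f_def field_simps)
    have eq2: "r * coord P n - a * ((coord P (Suc n) + (case n of 0 \<Rightarrow> 0 | Suc m \<Rightarrow> coord P m)) / 2) = \<alpha> n * f n" for n
      using arg_cong[OF JR[of "D x"], of "\<lambda>x. coord x n"] unfolding Dx P_def[symmetric]
      by (simp add: coord_free_jacobi)
    have eq1: "s * \<mu> * f n = (r\<^sup>2 - a\<^sup>2) * coord P n - r * \<beta> n * f n" for n
    proof -
      have "s * (d n * coord (K (D x)) n) = \<mu> * coord x n"
        using arg_cong[OF x(2), of "\<lambda>x. coord x n"] by (simp add: T_def coord_D)
      then have "s * s * (d n * coord (K (D x)) n) = s * \<mu> * coord x n" by (simp only: mult.assoc)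
      then have "coord (K (D x)) n = s * \<mu> * f n" using s2 dn(1)[of n] by (simp add: f_def field_simps)
      moreover have "coord (K (D x)) n = (r\<^sup>2 - a\<^sup>2) * coord P n - r * (\<gamma> n * coord (D x) n)"
        by (simp add: K_def P_def coord_G)
      moreover have "\<gamma> n * coord (D x) n = \<beta> n * f n"
        using \<alpha>(1)[of n] unfolding Dx by (simp add: \<gamma>_def)
      ultimately show ?thesis by simp
    qed
    obtain n where "coord x n \<noteq> 0" using x(1) ell2_eqI[of x 0] by auto
    then have "f n \<noteq> 0" using dn(1)[of n] by (simp add: f_def)
    moreover have "s * \<mu> \<noteq> 0" using \<mu> s by auto
    ultimately show "\<mu> > 0 \<and> (\<exists>f p. (\<exists>n. f n \<noteq> 0) \<and> summable (\<lambda>n. \<bar>f n\<bar>) \<and> summable (\<lambda>n. \<bar>p n\<bar>) \<and>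
     (\<forall>n. s * \<mu> * f n = (r\<^sup>2 - a\<^sup>2) * p n - r * \<beta> n * f n) \<and>
     (\<forall>n. r * p n - a * ((p (Suc n) + (case n of 0 \<Rightarrow> 0 | Suc m \<Rightarrow> p m)) / 2) = \<alpha> n * f n))"
      using \<mu> eq1 eq2 jacobi_pencil_decay[OF a \<alpha> \<beta>0, of "s * \<mu>" "coord P" "norm P" f] abs_coord_le_norm
      by (intro conjI exI[of _ f] exI[of _ "coord P"]) auto
  qed
  ultimately show ?thesis by (rule infinite_super[rotated])
qed

section \<open>Integration over a period\<close>

text \<open>Lebesgue measure of one period, placed on the whole line so that measurability stays
  that of \<open>borel\<close>; rotation invariance becomes a statement about periodic
  integrands.\<close>

definition circ :: "real measure" where
  "circ = density lborel (\<lambda>x. ennreal (indicator {0..2*pi} x))"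

lemma sets_circ [measurable_cong, simp]: "sets circ = sets borel"
  by (simp add: circ_def)

lemma space_circ [simp]: "space circ = UNIV"
  by (simp add: circ_def)

lemma nn_integral_circ:
  "f \<in> borel_measurable borel \<Longrightarrow> (\<integral>\<^sup>+x. f x \<partial>circ) = (\<integral>\<^sup>+x. f x * indicator {0..2*pi} x \<partial>lborel)"
  unfolding circ_def
  by (subst nn_integral_density) (auto simp: mult.commute ennreal_indicator)

lemma emeasure_circ_space: "emeasure circ (space circ) = ennreal (2 * pi)"
  using nn_integral_circ[of "\<lambda>_. 1"] by simp

lemma measure_circ_space: "measure circ UNIV = 2 * pi"
  using emeasure_circ_space by (simp add: measure_def)

interpretation circ: finite_measure circ
  by (rule finite_measureI) (simp add: emeasure_circ_space del: space_circ)

interpretation circ2: pair_sigma_finite circ circ ..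

lemma integral_circ:
  fixes f :: "real \<Rightarrow> real"
  shows "f \<in> borel_measurable borel \<Longrightarrow> integral\<^sup>L circ f = (LINT x:{0..2*pi}|lborel. f x)"
  unfolding circ_def set_lebesgue_integral_def by (subst integral_density) auto

lemma integrable_circ:
  fixes f :: "real \<Rightarrow> real"
  shows "f \<in> borel_measurable borel \<Longrightarrow> integrable circ f \<longleftrightarrow> set_integrable lborel {0..2*pi} f"
  unfolding circ_def set_integrable_def by (subst integrable_density) auto

lemma AE_circ_iff: "Measurable.pred borel P \<Longrightarrow> (AE x in circ. P x) \<longleftrightarrow> (AE x in lborel. x \<in> {0..2*pi} \<longrightarrow> P x)"
  unfolding circ_def by (subst AE_density) (auto simp: indicator_def)

lemma AE_circ_interior: "AE x in circ. 0 < x \<and> x < 2 * pi"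
proof -
  have "AE x in lborel. x \<in> {0..2*pi} \<longrightarrow> 0 < x \<and> x < 2 * pi"
    using AE_lborel_singleton[of 0] AE_lborel_singleton[of "2*pi"] by eventually_elim auto
  then show ?thesis by (subst AE_circ_iff) auto
qed

lemma integrable_circ_continuous:
  fixes f :: "real \<Rightarrow> real"
  assumes "continuous_on UNIV f"
  shows "integrable circ f"
  by (subst integrable_circ)
    (use assms in \<open>auto intro: borel_measurable_continuous_onI borel_integrable_atLeastAtMost' continuous_on_subset\<close>)

lemma integral_circ_FTC:
  fixes F f :: "real \<Rightarrow> real"
  assumes "\<And>x. (F has_real_derivative f x) (at x)" and cont: "continuous_on UNIV f"
  shows "integral\<^sup>L circ f = F (2*pi) - F 0"
proof -
  have "f \<in> borel_measurable borel" using cont by (rule borel_measurable_continuous_onI)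
  then have "integral\<^sup>L circ f = (\<integral>x. indicator {0..2*pi} x *\<^sub>R f x \<partial>lborel)"
    by (simp add: integral_circ set_lebesgue_integral_def)
  also have "\<dots> = F (2*pi) - F 0"
    by (rule integral_FTC_Icc) (use assms in \<open>auto simp: has_real_derivative_iff_has_vector_derivative[symmetric]
        intro: DERIV_subset continuous_on_subset\<close>)
  finally show ?thesis .
qed

lemma integrable_circ2_product:
  fixes f g :: "real \<Rightarrow> real"
  assumes f: "integrable circ f" and g: "integrable circ g"
  shows "integrable (circ \<Otimes>\<^sub>M circ) (\<lambda>(x, y). f x * g y)"
proof (rule circ2.Fubini_integrable)
  have [measurable]: "f \<in> borel_measurable borel" "g \<in> borel_measurable borel"
    using borel_measurable_integrable[OF f] borel_measurable_integrable[OF g] by simp_all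
  show "(\<lambda>(x, y). f x * g y) \<in> borel_measurable (circ \<Otimes>\<^sub>M circ)" by measurable
  have "(\<lambda>x. LINT y|circ. norm (f x * g y)) = (\<lambda>x. norm (f x) * (LINT y|circ. norm (g y)))"
    by (simp add: abs_mult)
  then show "integrable circ (\<lambda>x. LINT y|circ. norm (case (x, y) of (x, y) \<Rightarrow> f x * g y))"
    using f by simp
qed (use g in auto)

text \<open>For shifts within one period the window leaves \<open>{0..2*pi}\<close> on one side
  only, and periodicity moves the overhang back.\<close>

lemma nn_integral_circ_shift:
  fixes f :: "real \<Rightarrow> ennreal"
  assumes f [measurable]: "f \<in> borel_measurable borel" and per: "\<And>x. f (x + 2 * pi) = f x"
    and c: "0 \<le> c" "c \<le> 2 * pi"
  shows "(\<integral>\<^sup>+x. f (x + c) \<partial>circ) = (\<integral>\<^sup>+x. f x \<partial>circ)"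
proof -
  have "(\<integral>\<^sup>+x. f (x + c) \<partial>circ) = (\<integral>\<^sup>+x. f x * indicator {c..c + 2*pi} x \<partial>lborel)"
    by (subst nn_integral_real_affine[where c = 1 and t = c])
      (auto simp: nn_integral_circ add.commute indicator_def intro!: nn_integral_cong)
  also have "\<dots> = (\<integral>\<^sup>+x. f x * indicator {c..<2*pi} x + f x * indicator {2*pi..c + 2*pi} x \<partial>lborel)"
    using c by (intro nn_integral_cong) (auto simp: indicator_def)
  also have "\<dots> = (\<integral>\<^sup>+x. f x * indicator {c..<2*pi} x \<partial>lborel) + (\<integral>\<^sup>+x. f x * indicator {2*pi..c + 2*pi} x \<partial>lborel)"
    by (rule nn_integral_add) auto
  also have "(\<integral>\<^sup>+x. f x * indicator {2*pi..c + 2*pi} x \<partial>lborel) = (\<integral>\<^sup>+x. f x * indicator {0..c} x \<partial>lborel)"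
    by (subst nn_integral_real_affine[where c = 1 and t = "2*pi"])
      (auto simp: indicator_def add.commute per intro!: nn_integral_cong)
  also have "(\<integral>\<^sup>+x. f x * indicator {c..<2*pi} x \<partial>lborel) + (\<integral>\<^sup>+x. f x * indicator {0..c} x \<partial>lborel)
      = (\<integral>\<^sup>+x. f x * indicator {c..<2*pi} x + f x * indicator {0..c} x \<partial>lborel)"
    by (rule nn_integral_add[symmetric]) auto
  also have "\<dots> = (\<integral>\<^sup>+x. f x * indicator {0..2*pi} x \<partial>lborel)"
  proof (rule nn_integral_cong_AE)
    show "AE x in lborel. f x * indicator {c..<2*pi} x + f x * indicator {0..c} x = f x * indicator {0..2*pi} x"
      using AE_lborel_singleton[of c] AE_lborel_singleton[of "2*pi"]
      by eventually_elim (use c in \<open>auto simp: indicator_def\<close>)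
  qed
  finally show ?thesis by (simp add: nn_integral_circ)
qed

lemma periodic_int:
  fixes f :: "real \<Rightarrow> 'a"
  assumes "\<And>x. f (x + 2 * pi) = f x"
  shows "f (x + 2 * pi * of_int k) = f x"
proof (induction k)
  case (nonneg n)
  then show ?case
  proof (induction n)
    case (Suc n)
    then show ?case using assms[of "x + 2 * pi * real n"] by (simp add: algebra_simps)
  qed simp
next
  case (neg n)
  have "f (x + 2 * pi * of_int (- int (Suc n))) = f x" for x
  proof (induction n arbitrary: x)
    case 0
    then show ?case using assms[of "x - 2 * pi"] by simp
  next
    case (Suc n)
    then show ?case using assms[of "x + 2 * pi * of_int (- int (Suc (Suc n)))"] by (simp add: algebra_simps)
  qed
  then show ?case .
qed

text \<open>Both sides are compared through the image measure of the wrapped translation, so that the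
  identity also holds, with the junk value of the Bochner integral, for non-integrable functions.\<close>

lemma integral_circ_shift:
  fixes f :: "real \<Rightarrow> real"
  assumes f [measurable]: "f \<in> borel_measurable borel" and per: "\<And>x. f (x + 2 * pi) = f x"
  shows "integral\<^sup>L circ (\<lambda>x. f (x + c)) = integral\<^sup>L circ f"
    and "integrable circ (\<lambda>x. f (x + c)) \<longleftrightarrow> integrable circ f"
proof -
  define w where "w x = x - 2 * pi * \<lfloor>x / (2 * pi)\<rfloor>" for x :: real
  have [measurable]: "w \<in> borel_measurable borel" unfolding w_def by measurable
  have w: "0 \<le> w x" "w x \<le> 2 * pi" for x
    using floor_divide_lower[of "2 * pi" x] floor_divide_upper[of "2 * pi" x]
    by (simp_all add: w_def algebra_simps)
  have f_w: "f (w x) = f x" for x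
    using periodic_int[of f x "- \<lfloor>x / (2 * pi)\<rfloor>", OF per] by (simp add: w_def)
  have w_per: "w (x + 2 * pi) = w x" for x
  proof -
    have "(x + 2 * pi) / (2 * pi) = x / (2 * pi) + 1" by (simp add: field_simps)
    then show ?thesis by (simp add: w_def algebra_simps)
  qed
  define W where "W c x = w (x + w c)" for c x
  have W [measurable]: "W c \<in> borel_measurable borel" for c unfolding W_def by measurable
  have f_W: "f (W c x) = f (x + c)" for c x
    using f_w[of "x + w c"] periodic_int[of f "x + c" "- \<lfloor>c / (2 * pi)\<rfloor>", OF per]
    by (simp add: W_def w_def[of c] add_diff_eq)
  have distr: "distr circ borel (W c) = distr circ borel w" for c
  proof (rule measure_eqI)
    fix A assume "A \<in> sets (distr circ borel (W c))"
    then have A [measurable]: "A \<in> sets borel" by simp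
    define g where "g x = (indicator A (w x) :: ennreal)" for x
    have [measurable]: "g \<in> borel_measurable borel" unfolding g_def by measurable
    have "emeasure (distr circ borel (W c)) A = (\<integral>\<^sup>+x. g (x + w c) \<partial>circ)"
      using nn_integral_distr[of "W c" circ borel "indicator A"] by (simp add: g_def W_def)
    also have "\<dots> = (\<integral>\<^sup>+x. g x \<partial>circ)"
      by (rule nn_integral_circ_shift) (simp_all add: g_def w_per w)
    also have "\<dots> = emeasure (distr circ borel w) A"
      using nn_integral_distr[of w circ borel "indicator A"] by (simp add: g_def)
    finally show "emeasure (distr circ borel (W c)) A = emeasure (distr circ borel w) A" .
  qed simp
  have "integral\<^sup>L circ (\<lambda>x. f (x + c)) = integral\<^sup>L (distr circ borel (W c)) f"
    by (subst integral_distr) (simp_all add: f_W)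
  also have "\<dots> = integral\<^sup>L circ f"
    unfolding distr by (subst integral_distr) (simp_all add: f_w)
  finally show "integral\<^sup>L circ (\<lambda>x. f (x + c)) = integral\<^sup>L circ f" .
  have "integrable circ (\<lambda>x. f (x + c)) \<longleftrightarrow> integrable (distr circ borel (W c)) f"
    by (subst integrable_distr_eq) (simp_all add: f_W)
  also have "\<dots> \<longleftrightarrow> integrable circ f"
    unfolding distr by (subst integrable_distr_eq) (simp_all add: f_w)
  finally show "integrable circ (\<lambda>x. f (x + c)) \<longleftrightarrow> integrable circ f" .
qed

lemma integral_circ_reflect:
  fixes f :: "real \<Rightarrow> real"
  assumes f [measurable]: "f \<in> borel_measurable borel" and per: "\<And>x. f (x + 2 * pi) = f x"
  shows "integral\<^sup>L circ (\<lambda>x. f (- x)) = integral\<^sup>L circ f"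
    and "integrable circ (\<lambda>x. f (- x)) \<longleftrightarrow> integrable circ f"
proof -
  define g where "g x = indicator {0..2*pi} x *\<^sub>R f x" for x
  have "f (2 * pi - x) = f (- x)" for x using per[of "- x"] by (simp add: add.commute)
  then have eq: "(\<lambda>x. g (2*pi + (-1) * x)) = (\<lambda>x. indicator {0..2*pi} x *\<^sub>R f (- x))"
    by (auto simp: fun_eq_iff indicator_def g_def)
  show "integral\<^sup>L circ (\<lambda>x. f (- x)) = integral\<^sup>L circ f"
    using lborel_integral_real_affine[where c = "-1" and t = "2*pi" and f = g] unfolding eq
    by (simp add: integral_circ set_lebesgue_integral_def g_def[abs_def])
  show "integrable circ (\<lambda>x. f (- x)) \<longleftrightarrow> integrable circ f"
    using lborel_integrable_real_affine_iff[where c = "-1" and t = "2*pi" and f = g] unfolding eq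
    by (simp add: integrable_circ set_integrable_def g_def[abs_def])
qed

lemma sin_multiple_periodic:
  "sin (real m * (x + 2 * pi)) = sin (real m * x)" "cos (real m * (x + 2 * pi)) = cos (real m * x)"
proof -
  have e: "real m * (x + 2 * pi) = real m * x + 2 * pi * of_int (int m)" by (simp add: algebra_simps)
  show "sin (real m * (x + 2 * pi)) = sin (real m * x)" "cos (real m * (x + 2 * pi)) = cos (real m * x)"
    unfolding e by (rule periodic_int, simp)+
qed

text \<open>Sines are eigenfunctions of convolution with an even periodic kernel: after the
  substitution \<open>z = x - y\<close> the addition theorem splits the sine, and the part with
  \<open>A z * sin (real m * z)\<close> integrates to 0 by reflection.\<close>

lemma even_convolution_sin:
  fixes A :: "real \<Rightarrow> real"
  assumes meas [measurable]: "A \<in> borel_measurable borel" and A: "integrable circ A"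
    and per: "\<And>x. A (x + 2 * pi) = A x" and even: "\<And>x. A (- x) = A x"
  shows "integral\<^sup>L circ (\<lambda>y. A (x - y) * sin (real m * y))
       = integral\<^sup>L circ (\<lambda>y. A y * cos (real m * y)) * sin (real m * x)"
    and "integrable circ (\<lambda>y. A (x - y))"
proof -
  define F where "F z = A z * sin (real m * (x - z))" for z
  have [measurable]: "F \<in> borel_measurable borel" unfolding F_def by measurable
  have perF: "F (z + 2 * pi) = F z" for z
  proof -
    have "sin (real m * (x - (z + 2 * pi))) = sin (real m * (x - z))"
      using sin_multiple_periodic(1)[of m "x - (z + 2 * pi)"] by (simp add: algebra_simps)
    then show ?thesis by (simp add: F_def per)
  qed
  have int: "integrable circ (\<lambda>z. A z * cos (real m * z))" "integrable circ (\<lambda>z. A z * sin (real m * z))"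
    by (rule Bochner_Integration.integrable_bound[OF A]; auto simp: abs_mult intro!: mult_left_le)+
  have "integral\<^sup>L circ (\<lambda>y. A (x - y) * sin (real m * y)) = integral\<^sup>L circ (\<lambda>y. F (- y + x))"
    by (simp add: F_def algebra_simps)
  also have "\<dots> = integral\<^sup>L circ (\<lambda>y. F (y + x))"
    using perF[of "_ + x"] by (intro integral_circ_reflect(1)[of "\<lambda>y. F (y + x)"]) (simp_all add: add_ac)
  also have "\<dots> = integral\<^sup>L circ F"
    by (rule integral_circ_shift(1)) (simp_all add: perF)
  also have "F = (\<lambda>z. A z * cos (real m * z) * sin (real m * x) - A z * sin (real m * z) * cos (real m * x))"
    by (simp add: F_def fun_eq_iff right_diff_distrib sin_diff algebra_simps)
  also have "integral\<^sup>L circ (\<lambda>z. A z * cos (real m * z) * sin (real m * x) - A z * sin (real m * z) * cos (real m * x))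
      = integral\<^sup>L circ (\<lambda>z. A z * cos (real m * z)) * sin (real m * x)
        - integral\<^sup>L circ (\<lambda>z. A z * sin (real m * z)) * cos (real m * x)"
    using int by simp
  also have "integral\<^sup>L circ (\<lambda>z. A z * sin (real m * z)) = 0"
    using integral_circ_reflect(1)[of "\<lambda>z. A z * sin (real m * z)"] per sin_multiple_periodic(1)[of m]
    by (simp add: even)
  finally show "integral\<^sup>L circ (\<lambda>y. A (x - y) * sin (real m * y))
       = integral\<^sup>L circ (\<lambda>y. A y * cos (real m * y)) * sin (real m * x)" by simp
  have "integrable circ (\<lambda>y. A (- y + x)) \<longleftrightarrow> integrable circ (\<lambda>y. A (y + x))"
    using per[of "_ + x"] by (intro integral_circ_reflect(2)[of "\<lambda>y. A (y + x)"]) (simp_all add: add_ac)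
  also have "\<dots> \<longleftrightarrow> integrable circ A"
    by (rule integral_circ_shift(2)) (simp_all add: per)
  finally show "integrable circ (\<lambda>y. A (x - y))" using A by simp
qed

lemma sin_ge_linear:
  assumes "0 \<le> y" "y \<le> pi / 2"
  shows "2 / pi * y \<le> sin y"
proof -
  have "convex_on {0..pi} (\<lambda>x. - sin x)"
    by (rule f''_ge0_imp_convex[where f' = "\<lambda>x. - cos x" and f'' = sin])
      (auto intro!: derivative_eq_intros sin_ge_zero)
  from convex_onD[OF this, of "2 / pi * y" 0 "pi / 2"] assms
  show ?thesis by (simp add: field_simps)
qed

text \<open>Provides the one-dimensional majorant for all kernels. By the linear lower bound on the
  sine, the integrand is at most a multiple of \<open>x powr (-1/2)\<close> on the first half of the
  period and of its mirror image on the second.\<close>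

lemma integrable_inverse_sqrt_sin: "integrable circ (\<lambda>x. 1 / sqrt (sin (x / 2)))"
proof -
  have *: "integrable circ (\<lambda>x. x powr (-1/2))"
  proof -
    have "(\<lambda>x. x powr (-1/2)) integrable_on {0..2*pi}" by (rule integrable_on_powr_from_0) auto
    then have "set_integrable lebesgue {0..2*pi} (\<lambda>x. x powr (-1/2) :: real)"
      by (rule nonnegative_absolutely_integrable_1) auto
    then show ?thesis
      unfolding set_integrable_def by (subst (asm) integrable_completion) (auto simp: integrable_circ set_integrable_def)
  qed
  have **: "integrable circ (\<lambda>x. (2*pi - x) powr (-1/2))"
  proof -
    define f where "f x = indicator {0..2*pi} x *\<^sub>R (x powr (-1/2))" for x :: real
    have "integrable lborel f" using * by (simp add: integrable_circ set_integrable_def f_def[abs_def])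
    then have "integrable lborel (\<lambda>x. f (2*pi + (-1) * x))" by (rule lborel_integrable_real_affine) simp
    moreover have "(\<lambda>x. f (2*pi + (-1) * x)) = (\<lambda>x. indicator {0..2*pi} x *\<^sub>R ((2*pi - x) powr (-1/2)))"
      by (auto simp: f_def fun_eq_iff indicator_def)
    ultimately show ?thesis by (simp add: integrable_circ set_integrable_def)
  qed
  have pw: "y powr (-1/2) = 1 / sqrt y" if "y > 0" for y :: real
    using that by (simp add: powr_minus_divide powr_half_sqrt)
  show ?thesis
  proof (rule Bochner_Integration.integrable_bound)
    show "integrable circ (\<lambda>x. sqrt pi * (x powr (-1/2) + (2*pi - x) powr (-1/2)))"
      using * ** by simp
    show "AE x in circ. norm (1 / sqrt (sin (x / 2))) \<le> norm (sqrt pi * (x powr (-1/2) + (2*pi - x) powr (-1/2)))"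
      using AE_circ_interior
    proof eventually_elim
      case (elim x)
      have key: "1 / sqrt (sin (y / 2)) \<le> sqrt pi * y powr (-1/2)" if y: "0 < y" "y \<le> pi" for y
      proof -
        have "y / pi \<le> sin (y / 2)" using sin_ge_linear[of "y / 2"] y by simp
        moreover have "0 < y / pi" using y by simp
        ultimately have "sqrt (y / pi) \<le> sqrt (sin (y / 2))" "0 < sin (y / 2)" by simp_all
        then have "1 / sqrt (sin (y / 2)) \<le> 1 / sqrt (y / pi)" using y by (intro divide_left_mono mult_pos_pos) auto
        then show ?thesis unfolding pw[OF y(1)] by (simp add: real_sqrt_divide)
      qed
      have nn: "0 \<le> sqrt pi * z powr (-1/2)" for z by simp
      have "1 / sqrt (sin (x / 2)) \<le> sqrt pi * x powr (-1/2) + sqrt pi * (2*pi - x) powr (-1/2)"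
      proof (cases "x \<le> pi")
        case True
        then show ?thesis using key[of x] elim nn[of "2*pi - x"] by linarith
      next
        case False
        have "sin ((2*pi - x) / 2) = sin (x / 2)" by (simp add: diff_divide_distrib)
        then have "1 / sqrt (sin (x / 2)) \<le> sqrt pi * (2*pi - x) powr (-1/2)"
          using key[of "2*pi - x"] False elim by simp
        then show ?thesis using nn[of x] by linarith
      qed
      moreover have "0 \<le> sin (x / 2)" using elim by (intro sin_ge_zero) auto
      ultimately show ?case using nn by (simp add: distrib_left abs_of_nonneg)
    qed
  qed measurable
qed

section \<open>The axisymmetric kernels\<close>

definition ku :: "real \<Rightarrow> real" where "ku x = (1 - cos x) / 2"

text \<open>The function X of the overview for \<open>q = a / R0\<close>, with \<open>ku\<close> the
  squared sine of the half angle. Since \<open>q\<close> is kept free, the kernel at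
  \<open>q = 1\<close> can also serve as a majorant in the original angles.\<close>

definition kX :: "real \<Rightarrow> real \<Rightarrow> real \<Rightarrow> real" where
  "kX q \<theta> \<eta> = ku \<theta> + q\<^sup>2 * ku \<eta>"

text \<open>\<open>kA\<close> and \<open>kB\<close> are the integrands whose integrals over \<theta>
  are the convolution kernels A and B. Where \<open>kX\<close> vanishes both take the value 0 by the
  convention for division, so inequalities between them hold everywhere.\<close>

definition kA :: "real \<Rightarrow> real \<Rightarrow> real \<Rightarrow> real" where
  "kA q \<theta> \<eta> = 1 / sqrt (kX q \<theta> \<eta>)"

definition kB :: "real \<Rightarrow> real \<Rightarrow> real \<Rightarrow> real" where
  "kB q \<theta> \<eta> = ku \<theta> / sqrt (kX q \<theta> \<eta>) ^ 3"

lemma ku_sin: "ku x = (sin (x / 2))\<^sup>2"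
  using cos_double_sin[of "x / 2"] by (simp add: ku_def)

lemma ku_nonneg [simp]: "0 \<le> ku x" by (simp add: ku_def)

lemma ku_le_1: "ku x \<le> 1" using cos_ge_minus_one[of x] by (simp add: ku_def)

lemma ku_minus [simp]: "ku (- x) = ku x" by (simp add: ku_def)

lemma ku_periodic [simp]: "ku (x + 2 * pi) = ku x" by (simp add: ku_def)

lemma ku_pos: "0 < x \<Longrightarrow> x < 2 * pi \<Longrightarrow> 0 < ku x"
  using sin_gt_zero[of "x / 2"] by (simp add: ku_sin)

lemma ku_le_square: "ku x \<le> x\<^sup>2 / 4"
proof -
  have "\<bar>sin (x / 2)\<bar>\<^sup>2 \<le> \<bar>x / 2\<bar>\<^sup>2" by (intro power_mono abs_sin_x_le_abs_x) auto
  then show ?thesis by (simp add: ku_sin power_divide)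
qed

lemma ku_measurable [measurable]: "ku \<in> borel_measurable borel"
  unfolding ku_def by measurable

lemma kX_measurable [measurable]: "(\<lambda>x. kX q (f x) (g x)) \<in> borel_measurable M"
  if [measurable]: "f \<in> borel_measurable M" "g \<in> borel_measurable M"
  unfolding kX_def by measurable

lemma kA_measurable [measurable]: "(\<lambda>x. kA q (f x) (g x)) \<in> borel_measurable M"
  if [measurable]: "f \<in> borel_measurable M" "g \<in> borel_measurable M"
  unfolding kA_def by measurable

lemma kB_measurable [measurable]: "(\<lambda>x. kB q (f x) (g x)) \<in> borel_measurable M"
  if [measurable]: "f \<in> borel_measurable M" "g \<in> borel_measurable M"
  unfolding kB_def by measurable

lemma kX_nonneg [simp]: "0 \<le> kX q \<theta> \<eta>" by (simp add: kX_def)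

lemma ku_le_kX: "ku \<theta> \<le> kX q \<theta> \<eta>" by (simp add: kX_def)

lemma kA_nonneg [simp]: "0 \<le> kA q \<theta> \<eta>" by (simp add: kA_def)

lemma kB_nonneg [simp]: "0 \<le> kB q \<theta> \<eta>" by (simp add: kB_def)

lemma kB_le_kA: "kB q \<theta> \<eta> \<le> kA q \<theta> \<eta>"
proof (cases "kX q \<theta> \<eta> = 0")
  case False
  then have pos: "0 < sqrt (kX q \<theta> \<eta>)" using kX_nonneg[of q \<theta> \<eta>] by (simp add: less_le del: kX_nonneg)
  have "ku \<theta> \<le> (sqrt (kX q \<theta> \<eta>))\<^sup>2" using ku_le_kX by simp
  then show ?thesis using pos by (simp add: kA_def kB_def field_simps power2_eq_square power3_eq_cube)
qed (simp add: kA_def kB_def)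

lemma kA_periodic [simp]: "kA q (\<theta> + 2 * pi) \<eta> = kA q \<theta> \<eta>" "kA q \<theta> (\<eta> + 2 * pi) = kA q \<theta> \<eta>"
  and kB_periodic [simp]: "kB q (\<theta> + 2 * pi) \<eta> = kB q \<theta> \<eta>" "kB q \<theta> (\<eta> + 2 * pi) = kB q \<theta> \<eta>"
  and kA_minus [simp]: "kA q \<theta> (- \<eta>) = kA q \<theta> \<eta>" "kA q (- \<theta>) \<eta> = kA q \<theta> \<eta>"
  and kB_minus [simp]: "kB q \<theta> (- \<eta>) = kB q \<theta> \<eta>" "kB q (- \<theta>) \<eta> = kB q \<theta> \<eta>"
  by (simp_all add: kA_def kB_def kX_def)

lemma AE_circ_sin_nonzero: "AE x in circ. sin ((x - t) / 2) \<noteq> 0"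
proof -
  have "{x. sin ((x - t) / 2) = 0} \<subseteq> range (\<lambda>k::int. t + 2 * pi * of_int k)"
  proof
    fix x assume "x \<in> {x. sin ((x - t) / 2) = 0}"
    then obtain i :: int where "(x - t) / 2 = of_int i * pi" by (auto simp: sin_zero_iff_int2)
    then have "x = t + 2 * pi * of_int i" by (simp add: field_simps)
    then show "x \<in> range (\<lambda>k::int. t + 2 * pi * of_int k)" by blast
  qed
  then have "countable {x. sin ((x - t) / 2) = 0}" by (rule countable_subset) simp
  then have "{x. sin ((x - t) / 2) = 0} \<in> null_sets lborel" by (rule countable_imp_null_set_lborel)
  then have "AE x in lborel. x \<in> {0..2*pi} \<longrightarrow> sin ((x - t) / 2) \<noteq> 0"
    by (rule AE_I') auto
  then show ?thesis by (subst AE_circ_iff) auto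
qed

lemma integrable_abs_sin_shift: "integrable circ (\<lambda>x. 1 / sqrt \<bar>sin ((x - t) / 2)\<bar>)"
proof -
  define h where "h x = 1 / sqrt \<bar>sin (x / 2)\<bar>" for x :: real
  have [measurable]: "h \<in> borel_measurable borel" unfolding h_def by measurable
  have "integrable circ h"
  proof (subst integrable_cong_AE)
    show "AE x in circ. h x = 1 / sqrt (sin (x / 2))"
      using AE_circ_interior
    proof eventually_elim
      case (elim x)
      then have "0 \<le> sin (x / 2)" by (intro sin_ge_zero) auto
      then show ?case by (simp add: h_def)
    qed
  qed (use integrable_inverse_sqrt_sin in auto)
  moreover have "h (x + 2 * pi) = h x" for x by (simp add: h_def add_divide_distrib)
  ultimately have "integrable circ (\<lambda>x. h (x + (- t)))"
    by (subst integral_circ_shift(2)) auto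
  then show ?thesis by (simp add: h_def)
qed

text \<open>The arithmetic-geometric mean inequality for the two squares in \<open>kX\<close>
  replaces the point singularity by a product of two integrable one-variable factors.\<close>

lemma kA_le_product:
  assumes q: "q > 0" and s: "sin (\<theta> / 2) \<noteq> 0" "sin (\<eta> / 2) \<noteq> 0"
  shows "kA q \<theta> \<eta> \<le> 1 / sqrt (2 * q) * (1 / sqrt \<bar>sin (\<theta> / 2)\<bar> * (1 / sqrt \<bar>sin (\<eta> / 2)\<bar>))"
proof -
  let ?s = "\<bar>sin (\<theta> / 2)\<bar>" and ?t = "\<bar>sin (\<eta> / 2)\<bar>"
  have "0 \<le> (?s - q * ?t)\<^sup>2" by simp
  then have "2 * q * (?s * ?t) \<le> ?s\<^sup>2 + q\<^sup>2 * ?t\<^sup>2" by (simp add: power2_eq_square algebra_simps)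
  then have "2 * q * (?s * ?t) \<le> kX q \<theta> \<eta>" by (simp add: kX_def ku_sin)
  then have "sqrt (2 * q * (?s * ?t)) \<le> sqrt (kX q \<theta> \<eta>)" by simp
  moreover have "0 < 2 * q * (?s * ?t)" using q s by simp
  ultimately have "1 / sqrt (kX q \<theta> \<eta>) \<le> 1 / sqrt (2 * q * (?s * ?t))"
    by (smt (verit) frac_le real_sqrt_gt_zero zero_le_one)
  then show ?thesis by (simp add: kA_def real_sqrt_mult)
qed

lemma integrable_kA:
  assumes q: "q > 0"
  shows "integrable (circ \<Otimes>\<^sub>M circ) (\<lambda>(x, y). kA q (x - t) (y - p))"
proof (rule circ2.Fubini_integrable)
  define h where "h t x = 1 / sqrt \<bar>sin ((x - t) / 2)\<bar>" for t x
  have h: "integrable circ (h t)" for t unfolding h_def by (rule integrable_abs_sin_shift)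
  have h_nonneg: "0 \<le> h t x" for t x by (simp add: h_def)
  let ?c = "1 / sqrt (2 * q)"
  show "(\<lambda>(x, y). kA q (x - t) (y - p)) \<in> borel_measurable (circ \<Otimes>\<^sub>M circ)" by measurable
  have le: "AE y in circ. kA q (x - t) (y - p) \<le> ?c * (h t x * h p y)" if "sin ((x - t) / 2) \<noteq> 0" for x
    using AE_circ_sin_nonzero[of p]
    by eventually_elim (use kA_le_product[OF q that] in \<open>auto simp: h_def\<close>)
  have int: "integrable circ (\<lambda>y. kA q (x - t) (y - p))" if "sin ((x - t) / 2) \<noteq> 0" for x
    by (rule Bochner_Integration.integrable_bound[where f = "\<lambda>y. ?c * (h t x * h p y)"])
      (use h le[OF that] h_nonneg q in \<open>auto elim!: eventually_mono\<close>)
  then show "AE x in circ. integrable circ (\<lambda>y. case (x, y) of (x, y) \<Rightarrow> kA q (x - t) (y - p))"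
    using AE_circ_sin_nonzero[of t] by (auto elim!: eventually_mono)
  show "integrable circ (\<lambda>x. LINT y|circ. norm (case (x, y) of (x, y) \<Rightarrow> kA q (x - t) (y - p)))"
  proof (rule Bochner_Integration.integrable_bound)
    show "integrable circ (\<lambda>x. ?c * h t x * (LINT y|circ. h p y))" using h by simp
    show "AE x in circ. norm (LINT y|circ. norm (case (x, y) of (x, y) \<Rightarrow> kA q (x - t) (y - p)))
        \<le> norm (?c * h t x * (LINT y|circ. h p y))"
      using AE_circ_sin_nonzero[of t]
    proof eventually_elim
      case (elim x)
      have "(LINT y|circ. kA q (x - t) (y - p)) \<le> (LINT y|circ. ?c * (h t x * h p y))"
        by (rule integral_mono_AE[OF int[OF elim] _ le[OF elim]]) (use h in simp)
      then show ?case using q h_nonneg by (simp add: abs_of_nonneg integral_nonneg_AE mult_ac)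
    qed
  qed measurable
qed

lemma integrable_kA_0: "q > 0 \<Longrightarrow> integrable (circ \<Otimes>\<^sub>M circ) (\<lambda>(x, y). kA q x y)"
  using integrable_kA[of q 0 0] by simp

lemma integrable_kB_0: "q > 0 \<Longrightarrow> integrable (circ \<Otimes>\<^sub>M circ) (\<lambda>(x, y). kB q x y)"
  by (rule Bochner_Integration.integrable_bound[OF integrable_kA_0])
    (auto simp: kB_le_kA intro!: AE_I2)

definition acoef :: "real \<Rightarrow> nat \<Rightarrow> real" where
  "acoef q n = (LINT \<eta>|circ. (LINT \<theta>|circ. kA q \<theta> \<eta>) * cos (real n * \<eta>))"

definition bcoef :: "real \<Rightarrow> nat \<Rightarrow> real" where
  "bcoef q n = (LINT \<eta>|circ. (LINT \<theta>|circ. kB q \<theta> \<eta>) * cos (real n * \<eta>))"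

text \<open>The exchange puts the integral over \<eta> inside. For almost every fixed \<theta> the
  kernels used here are smooth in \<eta>, so their coefficients can be computed or integrated by
  parts.\<close>

lemma fourier_coefficient_Fubini:
  fixes k :: "real \<Rightarrow> real \<Rightarrow> real"
  assumes k: "integrable (circ \<Otimes>\<^sub>M circ) (case_prod k)"
  shows "integrable (circ \<Otimes>\<^sub>M circ) (\<lambda>(x, y). k x y * cos (real n * y))"
    and "(LINT \<eta>|circ. (LINT \<theta>|circ. k \<theta> \<eta>) * cos (real n * \<eta>))
       = (LINT \<theta>|circ. LINT \<eta>|circ. k \<theta> \<eta> * cos (real n * \<eta>))"
proof -
  have [measurable]: "case_prod k \<in> borel_measurable (circ \<Otimes>\<^sub>M circ)" using k by (rule borel_measurable_integrable)
  show int: "integrable (circ \<Otimes>\<^sub>M circ) (\<lambda>(x, y). k x y * cos (real n * y))"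
    by (rule Bochner_Integration.integrable_bound[OF k])
      (auto simp: abs_mult split_beta' intro!: AE_I2 mult_left_le)
  have "(LINT \<eta>|circ. LINT \<theta>|circ. k \<theta> \<eta> * cos (real n * \<eta>))
      = (LINT \<theta>|circ. LINT \<eta>|circ. k \<theta> \<eta> * cos (real n * \<eta>))"
    by (rule circ2.Fubini_integral[OF int])
  then show "(LINT \<eta>|circ. (LINT \<theta>|circ. k \<theta> \<eta>) * cos (real n * \<eta>))
       = (LINT \<theta>|circ. LINT \<eta>|circ. k \<theta> \<eta> * cos (real n * \<eta>))" by simp
qed

lemma DERIV_inverse_sqrt_power:
  fixes X :: "real \<Rightarrow> real"
  assumes X: "(X has_real_derivative X') (at x)" "X x > 0"
  shows "((\<lambda>x. 1 / sqrt (X x) ^ k) has_real_derivative - (real k / 2 * X' / sqrt (X x) ^ (k + 2))) (at x)"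
proof (cases k)
  case (Suc j)
  have S: "sqrt (X x) > 0" using X by simp
  have "((\<lambda>x. sqrt (X x)) has_real_derivative X' / (2 * sqrt (X x))) (at x)"
    using X by (auto intro!: derivative_eq_intros simp: field_simps)
  from DERIV_power[OF this, of k]
  have "((\<lambda>x. sqrt (X x) ^ k) has_real_derivative real k * (X' / (2 * sqrt (X x)) * sqrt (X x) ^ j)) (at x)"
    by (simp add: Suc)
  from DERIV_inverse_fun[OF this] S
  have "((\<lambda>x. 1 / sqrt (X x) ^ k) has_real_derivative
      - (real k * (X' / (2 * sqrt (X x)) * sqrt (X x) ^ j) * inverse ((sqrt (X x) ^ k)\<^sup>2))) (at x)"
    by (simp add: inverse_eq_divide numeral_2_eq_2)
  moreover have "real k * (X' / (2 * s) * s ^ j) * inverse ((s ^ k)\<^sup>2) = real k / 2 * X' / s ^ (k + 2)"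
    if "s > 0" for s :: real
    using that by (simp add: Suc power2_eq_square divide_simps)
  ultimately show ?thesis using S by simp
qed simp

lemma integral_circ_cos: "n > 0 \<Longrightarrow> (LINT \<eta>|circ. cos (real n * \<eta>)) = 0"
proof -
  assume n: "n > 0"
  have "(LINT \<eta>|circ. cos (real n * \<eta>)) = sin (real n * (2*pi)) / n - sin (real n * 0) / n"
    using n by (intro integral_circ_FTC[where F = "\<lambda>x. sin (real n * x) / n"])
      (auto intro!: derivative_eq_intros continuous_intros)
  then show ?thesis using sin_multiple_periodic(1)[of n 0] by simp
qed

subsection \<open>Fourier coefficients of the kernels\<close>

text \<open>The characteristic roots are \<open>\<tau>\<close> and \<open>1 / \<tau>\<close>. The
  combination \<open>d\<close> removes the decaying solution; unless it is 0 it grows like the n-th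
  power of \<open>1 / \<tau>\<close>, which boundedness excludes.\<close>

lemma bounded_three_term_recurrence:
  fixes I :: "nat \<Rightarrow> real"
  assumes rec: "\<And>n. I (Suc (Suc n)) + I n = 2 * \<alpha> * I (Suc n)" and bd: "\<And>n. \<bar>I n\<bar> \<le> K"
    and \<tau>: "0 < \<tau>" "\<tau> < 1" "\<tau>\<^sup>2 + 1 = 2 * \<alpha> * \<tau>"
  shows "I n = \<tau> ^ n * I 0"
proof -
  define d where "d n = I (Suc n) - \<tau> * I n" for n
  have step: "d n = \<tau> * d (Suc n)" for n
  proof -
    have r: "I (Suc (Suc n)) = 2 * \<alpha> * I (Suc n) - I n" using rec[of n] by linarith
    have "\<tau> * d (Suc n) = \<tau> * (2 * \<alpha> * I (Suc n) - I n) - \<tau>\<^sup>2 * I (Suc n)"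
      unfolding d_def r by (simp add: power2_eq_square algebra_simps)
    also have "\<dots> = (2 * \<alpha> * \<tau> - \<tau>\<^sup>2) * I (Suc n) - \<tau> * I n" by (simp add: algebra_simps)
    also have "2 * \<alpha> * \<tau> - \<tau>\<^sup>2 = 1" using \<tau>(3) by simp
    finally show ?thesis by (simp add: d_def)
  qed
  have d_bd: "\<bar>d n\<bar> \<le> 2 * K" for n
  proof -
    have "\<bar>d n\<bar> \<le> \<bar>I (Suc n)\<bar> + \<tau> * \<bar>I n\<bar>"
      unfolding d_def using \<tau>(1) by (metis abs_mult abs_of_pos abs_triangle_ineq4)
    also have "\<tau> * \<bar>I n\<bar> \<le> 1 * \<bar>I n\<bar>" using \<tau> by (intro mult_right_mono) auto
    finally show ?thesis using bd[of n] bd[of "Suc n"] by simp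
  qed
  have d0: "d n = 0" for n
  proof -
    have "d n = \<tau> ^ m * d (n + m)" for m
    proof (induction m)
      case (Suc m)
      have "\<tau> ^ m * d (n + m) = \<tau> ^ m * (\<tau> * d (Suc (n + m)))" using step[of "n + m"] by (rule arg_cong)
      with Suc show ?case by simp
    qed simp
    then have "\<bar>d n\<bar> \<le> \<tau> ^ m * (2 * K)" for m
      using d_bd \<tau>(1) by (metis abs_mult abs_of_pos mult_left_mono zero_less_power less_imp_le)
    moreover have "(\<lambda>m. \<tau> ^ m * (2 * K)) \<longlonglongrightarrow> 0 * (2 * K)"
      using \<tau> by (intro tendsto_intros LIMSEQ_power_zero) auto
    ultimately have "\<bar>d n\<bar> \<le> 0 * (2 * K)" by (intro LIMSEQ_le_const) auto
    then show ?thesis by simp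
  qed
  show ?thesis
  proof (induction n)
    case (Suc n)
    then show ?case using d0[of n] by (simp add: d_def)
  qed simp
qed

text \<open>The denominator is \<open>q\<^sup>2 / 2\<close> times
  \<open>\<alpha> - cos \<eta>\<close> with \<open>\<alpha> = 1 + 2 * y / q\<^sup>2\<close>, so for
  \<open>y > 0\<close> these are, up to a factor, Fourier coefficients of a Poisson kernel. The
  inverse square root is later decomposed into such functions.\<close>

definition poisson_int :: "real \<Rightarrow> real \<Rightarrow> nat \<Rightarrow> real" where
  "poisson_int q y n = (LINT \<eta>|circ. cos (real n * \<eta>) / (y + q\<^sup>2 * ku \<eta>))"

context
  fixes q :: real
  assumes q: "q > 0"
begin

lemma poisson_denominator_pos: "y > 0 \<Longrightarrow> y + q\<^sup>2 * ku \<eta> > 0"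
  by (intro add_pos_nonneg) auto

lemma continuous_poisson_integrand:
  assumes y: "y > 0"
  shows "continuous_on UNIV (\<lambda>\<eta>. cos (real n * \<eta>) / (y + q\<^sup>2 * ku \<eta>))"
proof (intro continuous_on_divide ballI)
  show "continuous_on UNIV (\<lambda>\<eta>. y + q\<^sup>2 * ku \<eta>)" unfolding ku_def by (intro continuous_intros) simp
  show "y + q\<^sup>2 * ku \<eta> \<noteq> 0" for \<eta> using poisson_denominator_pos[OF y, of \<eta>] by simp
qed (intro continuous_intros)

lemma integrable_poisson_integrand:
  "y > 0 \<Longrightarrow> integrable circ (\<lambda>\<eta>. cos (real n * \<eta>) / (y + q\<^sup>2 * ku \<eta>))"
  by (intro integrable_circ_continuous continuous_poisson_integrand)

text \<open>In twice cos \<eta> cos ((n + 1) \<eta>) the factor cos \<eta> is replaced by a constant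
  minus a multiple of the denominator. The cancelled term leaves the integral of cos ((n + 1)
  \<eta>), which vanishes because n + 1 > 0.\<close>

lemma poisson_int_recurrence:
  assumes y: "y > 0"
  shows "poisson_int q y (Suc (Suc n)) + poisson_int q y n = 2 * (1 + 2 * y / q\<^sup>2) * poisson_int q y (Suc n)"
proof -
  let ?D = "\<lambda>\<eta>. y + q\<^sup>2 * ku \<eta>"
  note D = poisson_denominator_pos[OF y]
  have eq: "cos (real (Suc (Suc n)) * \<eta>) / ?D \<eta> + cos (real n * \<eta>) / ?D \<eta>
      = 2 * (1 + 2 * y / q\<^sup>2) * (cos (real (Suc n) * \<eta>) / ?D \<eta>) - 4 / q\<^sup>2 * cos (real (Suc n) * \<eta>)" for \<eta>
  proof -
    define c where "c = cos (real (Suc n) * \<eta>)"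
    have "cos (real (Suc (Suc n)) * \<eta>) + cos (real n * \<eta>) = 2 * cos \<eta> * c"
      using cos_add[of "real (Suc n) * \<eta>" \<eta>] cos_diff[of "real (Suc n) * \<eta>" \<eta>]
      by (simp add: c_def algebra_simps)
    then have "cos (real (Suc (Suc n)) * \<eta>) / ?D \<eta> + cos (real n * \<eta>) / ?D \<eta> = 2 * cos \<eta> * c / ?D \<eta>"
      by (simp add: add_divide_distrib[symmetric])
    also have "cos \<eta> = 1 + 2 * y / q\<^sup>2 - 2 / q\<^sup>2 * ?D \<eta>"
      using q by (simp add: ku_def field_simps)
    also have "2 * (1 + 2 * y / q\<^sup>2 - 2 / q\<^sup>2 * ?D \<eta>) * c / ?D \<eta>
        = 2 * (1 + 2 * y / q\<^sup>2) * (c / ?D \<eta>) - 4 / q\<^sup>2 * c"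
    proof -
      have "2 * (A - B * z) * c / z = 2 * A * (c / z) - 2 * B * c" if "z > 0" for A B z
        using that by (simp add: field_simps)
      from this[OF D[of \<eta>], of "1 + 2 * y / q\<^sup>2" "2 / q\<^sup>2"] show ?thesis by simp
    qed
    finally show ?thesis by (simp add: c_def)
  qed
  have int2: "integrable circ (\<lambda>\<eta>. cos (real (Suc n) * \<eta>))"
    by (intro integrable_circ_continuous continuous_intros)
  have "poisson_int q y (Suc (Suc n)) + poisson_int q y n
      = (LINT \<eta>|circ. cos (real (Suc (Suc n)) * \<eta>) / ?D \<eta> + cos (real n * \<eta>) / ?D \<eta>)"
    unfolding poisson_int_def
    by (rule Bochner_Integration.integral_add[symmetric]) (intro integrable_poisson_integrand y)+
  also have "\<dots> = (LINT \<eta>|circ. 2 * (1 + 2 * y / q\<^sup>2) * (cos (real (Suc n) * \<eta>) / ?D \<eta>) - 4 / q\<^sup>2 * cos (real (Suc n) * \<eta>))"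
    unfolding eq ..
  also have "\<dots> = 2 * (1 + 2 * y / q\<^sup>2) * poisson_int q y (Suc n) - 4 / q\<^sup>2 * (LINT \<eta>|circ. cos (real (Suc n) * \<eta>))"
    unfolding poisson_int_def
    using integrable_poisson_integrand[OF y, of "Suc n"] int2
    by (subst Bochner_Integration.integral_diff) (simp_all only: integral_mult_right_zero integrable_mult_right)
  also have "(LINT \<eta>|circ. cos (real (Suc n) * \<eta>)) = 0" by (rule integral_circ_cos) simp
  finally show ?thesis by simp
qed

lemma poisson_int_geometric:
  assumes y: "y > 0"
  defines "\<alpha> \<equiv> 1 + 2 * y / q\<^sup>2"
  shows "poisson_int q y n = (\<alpha> - sqrt (\<alpha>\<^sup>2 - 1)) ^ n * poisson_int q y 0"
proof (rule bounded_three_term_recurrence)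
  have a1: "\<alpha> > 1" unfolding \<alpha>_def using y q by simp
  then have "1 < \<alpha>\<^sup>2" by (simp add: one_less_power)
  then have "\<alpha>\<^sup>2 - 1 > 0" by simp
  show "poisson_int q y (Suc (Suc n)) + poisson_int q y n = 2 * \<alpha> * poisson_int q y (Suc n)" for n
    unfolding \<alpha>_def by (rule poisson_int_recurrence[OF y])
  show "\<bar>poisson_int q y n\<bar> \<le> poisson_int q y 0" for n
  proof -
    have "\<bar>poisson_int q y n\<bar> \<le> (LINT \<eta>|circ. \<bar>cos (real n * \<eta>) / (y + q\<^sup>2 * ku \<eta>)\<bar>)"
      unfolding poisson_int_def by (rule integral_abs_bound)
    also have "\<dots> \<le> (LINT \<eta>|circ. cos (real 0 * \<eta>) / (y + q\<^sup>2 * ku \<eta>))"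
      by (intro integral_mono integrable_abs integrable_poisson_integrand y)
        (use poisson_denominator_pos[OF y] in \<open>auto simp: abs_mult less_imp_le intro!: divide_right_mono\<close>)
    finally show ?thesis unfolding poisson_int_def .
  qed
  have "sqrt (\<alpha>\<^sup>2 - 1) < sqrt (\<alpha>\<^sup>2)" by (rule real_sqrt_less_mono) simp
  then show "0 < \<alpha> - sqrt (\<alpha>\<^sup>2 - 1)" using a1 by simp
  have "(\<alpha> - 1)\<^sup>2 < \<alpha>\<^sup>2 - 1" using a1 by (simp add: power2_eq_square algebra_simps)
  then have "\<alpha> - 1 < sqrt (\<alpha>\<^sup>2 - 1)" by (rule real_less_rsqrt)
  then show "\<alpha> - sqrt (\<alpha>\<^sup>2 - 1) < 1" by simp
  have "(sqrt (\<alpha>\<^sup>2 - 1))\<^sup>2 = \<alpha>\<^sup>2 - 1" using \<open>\<alpha>\<^sup>2 - 1 > 0\<close> by simp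
  then show "(\<alpha> - sqrt (\<alpha>\<^sup>2 - 1))\<^sup>2 + 1 = 2 * \<alpha> * (\<alpha> - sqrt (\<alpha>\<^sup>2 - 1))"
    by (simp add: power2_diff) (simp add: power2_eq_square algebra_simps)
qed

lemma poisson_int_nonneg: "y > 0 \<Longrightarrow> 0 \<le> poisson_int q y n"
proof -
  assume y: "y > 0"
  define \<alpha> where "\<alpha> = 1 + 2 * y / q\<^sup>2"
  have "\<alpha> > 1" unfolding \<alpha>_def using y q by simp
  moreover have "sqrt (\<alpha>\<^sup>2 - 1) \<le> sqrt (\<alpha>\<^sup>2)" by (rule real_sqrt_le_mono) simp
  ultimately have "0 \<le> \<alpha> - sqrt (\<alpha>\<^sup>2 - 1)" by simp
  moreover have "0 \<le> poisson_int q y 0"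
    unfolding poisson_int_def using poisson_denominator_pos[OF y]
    by (intro integral_nonneg_AE AE_I2) (auto intro: less_imp_le)
  ultimately have "0 \<le> (\<alpha> - sqrt (\<alpha>\<^sup>2 - 1)) ^ n * poisson_int q y 0" by simp
  then show ?thesis using poisson_int_geometric[OF y, of n] unfolding \<alpha>_def[symmetric] by linarith
qed

text \<open>Only the range \<open>{0..sqrt y}\<close> is kept, on which
  \<open>ku \<eta> \<le> y / 4\<close> and the denominator is at most
  \<open>y * (1 + q\<^sup>2 / 4)\<close>.\<close>

lemma poisson_int_0_ge:
  assumes y: "y > 0" "sqrt y \<le> 2 * pi"
  shows "1 / (sqrt y * (1 + q\<^sup>2 / 4)) \<le> poisson_int q y 0"
proof -
  let ?c = "1 / (y * (1 + q\<^sup>2 / 4))"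
  have q2: "1 + q\<^sup>2 / 4 > 0" by (simp add: add_pos_nonneg)
  have "1 / (sqrt y * (1 + q\<^sup>2 / 4)) = sqrt y * ?c"
  proof -
    have "1 / (s * c) = s * (1 / (s\<^sup>2 * c))" if "s > 0" "c > 0" for s c :: real
      using that by (simp add: power2_eq_square)
    from this[of "sqrt y" "1 + q\<^sup>2 / 4"] show ?thesis using y q2 by simp
  qed
  also have "\<dots> = (LINT x|lborel. indicator {0..sqrt y} x * ?c)" using y by simp
  also have "\<dots> = (LINT x|circ. indicator {0..sqrt y} x * ?c)"
    using y by (subst integral_circ)
      (auto simp: set_lebesgue_integral_def indicator_def intro!: Bochner_Integration.integral_cong)
  also have "\<dots> \<le> (LINT \<eta>|circ. cos (real 0 * \<eta>) / (y + q\<^sup>2 * ku \<eta>))"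
  proof (intro integral_mono integrable_poisson_integrand y)
    show "integrable circ (\<lambda>x. indicator {0..sqrt y} x * ?c)"
      by (intro integrable_mult_left) (simp add: integrable_indicator_iff less_top[symmetric])
    fix \<eta>
    show "indicator {0..sqrt y} \<eta> * ?c \<le> cos (real 0 * \<eta>) / (y + q\<^sup>2 * ku \<eta>)"
    proof (cases "\<eta> \<in> {0..sqrt y}")
      case True
      then have "\<eta>\<^sup>2 \<le> (sqrt y)\<^sup>2" by (intro power_mono) auto
      then have "ku \<eta> \<le> y / 4" using ku_le_square[of \<eta>] y by simp
      then have "q\<^sup>2 * ku \<eta> \<le> q\<^sup>2 * (y / 4)" by (intro mult_left_mono) auto
      then have "y + q\<^sup>2 * ku \<eta> \<le> y * (1 + q\<^sup>2 / 4)" by (simp add: algebra_simps)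
      then show ?thesis using True poisson_denominator_pos[OF y(1), of \<eta>] y q2
        by (simp add: frac_le)
    qed (use poisson_denominator_pos[OF y(1), of \<eta>] in \<open>auto intro: less_imp_le\<close>)
  qed
  finally show ?thesis by (simp add: poisson_int_def)
qed

text \<open>For \<open>y\<close> of order \<open>1 / n\<^sup>2\<close> the geometric ratio is at
  least \<open>1 - 1 / (2 * n)\<close>, so by Bernoulli its n-th power is at least 1/2. The constant
  5/4 is \<open>1 + 1/4\<close>, from \<open>s\<^sup>2 + ku \<theta>\<close> with \<open>s\<close>
  and \<open>\<theta>\<close> at most \<open>\<kappa> / n\<close>. The condition
  \<open>\<kappa> \<le> q / 6\<close> gives \<open>\<alpha> - 1 \<le> 1 / (12 * n\<^sup>2)\<close>,
  and \<open>\<kappa> \<le> 1\<close> keeps \<open>sqrt y\<close> within one period.\<close>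

lemma poisson_int_ge:
  assumes \<kappa>: "0 < \<kappa>" "\<kappa> \<le> 1" "\<kappa> \<le> q / 6" and n: "n > 0" and y: "0 < y" "y \<le> 5/4 * (\<kappa> / n)\<^sup>2"
  shows "n / (4 * \<kappa> * (1 + q\<^sup>2 / 4)) \<le> poisson_int q y n"
proof -
  define \<alpha> where "\<alpha> = 1 + 2 * y / q\<^sup>2"
  have q2: "1 + q\<^sup>2 / 4 > 0" by (simp add: add_pos_nonneg)
  have n1: "real n \<ge> 1" using n by simp
  have sy: "sqrt y \<le> 2 * (\<kappa> / n)"
  proof (rule real_le_lsqrt)
    have "(2 * (\<kappa> / n))\<^sup>2 = 4 * (\<kappa> / n)\<^sup>2" by (simp only: power_mult_distrib) simp
    moreover have "0 \<le> (\<kappa> / n)\<^sup>2" by simp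
    ultimately show "y \<le> (2 * (\<kappa> / n))\<^sup>2" using y(2) by linarith
  qed (use \<kappa> in auto)
  have "\<kappa> / n \<le> 1" using n1 \<kappa> by (simp add: divide_le_eq)
  then have sy2: "sqrt y \<le> 2 * pi" using sy pi_gt3 by linarith
  have \<kappa>q: "\<kappa>\<^sup>2 \<le> q\<^sup>2 / 36" using power_mono[OF \<kappa>(3), of 2] \<kappa>(1) by (simp add: power_divide)
  have "2 * y / q\<^sup>2 \<le> 1 / (12 * (real n)\<^sup>2)"
  proof -
    have "y \<le> 5/4 * (\<kappa>\<^sup>2 / (real n)\<^sup>2)" using y(2) by (simp add: power_divide)
    also have "\<dots> \<le> 5/4 * (q\<^sup>2 / 36 / (real n)\<^sup>2)" using \<kappa>q by (intro mult_left_mono divide_right_mono) auto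
    finally have "2 * y / q\<^sup>2 \<le> 2 * (5/4 * (q\<^sup>2 / 36 / (real n)\<^sup>2)) / q\<^sup>2" by (intro divide_right_mono) auto
    also have "\<dots> = 5 / (72 * (real n)\<^sup>2)" using q by (simp add: field_simps)
    also have "\<dots> \<le> 1 / (12 * (real n)\<^sup>2)" using n by (simp add: field_simps)
    finally show ?thesis .
  qed
  then have \<alpha>1: "\<alpha> - 1 \<le> 1 / (12 * (real n)\<^sup>2)" by (simp add: \<alpha>_def)
  have \<alpha>0: "\<alpha> \<ge> 1" using y q by (simp add: \<alpha>_def)
  have "1 \<le> (real n)\<^sup>2" by (rule one_le_power[OF n1])
  then have "1 / (12 * (real n)\<^sup>2) \<le> 1 / 12" using n by (intro divide_left_mono) auto
  then have "\<alpha> + 1 \<le> 3" using \<alpha>1 by linarith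
  then have "(\<alpha> - 1) * (\<alpha> + 1) \<le> 1 / (12 * (real n)\<^sup>2) * 3" using \<alpha>1 \<alpha>0 by (intro mult_mono) auto
  then have "\<alpha>\<^sup>2 - 1 \<le> (1 / (2 * n))\<^sup>2" by (simp add: power2_eq_square algebra_simps)
  then have "sqrt (\<alpha>\<^sup>2 - 1) \<le> 1 / (2 * n)" using real_sqrt_le_mono by fastforce
  then have \<tau>: "1 - 1 / (2 * n) \<le> \<alpha> - sqrt (\<alpha>\<^sup>2 - 1)" using \<alpha>0 by simp
  have "1 / (2 * real n) \<le> 1" using n1 by simp
  have "1 / 2 = 1 + real n * (- (1 / (2 * real n)))" using n by simp
  also have "\<dots> \<le> (1 + (- (1 / (2 * real n)))) ^ n"
    using \<open>1 / (2 * real n) \<le> 1\<close> by (intro Bernoulli_inequality) simp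
  also have "\<dots> \<le> (\<alpha> - sqrt (\<alpha>\<^sup>2 - 1)) ^ n"
    using \<tau> \<open>1 / (2 * real n) \<le> 1\<close> by (intro power_mono) auto
  finally have half: "1 / 2 \<le> (\<alpha> - sqrt (\<alpha>\<^sup>2 - 1)) ^ n" .
  have "n / (4 * \<kappa> * (1 + q\<^sup>2 / 4)) = 1 / 2 * (1 / (2 * (\<kappa> / n) * (1 + q\<^sup>2 / 4)))"
    by simp
  also have "\<dots> \<le> 1 / 2 * (1 / (sqrt y * (1 + q\<^sup>2 / 4)))"
    using sy y q2 \<kappa> n by (intro mult_left_mono divide_left_mono mult_right_mono mult_pos_pos) auto
  also have "\<dots> \<le> (\<alpha> - sqrt (\<alpha>\<^sup>2 - 1)) ^ n * poisson_int q y 0"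
    using half poisson_int_0_ge[OF y(1) sy2] y q2 by (intro mult_mono) auto
  also have "\<dots> = poisson_int q y n" unfolding poisson_int_geometric[OF y(1), of n] \<alpha>_def ..
  finally show ?thesis .
qed

end

section \<open>Subordination: lower bound and decay of a_n\<close>

text \<open>Writes \<open>1 / sqrt X\<close> as a positive superposition of the functions
  \<open>1 / (s\<^sup>2 + X)\<close>. For \<open>X = kX q \<theta> \<eta>\<close> each of them is a
  Poisson denominator with \<open>y = s\<^sup>2 + ku \<theta>\<close>, so positivity and explicit
  size pass to the coefficients of \<open>kA\<close>.\<close>

lemma subordination_integral:
  assumes X: "X > (0::real)"
  shows "has_bochner_integral lborel (\<lambda>s. indicator {0..} s * (1 / (s\<^sup>2 + X))) (pi / (2 * sqrt X))"
proof -
  have pos: "s\<^sup>2 + X > 0" for s using X by (simp add: add_nonneg_pos)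
  have "(\<integral>\<^sup>+s. ennreal (1 / (s\<^sup>2 + X)) * indicator {0..} s \<partial>lborel)
      = ennreal (pi / 2 / sqrt X - arctan (0 / sqrt X) / sqrt X)"
  proof (rule nn_integral_FTC_atLeast)
    show "((\<lambda>s. arctan (s / sqrt X) / sqrt X) has_real_derivative 1 / (s\<^sup>2 + X)) (at s)" for s
    proof -
      have "inverse (1 + (s / t)\<^sup>2) * (1 / t) / t = 1 / (s\<^sup>2 + t\<^sup>2)" if "t > 0" for t
      proof -
        have "1 + (s / t)\<^sup>2 = (s\<^sup>2 + t\<^sup>2) / t\<^sup>2"
          using that by (simp add: power_divide add_divide_distrib)
        then show ?thesis using that by (simp add: power2_eq_square)
      qed
      from this[of "sqrt X"] X
      have e: "inverse (1 + (s / sqrt X)\<^sup>2) * (1 / sqrt X) / sqrt X = 1 / (s\<^sup>2 + X)" by simp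
      have "((\<lambda>s. arctan (s / sqrt X) / sqrt X) has_real_derivative
          inverse (1 + (s / sqrt X)\<^sup>2) * (1 / sqrt X) / sqrt X) (at s)"
        by (rule DERIV_cdivide[OF DERIV_chain2[OF DERIV_arctan DERIV_cdivide[OF DERIV_ident]]])
      then show ?thesis unfolding e .
    qed
    have "filterlim (\<lambda>s. s * (1 / sqrt X)) at_top at_top"
      using X by (intro filterlim_at_top_mult_tendsto_pos[OF tendsto_const] filterlim_ident) auto
    then have "((\<lambda>s. arctan (s / sqrt X)) \<longlongrightarrow> pi / 2) at_top"
      using filterlim_compose[OF tendsto_arctan_at_top] by simp
    then show "((\<lambda>s. arctan (s / sqrt X) / sqrt X) \<longlongrightarrow> pi / 2 / sqrt X) at_top"
      using X by (intro tendsto_intros) auto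
  qed (use pos in \<open>auto intro: less_imp_le\<close>)
  moreover have "ennreal (indicator {0..} s * (1 / (s\<^sup>2 + X))) = ennreal (1 / (s\<^sup>2 + X)) * indicator {0..} s" for s
    by (simp add: indicator_def)
  ultimately have "(\<integral>\<^sup>+s. ennreal (indicator {0..} s * (1 / (s\<^sup>2 + X))) \<partial>lborel) = ennreal (pi / (2 * sqrt X))"
    by simp
  then show ?thesis
    by (intro has_bochner_integral_nn_integral) (use X pos in \<open>auto intro!: AE_I2 mult_nonneg_nonneg intro: less_imp_le\<close>)
qed

interpretation lborel_circ: pair_sigma_finite lborel circ ..

context
  fixes q :: real
  assumes q: "q > 0"
begin

lemma kX_pos: "ku \<theta> > 0 \<Longrightarrow> kX q \<theta> \<eta> > 0"
  by (simp add: kX_def add_pos_nonneg)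

lemma kX_pos': "ku \<eta> > 0 \<Longrightarrow> kX q \<theta> \<eta> > 0"
  using q by (simp add: kX_def add_nonneg_pos)

lemma kA_coefficient_subordination:
  assumes u: "ku \<theta> > 0"
  shows "(LINT \<eta>|circ. kA q \<theta> \<eta> * cos (real n * \<eta>))
      = 2 / pi * (LINT s|lborel. indicator {0..} s * poisson_int q (s\<^sup>2 + ku \<theta>) n)"
    and "integrable lborel (\<lambda>s. indicator {0..} s * poisson_int q (s\<^sup>2 + ku \<theta>) n)"
proof -
  define f where "f s \<eta> = indicator {0..} s * (cos (real n * \<eta>) / (s\<^sup>2 + ku \<theta> + q\<^sup>2 * ku \<eta>))" for s \<eta> :: real
  have y: "s\<^sup>2 + ku \<theta> > 0" for s using u by (simp add: add_nonneg_pos)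
  have [measurable]: "case_prod f \<in> borel_measurable (lborel \<Otimes>\<^sub>M circ)"
    unfolding f_def by measurable
  have inner: "(LINT \<eta>|circ. f s \<eta>) = indicator {0..} s * poisson_int q (s\<^sup>2 + ku \<theta>) n" for s
    unfolding f_def poisson_int_def by (rule integral_mult_right_zero)
  have f_le: "\<bar>f s \<eta>\<bar> \<le> indicator {0..} s * (1 / (s\<^sup>2 + ku \<theta>))" for s \<eta>
  proof -
    have "\<bar>cos (real n * \<eta>)\<bar> / (s\<^sup>2 + ku \<theta> + q\<^sup>2 * ku \<eta>) \<le> 1 / (s\<^sup>2 + ku \<theta>)"
      using y[of s] by (intro frac_le) auto
    then show ?thesis using y[of s] by (simp add: f_def abs_mult indicator_def)
  qed
  have fint: "integrable circ (f s)" for s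
    unfolding f_def by (intro integrable_mult_right integrable_poisson_integrand[OF q y])
  have int: "integrable (lborel \<Otimes>\<^sub>M circ) (case_prod f)"
  proof (rule lborel_circ.Fubini_integrable)
    show "integrable lborel (\<lambda>s. LINT \<eta>|circ. norm (case (s, \<eta>) of (x, xa) \<Rightarrow> f x xa))"
    proof (rule Bochner_Integration.integrable_bound)
      show "integrable lborel (\<lambda>s. 2 * pi * (indicator {0..} s * (1 / (s\<^sup>2 + ku \<theta>))))"
        using subordination_integral[OF u] unfolding has_bochner_integral_iff
        by (intro integrable_mult_right) blast
      show "AE s in lborel. norm (LINT \<eta>|circ. norm (case (s, \<eta>) of (x, xa) \<Rightarrow> f x xa))
          \<le> norm (2 * pi * (indicator {0..} s * (1 / (s\<^sup>2 + ku \<theta>))))"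
      proof (rule AE_I2)
        fix s
        have "(LINT \<eta>|circ. \<bar>f s \<eta>\<bar>) \<le> (LINT \<eta>|circ. indicator {0..} s * (1 / (s\<^sup>2 + ku \<theta>)))"
          using fint f_le by (intro integral_mono) auto
        also have "\<dots> = 2 * pi * (indicator {0..} s * (1 / (s\<^sup>2 + ku \<theta>)))"
          by (simp add: measure_circ_space)
        finally have "(LINT \<eta>|circ. \<bar>f s \<eta>\<bar>) \<le> 2 * pi * (indicator {0..} s * (1 / (s\<^sup>2 + ku \<theta>)))" .
        moreover have "0 \<le> (LINT \<eta>|circ. \<bar>f s \<eta>\<bar>)" by simp
        ultimately show "norm (LINT \<eta>|circ. norm (case (s, \<eta>) of (x, xa) \<Rightarrow> f x xa))
          \<le> norm (2 * pi * (indicator {0..} s * (1 / (s\<^sup>2 + ku \<theta>))))"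
          by (simp only: real_norm_def prod.case)
      qed
    qed measurable
  qed (use fint in auto)
  have "(LINT s|lborel. f s \<eta>) = pi / 2 * (kA q \<theta> \<eta> * cos (real n * \<eta>))" for \<eta>
  proof -
    have "(\<lambda>s. f s \<eta>) = (\<lambda>s. cos (real n * \<eta>) * (indicator {0..} s * (1 / (s\<^sup>2 + kX q \<theta> \<eta>))))"
      by (simp add: f_def kX_def fun_eq_iff add.assoc)
    then have "(LINT s|lborel. f s \<eta>) = cos (real n * \<eta>) * (pi / (2 * sqrt (kX q \<theta> \<eta>)))"
      using subordination_integral[OF kX_pos[OF u], of \<eta>] unfolding has_bochner_integral_iff
      by (simp only: integral_mult_right_zero)
    then show ?thesis by (simp add: kA_def)
  qed
  then have "pi / 2 * (LINT \<eta>|circ. kA q \<theta> \<eta> * cos (real n * \<eta>)) = (LINT \<eta>|circ. LINT s|lborel. f s \<eta>)"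
    by (simp only: integral_mult_right_zero)
  also have "\<dots> = (LINT s|lborel. LINT \<eta>|circ. f s \<eta>)" by (rule lborel_circ.Fubini_integral[OF int])
  finally show "(LINT \<eta>|circ. kA q \<theta> \<eta> * cos (real n * \<eta>))
      = 2 / pi * (LINT s|lborel. indicator {0..} s * poisson_int q (s\<^sup>2 + ku \<theta>) n)"
    by (simp add: inner field_simps)
  show "integrable lborel (\<lambda>s. indicator {0..} s * poisson_int q (s\<^sup>2 + ku \<theta>) n)"
    using lborel_circ.integrable_fst'[OF int] by (simp add: inner)
qed

lemma integrable_kA_coefficient: "integrable circ (\<lambda>\<theta>. LINT \<eta>|circ. kA q \<theta> \<eta> * cos (real n * \<eta>))"
  using circ2.integrable_fst'[OF fourier_coefficient_Fubini(1)[OF integrable_kA_0[OF q]]] by simp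

lemma acoef_eq: "acoef q n = (LINT \<theta>|circ. LINT \<eta>|circ. kA q \<theta> \<eta> * cos (real n * \<eta>))"
  unfolding acoef_def by (rule fourier_coefficient_Fubini(2)[OF integrable_kA_0[OF q]])

text \<open>All contributions are nonnegative, so it suffices to keep \<open>s\<close> and
  \<open>\<theta>\<close> in \<open>{0..\<kappa> / n}\<close>, a square of area
  \<open>(\<kappa> / n)\<^sup>2\<close> on which the integrand is at least of order
  \<open>n\<close>. The order 1/n matches the logarithmic singularity of the kernel A.\<close>

lemma acoef_lower_bound: "\<exists>c>0. \<forall>n>0. c / real n \<le> acoef q n"
proof -
  define \<kappa> where "\<kappa> = min 1 (q / 6)"
  have \<kappa>: "0 < \<kappa>" "\<kappa> \<le> 1" "\<kappa> \<le> q / 6" using q by (auto simp: \<kappa>_def)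
  define Q where "Q = 1 + q\<^sup>2 / 4"
  have Q: "Q > 0" by (simp add: Q_def add_pos_nonneg)
  define c0 where "c0 = 1 / (2 * pi * Q)"
  have c0: "c0 > 0" using Q by (simp add: c0_def)
  have "c0 * \<kappa> / real n \<le> acoef q n" if n: "n > 0" for n
  proof -
    let ?G = "\<lambda>\<theta>. LINT \<eta>|circ. kA q \<theta> \<eta> * cos (real n * \<eta>)"
    have y: "s\<^sup>2 + ku \<theta> > 0" if "ku \<theta> > 0" for s \<theta> using that by (simp add: add_nonneg_pos)
    have G_nonneg: "0 \<le> ?G \<theta>" if "ku \<theta> > 0" for \<theta>
      unfolding kA_coefficient_subordination(1)[OF that]
      using poisson_int_nonneg[OF q y[OF that]] by (intro mult_nonneg_nonneg integral_nonneg_AE AE_I2) auto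
    have G_ge: "c0 \<le> ?G \<theta>" if \<theta>: "ku \<theta> > 0" "0 \<le> \<theta>" "\<theta> \<le> \<kappa> / n" for \<theta>
    proof -
      have "c0 = 2 / pi * (LINT s|lborel. indicator {0..\<kappa> / n} s * (n / (4 * \<kappa> * Q)))"
        using \<kappa> n Q by (simp add: c0_def field_simps)
      also have "\<dots> \<le> 2 / pi * (LINT s|lborel. indicator {0..} s * poisson_int q (s\<^sup>2 + ku \<theta>) n)"
      proof (intro mult_left_mono integral_mono kA_coefficient_subordination(2) \<theta>)
        show "integrable lborel (\<lambda>s. indicator {0..\<kappa> / n} s * (n / (4 * \<kappa> * Q)))"
          by (intro integrable_mult_left) (simp add: integrable_indicator_iff emeasure_lborel_Icc_eq)
        fix s :: real
        show "indicator {0..\<kappa> / n} s * (n / (4 * \<kappa> * Q)) \<le> indicator {0..} s * poisson_int q (s\<^sup>2 + ku \<theta>) n"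
        proof (cases "s \<in> {0..\<kappa> / n}")
          case True
          have "s\<^sup>2 \<le> (\<kappa> / n)\<^sup>2" using True by (intro power_mono) auto
          moreover have "\<theta>\<^sup>2 \<le> (\<kappa> / n)\<^sup>2" using \<theta> by (intro power_mono) auto
          ultimately have "s\<^sup>2 + ku \<theta> \<le> 5/4 * (\<kappa> / n)\<^sup>2" using ku_le_square[of \<theta>] by linarith
          then show ?thesis using True poisson_int_ge[OF q \<kappa> n y[OF \<theta>(1)]] by (simp add: Q_def)
        next
          case False
          then show ?thesis using poisson_int_nonneg[OF q y[OF \<theta>(1)]] by (simp add: indicator_def)
        qed
      qed simp
      finally show ?thesis unfolding kA_coefficient_subordination(1)[OF \<theta>(1)] .
    qed
    have n1: "real n \<ge> 1" using n by simp
    have "\<kappa> / n \<le> 1" using n1 \<kappa> by (simp add: divide_le_eq)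
    then have \<kappa>n: "\<kappa> / n \<le> 2 * pi" using pi_gt3 by linarith
    have "c0 * \<kappa> / n = (LINT x|lborel. indicator {0..\<kappa> / n} x * c0)" using \<kappa> n by simp
    also have "\<dots> = (LINT x|circ. indicator {0..\<kappa> / n} x * c0)"
      using \<kappa>n by (subst integral_circ)
        (auto simp: set_lebesgue_integral_def indicator_def intro!: Bochner_Integration.integral_cong)
    also have "\<dots> \<le> (LINT \<theta>|circ. ?G \<theta>)"
    proof (intro integral_mono_AE integrable_kA_coefficient)
      show "integrable circ (\<lambda>x. indicator {0..\<kappa> / n} x * c0)"
        by (intro integrable_mult_left) (simp add: integrable_indicator_iff less_top[symmetric])
      show "AE \<theta> in circ. indicator {0..\<kappa> / n} \<theta> * c0 \<le> ?G \<theta>"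
        using AE_circ_interior
      proof eventually_elim
        case (elim \<theta>)
        then have "ku \<theta> > 0" by (intro ku_pos) auto
        then show ?case using G_ge[of \<theta>] G_nonneg[of \<theta>] by (simp add: indicator_def)
      qed
    qed
    finally show ?thesis by (simp add: acoef_eq)
  qed
  then show ?thesis using c0 \<kappa> by (intro exI[of _ "c0 * \<kappa>"]) auto
qed

lemma DERIV_kX: "((\<lambda>\<eta>. kX q \<theta> \<eta>) has_real_derivative q\<^sup>2 * sin \<eta> / 2) (at \<eta>)"
  unfolding kX_def ku_def by (auto intro!: derivative_eq_intros)

lemma continuous_kX: "continuous_on UNIV (\<lambda>\<eta>. kX q \<theta> \<eta>)" "continuous_on UNIV (\<lambda>\<theta>. kX q \<theta> \<eta>)"
  unfolding kX_def ku_def by (intro continuous_intros; simp)+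

text \<open>Dominated convergence in \<theta>: off the pole one integration by parts in \<eta> gives
  decay like 1/n with a constant depending on \<theta>, and the integral of \<open>kA\<close> over
  \<eta> is an integrable majorant.\<close>

lemma acoef_tendsto_0: "acoef q \<longlonglongrightarrow> 0"
proof -
  have "(\<lambda>n. LINT \<theta>|circ. LINT \<eta>|circ. kA q \<theta> \<eta> * cos (real n * \<eta>)) \<longlonglongrightarrow> (LINT \<theta>|circ. 0)"
  proof (rule integral_dominated_convergence)
    show "integrable circ (\<lambda>\<theta>. LINT \<eta>|circ. kA q \<theta> \<eta>)"
      using circ2.integrable_fst'[OF integrable_kA_0[OF q]] by simp
    show "(\<lambda>\<theta>. LINT \<eta>|circ. kA q \<theta> \<eta> * cos (real n * \<eta>)) \<in> borel_measurable circ" for n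
      using integrable_kA_coefficient by (rule borel_measurable_integrable)
    show "AE \<theta> in circ. norm (LINT \<eta>|circ. kA q \<theta> \<eta> * cos (real n * \<eta>)) \<le> (LINT \<eta>|circ. kA q \<theta> \<eta>)" for n
      using circ2.AE_integrable_fst'[OF integrable_kA_0[OF q]]
    proof eventually_elim
      case (elim \<theta>)
      have "norm (LINT \<eta>|circ. kA q \<theta> \<eta> * cos (real n * \<eta>)) \<le> (LINT \<eta>|circ. norm (kA q \<theta> \<eta> * cos (real n * \<eta>)))"
        by (rule integral_norm_bound)
      also have "\<dots> \<le> (LINT \<eta>|circ. kA q \<theta> \<eta>)"
      proof (rule integral_mono)
        show k: "integrable circ (\<lambda>\<eta>. kA q \<theta> \<eta>)" using elim by simp
        show "norm (kA q \<theta> \<eta> * cos (real n * \<eta>)) \<le> kA q \<theta> \<eta>" for \<eta> by (simp add: abs_mult mult_left_le)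
        then show "integrable circ (\<lambda>\<eta>. norm (kA q \<theta> \<eta> * cos (real n * \<eta>)))"
          by (intro Bochner_Integration.integrable_bound[OF k]) auto
      qed
      finally show ?case .
    qed
    show "AE \<theta> in circ. (\<lambda>n. LINT \<eta>|circ. kA q \<theta> \<eta> * cos (real n * \<eta>)) \<longlonglongrightarrow> 0"
      using AE_circ_interior
    proof eventually_elim
      case (elim \<theta>)
      then have u: "ku \<theta> > 0" by (intro ku_pos) auto
      let ?S = "\<lambda>\<eta>. sqrt (kX q \<theta> \<eta>)"
      note X = kX_pos[OF u]
      have S0: "kX q \<theta> \<eta> \<noteq> 0" for \<eta> using X[of \<eta>] by simp
      define D where "D \<eta> = - (1 / 2 * (q\<^sup>2 * sin \<eta> / 2) / ?S \<eta> ^ 3)" for \<eta>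
      have contD: "continuous_on UNIV D"
        unfolding D_def by (intro continuous_intros continuous_kX) (simp_all add: S0)
      have contA: "continuous_on UNIV (\<lambda>\<eta>. kA q \<theta> \<eta>)"
        unfolding kA_def by (intro continuous_intros continuous_kX) (simp_all add: S0)
      have dA: "((\<lambda>\<eta>. kA q \<theta> \<eta>) has_real_derivative D \<eta>) (at \<eta>)" for \<eta>
        using DERIV_inverse_sqrt_power[OF DERIV_kX[of \<theta> \<eta>] X, of 1] by (simp add: kA_def D_def numeral_eq_Suc)
      have bound: "\<bar>LINT \<eta>|circ. kA q \<theta> \<eta> * cos (real n * \<eta>)\<bar> \<le> (LINT \<eta>|circ. \<bar>D \<eta>\<bar>) / n" if n: "n > 0" for n
      proof -
        have i1: "integrable circ (\<lambda>\<eta>. kA q \<theta> \<eta> * cos (real n * \<eta>))"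
          by (intro integrable_circ_continuous continuous_intros contA)
        have i2: "integrable circ (\<lambda>\<eta>. D \<eta> * (sin (real n * \<eta>) / n))"
          using n by (intro integrable_circ_continuous continuous_intros contD) auto
        have "(LINT \<eta>|circ. kA q \<theta> \<eta> * cos (real n * \<eta>) + D \<eta> * (sin (real n * \<eta>) / n))
            = kA q \<theta> (2*pi) * (sin (real n * (2*pi)) / n) - kA q \<theta> 0 * (sin (real n * 0) / n)"
        proof (rule integral_circ_FTC)
          show "((\<lambda>\<eta>. kA q \<theta> \<eta> * (sin (real n * \<eta>) / n)) has_real_derivative
              kA q \<theta> \<eta> * cos (real n * \<eta>) + D \<eta> * (sin (real n * \<eta>) / n)) (at \<eta>)" for \<eta>
            using n by (auto intro!: derivative_eq_intros dA simp: field_simps)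
          show "continuous_on UNIV (\<lambda>\<eta>. kA q \<theta> \<eta> * cos (real n * \<eta>) + D \<eta> * (sin (real n * \<eta>) / n))"
            using n by (intro continuous_intros contA contD) auto
        qed
        then have "(LINT \<eta>|circ. kA q \<theta> \<eta> * cos (real n * \<eta>)) = - (LINT \<eta>|circ. D \<eta> * (sin (real n * \<eta>) / n))"
          using i1 i2 sin_multiple_periodic(1)[of n 0] by simp
        then have "\<bar>LINT \<eta>|circ. kA q \<theta> \<eta> * cos (real n * \<eta>)\<bar> = \<bar>LINT \<eta>|circ. D \<eta> * (sin (real n * \<eta>) / n)\<bar>"
          by simp
        also have "\<dots> \<le> (LINT \<eta>|circ. \<bar>D \<eta> * (sin (real n * \<eta>) / n)\<bar>)" by (rule integral_abs_bound)
        also have "\<dots> \<le> (LINT \<eta>|circ. \<bar>D \<eta>\<bar> / n)"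
        proof (rule integral_mono)
          show "integrable circ (\<lambda>\<eta>. \<bar>D \<eta>\<bar> / n)"
            using n by (intro integrable_circ_continuous continuous_intros contD) auto
          show "\<bar>D \<eta> * (sin (real n * \<eta>) / n)\<bar> \<le> \<bar>D \<eta>\<bar> / n" for \<eta>
            by (simp add: abs_mult divide_right_mono mult_left_le)
        qed (rule integrable_abs[OF i2])
        finally show ?thesis by simp
      qed
      have "(\<lambda>n. (LINT \<eta>|circ. \<bar>D \<eta>\<bar>) / real n) \<longlonglongrightarrow> 0"
        by (intro tendsto_divide_0[OF tendsto_const] filterlim_at_top_imp_at_infinity filterlim_real_sequentially)
      then show ?case
        by (rule Lim_null_comparison[rotated]) (use bound in \<open>auto intro!: eventually_sequentiallyI[of 1]\<close>)
    qed
  qed simp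
  then show ?thesis by (simp add: acoef_eq[abs_def])
qed

end

section \<open>The difference a_n - b_n\<close>

text \<open>To leading order at the origin \<open>kF\<close> is homogeneous of degree 1 in the
  distance, while \<open>kA\<close> and \<open>kB\<close> have degree -1. This gain of two degrees
  is what two integrations by parts convert into the factor \<open>1 / n\<^sup>2\<close>.\<close>

definition kF :: "real \<Rightarrow> real \<Rightarrow> real \<Rightarrow> real" where
  "kF q \<theta> \<eta> = 2 * ku \<theta> / sqrt (kX q \<theta> \<eta>) - (ku \<theta>)\<^sup>2 / sqrt (kX q \<theta> \<eta>) ^ 3"

lemma kF_measurable [measurable]: "(\<lambda>x. kF q (f x) (g x)) \<in> borel_measurable M"
  if [measurable]: "f \<in> borel_measurable M" "g \<in> borel_measurable M"
  unfolding kF_def by measurable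

context
  fixes q :: real
  assumes q: "q > 0"
begin

lemma abs_kF_le: "\<bar>kF q \<theta> \<eta>\<bar> \<le> 3 * sqrt (1 + q\<^sup>2)"
proof (cases "kX q \<theta> \<eta> = 0")
  case False
  define S where "S = sqrt (kX q \<theta> \<eta>)"
  have S: "S > 0" using False kX_nonneg[of q \<theta> \<eta>] by (simp add: S_def less_le del: kX_nonneg)
  have u: "ku \<theta> \<le> S\<^sup>2" using ku_le_kX[of \<theta> q \<eta>] by (simp add: S_def)
  have "kX q \<theta> \<eta> \<le> 1 + q\<^sup>2 * 1" unfolding kX_def by (intro add_mono mult_left_mono ku_le_1) auto
  then have S2: "S \<le> sqrt (1 + q\<^sup>2)" by (simp add: S_def)
  have "2 * ku \<theta> / S \<le> 2 * S\<^sup>2 / S" using u S by (intro divide_right_mono) auto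
  moreover have "(ku \<theta>)\<^sup>2 / S ^ 3 \<le> (S\<^sup>2)\<^sup>2 / S ^ 3" using u S by (intro divide_right_mono power_mono) auto
  moreover have "2 * S\<^sup>2 / S = 2 * S" "(S\<^sup>2)\<^sup>2 / S ^ 3 = S" using S by (simp_all add: power2_eq_square power3_eq_cube)
  moreover have "0 \<le> 2 * ku \<theta> / S" "0 \<le> (ku \<theta>)\<^sup>2 / S ^ 3" using S by simp_all
  ultimately have "\<bar>2 * ku \<theta> / S - (ku \<theta>)\<^sup>2 / S ^ 3\<bar> \<le> 3 * S" by linarith
  then show ?thesis using S2 unfolding kF_def S_def[symmetric] by linarith
qed (simp add: kF_def)

lemma integrable_kF: "integrable (circ \<Otimes>\<^sub>M circ) (\<lambda>(\<theta>, \<eta>). kF q \<theta> \<eta>)"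
proof (rule Bochner_Integration.integrable_bound)
  show "integrable (circ \<Otimes>\<^sub>M circ) (\<lambda>(x, y). 3 * sqrt (1 + q\<^sup>2) * 1)"
    by (rule integrable_circ2_product) auto
  show "AE x in circ \<Otimes>\<^sub>M circ. norm (case x of (\<theta>, \<eta>) \<Rightarrow> kF q \<theta> \<eta>) \<le> norm (case x of (x, y) \<Rightarrow> 3 * sqrt (1 + q\<^sup>2) * 1)"
    using abs_kF_le by (auto intro!: AE_I2 order_trans[OF _ abs_ge_self])
qed measurable

lemma DERIV_kX_fst: "((\<lambda>\<theta>. kX q \<theta> \<eta>) has_real_derivative sin \<theta> / 2) (at \<theta>)"
  unfolding kX_def ku_def by (auto intro!: derivative_eq_intros)

text \<open>Integration by parts in \<open>\<theta>\<close>: the difference of the integrands is twice the derivative of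
  \<open>sin \<theta> / (2 sqrt (kX q \<theta> \<eta>))\<close>. It trades the singular kernels for the bounded one.\<close>

lemma kA_minus_kB_integral:
  assumes w: "ku \<eta> > 0"
  shows "(LINT \<theta>|circ. kA q \<theta> \<eta>) - (LINT \<theta>|circ. kB q \<theta> \<eta>) = (LINT \<theta>|circ. kF q \<theta> \<eta>)"
proof -
  note X = kX_pos'[OF q w]
  have X0: "kX q \<theta> \<eta> \<noteq> 0" for \<theta> using X[of \<theta>] by simp
  note cont = continuous_kX(2)[OF q, of \<eta>]
  have ku: "continuous_on UNIV ku" unfolding ku_def by (intro continuous_intros) simp
  have iA: "integrable circ (\<lambda>\<theta>. kA q \<theta> \<eta>)" and iB: "integrable circ (\<lambda>\<theta>. kB q \<theta> \<eta>)"
    and iF: "integrable circ (\<lambda>\<theta>. kF q \<theta> \<eta>)"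
    unfolding kA_def kB_def kF_def
    by (safe intro!: integrable_circ_continuous continuous_intros cont ku) (simp_all add: X0)
  let ?H = "\<lambda>\<theta>. sin \<theta> / 2 * (1 / sqrt (kX q \<theta> \<eta>) ^ 1)"
  let ?h = "\<lambda>\<theta>. (kA q \<theta> \<eta> - kB q \<theta> \<eta> - kF q \<theta> \<eta>) / 2"
  have "(LINT \<theta>|circ. ?h \<theta>) = ?H (2 * pi) - ?H 0"
  proof (rule integral_circ_FTC)
    show "(?H has_real_derivative ?h \<theta>) (at \<theta>)" for \<theta>
    proof -
      define S where "S = sqrt (kX q \<theta> \<eta>)"
      have S: "S > 0" using X[of \<theta>] by (simp add: S_def)
      have d: "(?H has_real_derivative cos \<theta> / 2 * (1 / S ^ 1) + - (real 1 / 2 * (sin \<theta> / 2) / S ^ (1 + 2)) * (sin \<theta> / 2)) (at \<theta>)"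
        unfolding S_def
        by (intro DERIV_mult DERIV_inverse_sqrt_power DERIV_kX_fst X) (auto intro!: derivative_eq_intros)
      have e: "cos \<theta> / 2 * (1 / S ^ 1) + - (real 1 / 2 * (sin \<theta> / 2) / S ^ (1 + 2)) * (sin \<theta> / 2) = ?h \<theta>"
      proof -
        have c: "cos \<theta> = 1 - 2 * ku \<theta>" by (simp add: ku_def field_simps)
        have "(sin \<theta>)\<^sup>2 = 1 - (cos \<theta>)\<^sup>2" by (simp add: sin_squared_eq)
        then have s: "sin \<theta> * sin \<theta> = 4 * (ku \<theta> * (1 - ku \<theta>))"
          unfolding c by (simp add: power2_eq_square algebra_simps)
        have "cos \<theta> / 2 * (1 / S ^ 1) + - (real 1 / 2 * (sin \<theta> / 2) / S ^ (1 + 2)) * (sin \<theta> / 2)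
            = cos \<theta> / 2 / S - sin \<theta> * sin \<theta> / 8 / S ^ 3" by (simp add: numeral_eq_Suc)
        also have "\<dots> = (1 / S - ku \<theta> / S ^ 3 - (2 * ku \<theta> / S - (ku \<theta>)\<^sup>2 / S ^ 3)) / 2"
          unfolding s c using S by (simp add: field_simps power2_eq_square)
        finally show ?thesis by (simp add: kA_def kB_def kF_def S_def)
      qed
      from d show ?thesis unfolding e .
    qed
    show "continuous_on UNIV ?h"
      unfolding kA_def kB_def kF_def by (intro continuous_intros cont ku; simp add: X0)
  qed
  then have "(LINT \<theta>|circ. ?h \<theta>) = 0" by simp
  then show ?thesis using iA iB iF by simp
qed

lemma acoef_minus_bcoef: "acoef q n - bcoef q n = (LINT \<theta>|circ. LINT \<eta>|circ. kF q \<theta> \<eta> * cos (real n * \<eta>))"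
proof -
  have iA: "integrable circ (\<lambda>\<eta>. (LINT \<theta>|circ. kA q \<theta> \<eta>) * cos (real n * \<eta>))"
    and iB: "integrable circ (\<lambda>\<eta>. (LINT \<theta>|circ. kB q \<theta> \<eta>) * cos (real n * \<eta>))"
    using circ2.integrable_snd[OF fourier_coefficient_Fubini(1)[OF integrable_kA_0[OF q], of n]]
      circ2.integrable_snd[OF fourier_coefficient_Fubini(1)[OF integrable_kB_0[OF q], of n]] by simp_all
  have "acoef q n - bcoef q n
      = (LINT \<eta>|circ. (LINT \<theta>|circ. kA q \<theta> \<eta>) * cos (real n * \<eta>) - (LINT \<theta>|circ. kB q \<theta> \<eta>) * cos (real n * \<eta>))"
    unfolding acoef_def bcoef_def using iA iB by simp
  also have "\<dots> = (LINT \<eta>|circ. (LINT \<theta>|circ. kF q \<theta> \<eta>) * cos (real n * \<eta>))"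
  proof (rule integral_cong_AE)
    show "AE \<eta> in circ. (LINT \<theta>|circ. kA q \<theta> \<eta>) * cos (real n * \<eta>) - (LINT \<theta>|circ. kB q \<theta> \<eta>) * cos (real n * \<eta>)
        = (LINT \<theta>|circ. kF q \<theta> \<eta>) * cos (real n * \<eta>)"
      using AE_circ_interior
    proof eventually_elim
      case (elim \<eta>)
      then have "ku \<eta> > 0" by (intro ku_pos) auto
      from kA_minus_kB_integral[OF this] show ?case by (simp add: left_diff_distrib[symmetric])
    qed
    have "integrable circ (\<lambda>\<eta>. (LINT \<theta>|circ. kF q \<theta> \<eta>) * cos (real n * \<eta>))"
      using circ2.integrable_snd[OF fourier_coefficient_Fubini(1)[OF integrable_kF, of n]] by simp
    then show "(\<lambda>\<eta>. (LINT \<theta>|circ. kF q \<theta> \<eta>) * cos (real n * \<eta>)) \<in> borel_measurable circ"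
      by (rule borel_measurable_integrable)
  qed (use iA iB in auto)
  also have "\<dots> = (LINT \<theta>|circ. LINT \<eta>|circ. kF q \<theta> \<eta> * cos (real n * \<eta>))"
    by (rule fourier_coefficient_Fubini(2)[OF integrable_kF])
  finally show ?thesis .
qed

text \<open>Two integrations by parts in \<eta>. The boundary terms vanish because sin (n \<eta>)
  and the factor sin \<eta> of \<open>F1\<close> are 0 at both ends, and the second derivative
  \<open>F2\<close> is no more singular than \<open>kA\<close>, hence integrable over both
  angles.\<close>

lemma kF_coefficient_bound:
  assumes u: "ku \<theta> > 0" and n: "n > 0"
  shows "\<bar>LINT \<eta>|circ. kF q \<theta> \<eta> * cos (real n * \<eta>)\<bar> \<le> 13 / 2 * q\<^sup>2 / (real n)\<^sup>2 * (LINT \<eta>|circ. kA q \<theta> \<eta>)"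
proof -
  define u where "u = ku \<theta>"
  have u0: "u > 0" using assms by (simp add: u_def)
  note X = kX_pos[OF q assms(1)]
  have X0: "kX q \<theta> \<eta> \<noteq> 0" for \<eta> using X[of \<eta>] by simp
  define P where "P k \<eta> = 1 / sqrt (kX q \<theta> \<eta>) ^ k" for k \<eta>
  have P_DERIV: "(P k has_real_derivative - (real k / 2 * (q\<^sup>2 * sin \<eta> / 2) * P (k + 2) \<eta>)) (at \<eta>)" for k \<eta>
    using DERIV_inverse_sqrt_power[OF DERIV_kX[OF q, of \<theta> \<eta>] X, of k] unfolding P_def by simp
  have P1: "(P 1 has_real_derivative - (1 / 2 * (q\<^sup>2 * sin \<eta> / 2) * P 3 \<eta>)) (at \<eta>)"
    and P3: "(P 3 has_real_derivative - (3 / 2 * (q\<^sup>2 * sin \<eta> / 2) * P 5 \<eta>)) (at \<eta>)"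
    and P5: "(P 5 has_real_derivative - (5 / 2 * (q\<^sup>2 * sin \<eta> / 2) * P 7 \<eta>)) (at \<eta>)" for \<eta>
  proof -
    have "P (1 + 2) = P 3" by (simp add: numeral_3_eq_3)
    then show "(P 1 has_real_derivative - (1 / 2 * (q\<^sup>2 * sin \<eta> / 2) * P 3 \<eta>)) (at \<eta>)"
      using P_DERIV[of 1 \<eta>] by (simp only: of_nat_1)
  qed (use P_DERIV[of 3 \<eta>] P_DERIV[of 5 \<eta>] in simp_all)
  have P_cont: "continuous_on UNIV (P k)" for k
    unfolding P_def by (intro continuous_intros continuous_kX[OF q]) (simp add: X0)
  have kF: "kF q \<theta> \<eta> = 2 * u * P 1 \<eta> - u\<^sup>2 * P 3 \<eta>" for \<eta>
    by (simp add: kF_def P_def u_def)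
  have kA: "kA q \<theta> \<eta> = P 1 \<eta>" for \<eta> by (simp add: kA_def P_def)
  define F1 where "F1 \<eta> = q\<^sup>2 * sin \<eta> / 2 * (3 / 2 * u\<^sup>2 * P 5 \<eta> - u * P 3 \<eta>)" for \<eta>
  define F2 where "F2 \<eta> = q\<^sup>2 * cos \<eta> / 2 * (3 / 2 * u\<^sup>2 * P 5 \<eta> - u * P 3 \<eta>)
      + (q\<^sup>2 * sin \<eta> / 2)\<^sup>2 * (3 / 2 * u * P 5 \<eta> - 15 / 4 * u\<^sup>2 * P 7 \<eta>)" for \<eta>
  have dF: "((\<lambda>\<eta>. kF q \<theta> \<eta>) has_real_derivative F1 \<eta>) (at \<eta>)" for \<eta>
    unfolding kF F1_def
    by (rule derivative_eq_intros P1 P3 P5 refl)+ (simp add: field_simps)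
  have dF1: "(F1 has_real_derivative F2 \<eta>) (at \<eta>)" for \<eta>
  proof -
    have g1: "((\<lambda>\<eta>. q\<^sup>2 * sin \<eta> / 2) has_real_derivative q\<^sup>2 * cos \<eta> / 2) (at \<eta>)"
      by (auto intro!: derivative_eq_intros)
    have g2: "((\<lambda>\<eta>. 3 / 2 * u\<^sup>2 * P 5 \<eta> - u * P 3 \<eta>) has_real_derivative
        3 / 2 * u\<^sup>2 * (- (5 / 2 * (q\<^sup>2 * sin \<eta> / 2) * P 7 \<eta>)) - u * (- (3 / 2 * (q\<^sup>2 * sin \<eta> / 2) * P 5 \<eta>))) (at \<eta>)"
      by (intro DERIV_diff DERIV_cmult P3 P5)
    show ?thesis
      unfolding F1_def F2_def
      by (rule DERIV_cong[OF DERIV_mult[OF g1 g2]]) (simp add: power2_eq_square algebra_simps)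
  qed
  have cF2: "continuous_on UNIV F2" unfolding F2_def
    by (intro continuous_intros P_cont[of 5] P_cont[of 3] P_cont[of 7]) auto
  have cF: "continuous_on UNIV (\<lambda>\<eta>. kF q \<theta> \<eta>)" unfolding kF
    by (intro continuous_intros P_cont[of 1] P_cont[of 3])
  \<comment> \<open>The inequality \<open>u \<le> S\<^sup>2\<close> trades each factor
    \<open>u\<close> for two powers of \<open>S\<close>, and the squared sine supplies another
    \<open>S\<^sup>2\<close>. The constant is \<open>1/2 * 5/2 + 21/4\<close>, with
    \<open>5/2 = 3/2 + 1\<close> and \<open>21/4 = 3/2 + 15/4\<close>.\<close>
  have F2_le: "\<bar>F2 \<eta>\<bar> \<le> 13 / 2 * q\<^sup>2 * kA q \<theta> \<eta>" for \<eta>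
  proof -
    define S where "S = sqrt (kX q \<theta> \<eta>)"
    have S: "S > 0" using X[of \<eta>] by (simp add: S_def)
    have P: "P k \<eta> = 1 / S ^ k" for k by (simp add: P_def S_def)
    have S2: "S\<^sup>2 = kX q \<theta> \<eta>" by (simp add: S_def)
    have uS: "u \<le> S\<^sup>2" using ku_le_kX[of \<theta> q \<eta>] by (simp add: S2 u_def)
    have pw: "u ^ i * P (2 * i + j) \<eta> \<le> P j \<eta>" for i j
    proof -
      have "u ^ i \<le> (S\<^sup>2) ^ i" using uS u0 by (intro power_mono) auto
      then have "u ^ i * (1 / S ^ (2 * i + j)) \<le> (S\<^sup>2) ^ i * (1 / S ^ (2 * i + j))"
        using S by (intro mult_right_mono) auto
      also have "\<dots> = 1 / S ^ j" using S by (simp add: power_add power_mult)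
      finally show ?thesis by (simp add: P)
    qed
    have Pn: "0 \<le> P k \<eta>" for k using S by (simp add: P)
    have a: "u * P 3 \<eta> \<le> P 1 \<eta>" "u\<^sup>2 * P 5 \<eta> \<le> P 1 \<eta>" "u * P 5 \<eta> \<le> P 3 \<eta>" "u\<^sup>2 * P 7 \<eta> \<le> P 3 \<eta>"
      using pw[of 1 1] pw[of 2 1] pw[of 1 3] pw[of 2 3] by (simp_all add: numeral_eq_Suc)
    have b: "0 \<le> u * P 3 \<eta>" "0 \<le> u\<^sup>2 * P 5 \<eta>" "0 \<le> u * P 5 \<eta>" "0 \<le> u\<^sup>2 * P 7 \<eta>"
      using Pn u0 by simp_all
    have 1: "\<bar>3 / 2 * u\<^sup>2 * P 5 \<eta> - u * P 3 \<eta>\<bar> \<le> 5 / 2 * P 1 \<eta>" using a b by linarith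
    have 2: "\<bar>3 / 2 * u * P 5 \<eta> - 15 / 4 * u\<^sup>2 * P 7 \<eta>\<bar> \<le> 21 / 4 * P 3 \<eta>" using a b by linarith
    have 3: "\<bar>q\<^sup>2 * cos \<eta> / 2\<bar> \<le> q\<^sup>2 / 2" using abs_cos_le_one[of \<eta>] by (simp add: abs_mult mult_left_le)
    have 4: "(q\<^sup>2 * sin \<eta> / 2)\<^sup>2 \<le> q\<^sup>2 * S\<^sup>2"
    proof -
      have "(sin \<eta>)\<^sup>2 = 1 - (cos \<eta>)\<^sup>2" by (simp add: sin_squared_eq)
      also have "\<dots> = 4 * (ku \<eta> * (1 - ku \<eta>))" by (simp add: ku_def power2_eq_square field_simps)
      also have "\<dots> \<le> 4 * (ku \<eta> * 1)" by (intro mult_left_mono) auto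
      finally have "(sin \<eta>)\<^sup>2 / 4 \<le> ku \<eta>" by simp
      then have "q\<^sup>2 * (q\<^sup>2 * ((sin \<eta>)\<^sup>2 / 4)) \<le> q\<^sup>2 * (q\<^sup>2 * ku \<eta>)" by (intro mult_left_mono) auto
      also have "\<dots> \<le> q\<^sup>2 * S\<^sup>2" unfolding S2 kX_def by (intro mult_left_mono) auto
      finally show ?thesis by (simp add: power2_eq_square mult_ac)
    qed
    have "\<bar>F2 \<eta>\<bar> \<le> \<bar>q\<^sup>2 * cos \<eta> / 2\<bar> * \<bar>3 / 2 * u\<^sup>2 * P 5 \<eta> - u * P 3 \<eta>\<bar>
        + (q\<^sup>2 * sin \<eta> / 2)\<^sup>2 * \<bar>3 / 2 * u * P 5 \<eta> - 15 / 4 * u\<^sup>2 * P 7 \<eta>\<bar>"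
      unfolding F2_def by (rule order_trans[OF abs_triangle_ineq]) (simp add: abs_mult)
    also have "\<dots> \<le> q\<^sup>2 / 2 * (5 / 2 * P 1 \<eta>) + q\<^sup>2 * S\<^sup>2 * (21 / 4 * P 3 \<eta>)"
      using 1 2 3 4 by (intro add_mono mult_mono) auto
    also have "q\<^sup>2 * S\<^sup>2 * (21 / 4 * P 3 \<eta>) = 21 / 4 * q\<^sup>2 * P 1 \<eta>"
      using S by (simp add: P power2_eq_square power3_eq_cube)
    also have "q\<^sup>2 / 2 * (5 / 2 * P 1 \<eta>) + 21 / 4 * q\<^sup>2 * P 1 \<eta> = 13 / 2 * q\<^sup>2 * P 1 \<eta>" by simp
    finally show ?thesis by (simp add: kA)
  qed
  let ?N = "real n"
  have i1: "integrable circ (\<lambda>\<eta>. kF q \<theta> \<eta> * cos (?N * \<eta>))"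
    by (intro integrable_circ_continuous continuous_intros cF)
  have i2: "integrable circ (\<lambda>\<eta>. F2 \<eta> * cos (?N * \<eta>) / ?N\<^sup>2)"
    using n by (intro integrable_circ_continuous continuous_intros cF2) auto
  have "(LINT \<eta>|circ. kF q \<theta> \<eta> * cos (?N * \<eta>) + F2 \<eta> * cos (?N * \<eta>) / ?N\<^sup>2)
      = (kF q \<theta> (2*pi) * sin (?N * (2*pi)) / ?N + F1 (2*pi) * cos (?N * (2*pi)) / ?N\<^sup>2)
        - (kF q \<theta> 0 * sin (?N * 0) / ?N + F1 0 * cos (?N * 0) / ?N\<^sup>2)"
  proof (rule integral_circ_FTC)
    show "((\<lambda>\<eta>. kF q \<theta> \<eta> * sin (?N * \<eta>) / ?N + F1 \<eta> * cos (?N * \<eta>) / ?N\<^sup>2) has_real_derivative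
        kF q \<theta> \<eta> * cos (?N * \<eta>) + F2 \<eta> * cos (?N * \<eta>) / ?N\<^sup>2) (at \<eta>)" for \<eta>
      using n by (auto intro!: derivative_eq_intros dF dF1 simp: field_simps power2_eq_square)
    show "continuous_on UNIV (\<lambda>\<eta>. kF q \<theta> \<eta> * cos (?N * \<eta>) + F2 \<eta> * cos (?N * \<eta>) / ?N\<^sup>2)"
      using n by (intro continuous_intros cF cF2) auto
  qed
  also have "\<dots> = 0" using sin_multiple_periodic(1)[of n 0] by (simp add: F1_def)
  finally have "\<bar>LINT \<eta>|circ. kF q \<theta> \<eta> * cos (?N * \<eta>)\<bar> = \<bar>LINT \<eta>|circ. F2 \<eta> * cos (?N * \<eta>) / ?N\<^sup>2\<bar>"
    unfolding Bochner_Integration.integral_add[OF i1 i2] by linarith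
  also have "\<dots> \<le> (LINT \<eta>|circ. \<bar>F2 \<eta> * cos (?N * \<eta>) / ?N\<^sup>2\<bar>)" by (rule integral_abs_bound)
  also have "\<dots> \<le> (LINT \<eta>|circ. 13 / 2 * q\<^sup>2 / ?N\<^sup>2 * kA q \<theta> \<eta>)"
  proof (rule integral_mono)
    show "integrable circ (\<lambda>\<eta>. \<bar>F2 \<eta> * cos (?N * \<eta>) / ?N\<^sup>2\<bar>)" by (rule integrable_abs[OF i2])
    show "integrable circ (\<lambda>\<eta>. 13 / 2 * q\<^sup>2 / ?N\<^sup>2 * kA q \<theta> \<eta>)"
      unfolding kA by (intro integrable_mult_right integrable_circ_continuous P_cont)
    fix \<eta>
    have "\<bar>F2 \<eta> * cos (?N * \<eta>)\<bar> \<le> \<bar>F2 \<eta>\<bar> * 1" unfolding abs_mult by (intro mult_left_mono) auto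
    also have "\<dots> \<le> 13 / 2 * q\<^sup>2 * kA q \<theta> \<eta>" using F2_le by simp
    finally have "\<bar>F2 \<eta> * cos (?N * \<eta>)\<bar> / ?N\<^sup>2 \<le> 13 / 2 * q\<^sup>2 * kA q \<theta> \<eta> / ?N\<^sup>2" by (rule divide_right_mono) simp
    then show "\<bar>F2 \<eta> * cos (?N * \<eta>) / ?N\<^sup>2\<bar> \<le> 13 / 2 * q\<^sup>2 / ?N\<^sup>2 * kA q \<theta> \<eta>" by simp
  qed
  also have "\<dots> = 13 / 2 * q\<^sup>2 / ?N\<^sup>2 * (LINT \<eta>|circ. kA q \<theta> \<eta>)" by (rule integral_mult_right_zero)
  finally show ?thesis .
qed

lemma acoef_minus_bcoef_bound: "\<exists>K. \<forall>n>0. \<bar>acoef q n - bcoef q n\<bar> \<le> K / (real n)\<^sup>2"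
proof (intro exI allI impI)
  fix n :: nat assume n: "n > 0"
  have "\<bar>acoef q n - bcoef q n\<bar> \<le> (LINT \<theta>|circ. \<bar>LINT \<eta>|circ. kF q \<theta> \<eta> * cos (real n * \<eta>)\<bar>)"
    unfolding acoef_minus_bcoef by (rule integral_abs_bound)
  also have "\<dots> \<le> (LINT \<theta>|circ. 13 / 2 * q\<^sup>2 / (real n)\<^sup>2 * (LINT \<eta>|circ. kA q \<theta> \<eta>))"
  proof (rule integral_mono_AE)
    show "integrable circ (\<lambda>\<theta>. \<bar>LINT \<eta>|circ. kF q \<theta> \<eta> * cos (real n * \<eta>)\<bar>)"
      using circ2.integrable_fst'[OF fourier_coefficient_Fubini(1)[OF integrable_kF, of n]] by simp
    have "integrable circ (\<lambda>\<theta>. LINT \<eta>|circ. kA q \<theta> \<eta>)"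
      using circ2.integrable_fst'[OF integrable_kA_0[OF q]] by simp
    then show "integrable circ (\<lambda>\<theta>. 13 / 2 * q\<^sup>2 / (real n)\<^sup>2 * (LINT \<eta>|circ. kA q \<theta> \<eta>))"
      by (rule integrable_mult_right)
    show "AE \<theta> in circ. \<bar>LINT \<eta>|circ. kF q \<theta> \<eta> * cos (real n * \<eta>)\<bar>
        \<le> 13 / 2 * q\<^sup>2 / (real n)\<^sup>2 * (LINT \<eta>|circ. kA q \<theta> \<eta>)"
      using AE_circ_interior
      by eventually_elim (intro kF_coefficient_bound ku_pos n; simp)
  qed
  also have "\<dots> = 13 / 2 * q\<^sup>2 / (real n)\<^sup>2 * (LINT \<theta>|circ. LINT \<eta>|circ. kA q \<theta> \<eta>)"
    by (rule integral_mult_right_zero)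
  finally show "\<bar>acoef q n - bcoef q n\<bar> \<le> 13 / 2 * q\<^sup>2 * (LINT \<theta>|circ. LINT \<eta>|circ. kA q \<theta> \<eta>) / (real n)\<^sup>2"
    by simp
qed

lemma acoef_pos: "n > 0 \<Longrightarrow> acoef q n > 0"
  using acoef_lower_bound[OF q] by (metis divide_pos_pos less_le_trans of_nat_0_less_iff)

text \<open>The difference of the coefficients is of order \<open>1 / n\<^sup>2\<close> and
  \<open>acoef\<close> is at least \<open>c / n\<close>, so the quotient differs from 1 by order
  1/n.\<close>

lemma bcoef_acoef_ratio: "(\<lambda>n. bcoef q (Suc n) / acoef q (Suc n)) \<longlonglongrightarrow> 1"
proof -
  obtain c where c: "c > 0" "\<And>n. n > 0 \<Longrightarrow> c / real n \<le> acoef q n" using acoef_lower_bound[OF q] by blast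
  obtain K where K: "\<And>n. n > 0 \<Longrightarrow> \<bar>acoef q n - bcoef q n\<bar> \<le> K / (real n)\<^sup>2"
    using acoef_minus_bcoef_bound by blast
  have bound: "norm (bcoef q (Suc n) / acoef q (Suc n) - 1) \<le> K / c * (1 / real (Suc n))" for n
  proof -
    let ?n = "Suc n" and ?a = "acoef q (Suc n)" and ?b = "bcoef q (Suc n)"
    have a: "?a > 0" by (rule acoef_pos) simp
    have "\<bar>?b / ?a - 1\<bar> = \<bar>?a - ?b\<bar> / ?a"
    proof -
      have "?b / ?a - 1 = - ((?a - ?b) / ?a)" using a by (simp add: diff_divide_distrib)
      then show ?thesis using a by simp
    qed
    also have "\<dots> \<le> (K / (real ?n)\<^sup>2) / (c / real ?n)"
      using K[of ?n] c(2)[of ?n] c(1) by (intro frac_le) auto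
    also have "\<dots> = K / c * (1 / real ?n)"
      using c(1) by (simp add: power2_eq_square)
    finally show ?thesis by simp
  qed
  have "(\<lambda>n. K / c * (1 / real (Suc n))) \<longlonglongrightarrow> K / c * 0"
    by (intro tendsto_intros LIMSEQ_Suc[OF lim_1_over_n])
  then have "(\<lambda>n. K / c * (1 / real (Suc n))) \<longlonglongrightarrow> 0" by (simp only: mult_zero_right)
  from Lim_null_comparison[OF always_eventually[OF allI[OF bound]] this]
  show ?thesis by (rule LIM_zero_cancel)
qed

end

section \<open>The conformal angle on the torus\<close>

locale ring_torus =
  fixes r0 a :: real
  assumes a_pos: "0 < a" and a_less: "a < r0"
begin

text \<open>Radius of the focal circle of the toroidal coordinates in which the torus is a
  coordinate surface. If t0 is the parameter of that surface, \<open>qq\<close> is 1 / sinh t0 and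
  \<open>tt\<close> is exp (- t0); the conformal angle \<eta> is the toroidal angle.\<close>

definition R0 :: real where "R0 = sqrt (r0\<^sup>2 - a\<^sup>2)"

definition qq :: real where "qq = a / R0"

definition tt :: real where "tt = (r0 - R0) / a"

definition rho :: "real \<Rightarrow> real" where "rho \<phi> = r0 + a * cos \<phi>"

definition den :: "real \<Rightarrow> real" where "den \<eta> = r0 - a * cos \<eta>"

text \<open>The argument of the disc automorphism \<open>(z - tt) / (1 - tt * z)\<close> at
  \<open>z = cis \<eta>\<close>, written with \<open>arctan\<close> so that it is a single smooth
  function on the line fixing 0 and \<open>2 * pi\<close>.\<close>

definition tor_angle :: "real \<Rightarrow> real" where
  "tor_angle \<eta> = \<eta> + 2 * arctan (tt * sin \<eta> / (1 - tt * cos \<eta>))"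

lemma sq_less: "a\<^sup>2 < r0\<^sup>2"
  using a_pos a_less by (intro power_strict_mono) auto

lemma R0_pos: "R0 > 0" and R0_sq: "R0\<^sup>2 = r0\<^sup>2 - a\<^sup>2"
  using sq_less by (simp_all add: R0_def)

lemma qq_pos: "qq > 0"
  using a_pos R0_pos by (simp add: qq_def)

lemma rho_ge: "r0 - a \<le> rho \<phi>" and rho_le: "rho \<phi> \<le> r0 + a"
proof -
  have "a * (-1) \<le> a * cos \<phi>" "a * cos \<phi> \<le> a * 1" using a_pos by (intro mult_left_mono; simp)+
  then show "r0 - a \<le> rho \<phi>" "rho \<phi> \<le> r0 + a" by (simp_all add: rho_def)
qed

lemma rho_pos: "rho \<phi> > 0" using rho_ge[of \<phi>] a_less by linarith

lemma den_pos: "den \<eta> > 0"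
proof -
  have "a * cos \<eta> \<le> a * 1" using a_pos by (intro mult_left_mono) auto
  then show ?thesis using a_less by (simp add: den_def)
qed

text \<open>\<open>tt\<close> is the smaller root of \<open>a * t\<^sup>2 - 2 * r0 * t + a\<close>;
  the last two facts turn the combinations \<open>1 + tt\<^sup>2\<close> and
  \<open>1 - tt\<^sup>2\<close> of the automorphism into \<open>r0\<close> and
  \<open>R0\<close>.\<close>

lemma tt: "0 < tt" "tt < 1" "1 + tt\<^sup>2 = 2 * tt / a * r0" "1 - tt\<^sup>2 = 2 * tt / a * R0"
proof -
  have "R0 < r0"
    using a_pos a_less R0_sq by (intro power_less_imp_less_base[of R0 2 r0]) auto
  then show t: "0 < tt" using a_pos by (simp add: tt_def)
  have "(r0 - a)\<^sup>2 < R0\<^sup>2"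
    unfolding R0_sq using mult_strict_left_mono[OF a_less a_pos] by (simp add: power2_eq_square algebra_simps)
  then have "r0 - a < R0" using R0_pos by (intro power_less_imp_less_base[of "r0 - a" 2 R0]) auto
  then show "tt < 1" using a_pos by (simp add: tt_def)
  have at: "a * tt = r0 - R0" using a_pos by (simp add: tt_def)
  have "a\<^sup>2 * (1 + tt\<^sup>2) = a\<^sup>2 + (a * tt)\<^sup>2" by (simp add: power_mult_distrib algebra_simps)
  also have "\<dots> = a\<^sup>2 + r0\<^sup>2 - 2 * r0 * R0 + R0\<^sup>2" unfolding at by (simp add: power2_diff)
  also have "\<dots> = 2 * (a * tt) * r0" unfolding R0_sq at by (simp add: power2_eq_square algebra_simps)
  finally have "a * (a * (1 + tt\<^sup>2)) = a * (2 * tt * r0)" by (simp add: power2_eq_square mult_ac)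
  then have "a * (1 + tt\<^sup>2) = 2 * tt * r0" using a_pos by (metis mult_cancel_left less_irrefl)
  then show "1 + tt\<^sup>2 = 2 * tt / a * r0" using a_pos by (simp add: field_simps)
  have "a\<^sup>2 * (1 - tt\<^sup>2) = a\<^sup>2 - (a * tt)\<^sup>2" by (simp add: power_mult_distrib algebra_simps)
  also have "\<dots> = a\<^sup>2 - r0\<^sup>2 + 2 * r0 * R0 - R0\<^sup>2" unfolding at by (simp add: power2_diff)
  also have "\<dots> = 2 * (a * tt) * R0"
    using R0_sq unfolding at by (simp add: power2_eq_square algebra_simps)
  finally have "a * (a * (1 - tt\<^sup>2)) = a * (2 * tt * R0)" by (simp add: power2_eq_square mult_ac)
  then have "a * (1 - tt\<^sup>2) = 2 * tt * R0" using a_pos by (metis mult_cancel_left less_irrefl)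
  then show "1 - tt\<^sup>2 = 2 * tt / a * R0" using a_pos by (simp add: field_simps)
qed

lemma tt_den: "1 - 2 * tt * cos \<eta> + tt\<^sup>2 = 2 * tt / a * den \<eta>"
proof -
  have "2 * tt / a * den \<eta> = 2 * tt / a * r0 - 2 * tt * cos \<eta>"
    using a_pos by (simp add: den_def right_diff_distrib)
  then show ?thesis using tt(3) by simp
qed

lemma tt_cos_less: "0 < 1 - tt * cos \<eta>"
proof -
  have "tt * cos \<eta> \<le> tt * 1" using tt by (intro mult_left_mono) auto
  then show ?thesis using tt(2) by linarith
qed

lemma cos_sin_tor_angle:
  "cos (tor_angle \<eta>) = (r0 * cos \<eta> - a) / den \<eta>"
  "sin (tor_angle \<eta>) = R0 * sin \<eta> / den \<eta>"
proof -
  define c s where "c = cos \<eta>" and "s = sin \<eta>"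
  have cs: "s\<^sup>2 = 1 - c\<^sup>2" by (simp add: c_def s_def sin_squared_eq)
  define y where "y = tt * s / (1 - tt * c)"
  define E where "E = 1 - 2 * tt * c + tt\<^sup>2"
  have E: "E = 2 * tt / a * den \<eta>" unfolding E_def c_def by (rule tt_den)
  have E0: "E > 0" unfolding E using tt a_pos den_pos by simp
  have w: "1 - tt * c > 0" unfolding c_def by (rule tt_cos_less)
  have y1: "1 + y\<^sup>2 = E / (1 - tt * c)\<^sup>2"
  proof -
    have "(1 - tt * c)\<^sup>2 + (tt * s)\<^sup>2 = E"
      unfolding E_def power_mult_distrib cs by (simp add: power2_eq_square algebra_simps)
    then show ?thesis using w by (simp add: y_def power_divide field_simps)
  qed
  have A: "cos (2 * arctan y) = ((1 - tt * c)\<^sup>2 - (tt * s)\<^sup>2) / E"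
  proof -
    have "cos (2 * arctan y) = 2 * (cos (arctan y))\<^sup>2 - 1" by (simp add: cos_double_cos)
    also have "\<dots> = 2 / (1 + y\<^sup>2) - 1" by (simp add: cos_arctan power_divide)
    also have "\<dots> = (2 * (1 - tt * c)\<^sup>2 - E) / E" using E0 by (simp add: y1 diff_divide_distrib)
    also have "2 * (1 - tt * c)\<^sup>2 - E = (1 - tt * c)\<^sup>2 - (tt * s)\<^sup>2"
      unfolding E_def power_mult_distrib cs by (simp add: power2_eq_square algebra_simps)
    finally show ?thesis .
  qed
  have B: "sin (2 * arctan y) = 2 * (tt * s) * (1 - tt * c) / E"
  proof -
    have "sqrt (1 + y\<^sup>2) * sqrt (1 + y\<^sup>2) = 1 + y\<^sup>2" by simp
    then have "sin (2 * arctan y) = 2 * y / (1 + y\<^sup>2)"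
      by (simp add: sin_double sin_arctan cos_arctan)
    also have "\<dots> = 2 * (tt * s) * (1 - tt * c) / E" using w E0 by (simp add: y1) (simp add: y_def power2_eq_square)
    finally show ?thesis .
  qed
  have tor: "tor_angle \<eta> = \<eta> + 2 * arctan y" by (simp add: tor_angle_def y_def c_def s_def)
  have scale: "2 * tt / a * x / E = x / den \<eta>" for x
    unfolding E using tt(1) a_pos by simp
  have s2: "s * s = 1 - c * c" using cs by (simp add: power2_eq_square)
  have comb: "c * (A / E) - s * (B / E) = (c * A - s * B) / E" "s * (A / E) + c * (B / E) = (s * A + c * B) / E" for A B
    by (simp_all add: diff_divide_distrib add_divide_distrib)
  have "cos (tor_angle \<eta>) = (c * ((1 - tt * c)\<^sup>2 - (tt * s)\<^sup>2) - s * (2 * (tt * s) * (1 - tt * c))) / E"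
    unfolding tor cos_add A B c_def[symmetric] s_def[symmetric] by (rule comb)
  also have "c * ((1 - tt * c)\<^sup>2 - (tt * s)\<^sup>2) - s * (2 * (tt * s) * (1 - tt * c)) = (1 + tt\<^sup>2) * c - 2 * tt"
  proof -
    have "c * ((1 - tt * c)\<^sup>2 - (tt * s)\<^sup>2) - s * (2 * (tt * s) * (1 - tt * c))
        = c * ((1 - tt * c)\<^sup>2 - tt\<^sup>2 * (s * s)) - 2 * tt * (s * s) * (1 - tt * c)"
      by (simp add: power2_eq_square algebra_simps)
    then show ?thesis unfolding s2 by (simp add: power2_eq_square algebra_simps)
  qed
  also have "(1 + tt\<^sup>2) * c - 2 * tt = 2 * tt / a * (r0 * c - a)"
    unfolding tt(3) using a_pos by (simp add: field_simps)
  finally show "cos (tor_angle \<eta>) = (r0 * cos \<eta> - a) / den \<eta>" unfolding scale c_def .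
  have "sin (tor_angle \<eta>) = (s * ((1 - tt * c)\<^sup>2 - (tt * s)\<^sup>2) + c * (2 * (tt * s) * (1 - tt * c))) / E"
    unfolding tor sin_add A B c_def[symmetric] s_def[symmetric] by (rule comb)
  also have "s * ((1 - tt * c)\<^sup>2 - (tt * s)\<^sup>2) + c * (2 * (tt * s) * (1 - tt * c)) = (1 - tt\<^sup>2) * s"
  proof -
    have "s * ((1 - tt * c)\<^sup>2 - (tt * s)\<^sup>2) + c * (2 * (tt * s) * (1 - tt * c))
        = s * ((1 - tt * c)\<^sup>2 - tt\<^sup>2 * (s * s) + 2 * tt * c * (1 - tt * c))"
      by (simp add: power2_eq_square algebra_simps)
    then show ?thesis unfolding s2 by (simp add: power2_eq_square algebra_simps)
  qed
  also have "(1 - tt\<^sup>2) * s = 2 * tt / a * (R0 * s)" unfolding tt(4) by simp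
  finally show "sin (tor_angle \<eta>) = R0 * sin \<eta> / den \<eta>" unfolding scale s_def .
qed

lemma rho_tor_angle: "rho (tor_angle \<eta>) = R0\<^sup>2 / den \<eta>"
proof -
  have "rho (tor_angle \<eta>) = (r0 * den \<eta> + a * (r0 * cos \<eta> - a)) / den \<eta>"
    using den_pos[of \<eta>] by (simp add: rho_def cos_sin_tor_angle add_divide_distrib)
  also have "r0 * den \<eta> + a * (r0 * cos \<eta> - a) = R0\<^sup>2"
    unfolding R0_sq den_def by (simp add: power2_eq_square algebra_simps)
  finally show ?thesis .
qed

text \<open>The derivative of the argument of the automorphism is the Poisson kernel
  \<open>(1 - tt\<^sup>2) / (1 - 2 * tt * cos \<eta> + tt\<^sup>2)\<close>. The arc length a d\<phi>
  thus equals \<open>qq\<close> rho d\<eta>, scaled by the same factor as rho d\<theta>; this is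
  conformality.\<close>

lemma DERIV_tor_angle: "(tor_angle has_real_derivative rho (tor_angle \<eta>) / R0) (at \<eta>)"
proof -
  define c s where "c = cos \<eta>" and "s = sin \<eta>"
  have s2: "s * s = 1 - c * c" using sin_squared_eq[of \<eta>] by (simp add: c_def s_def power2_eq_square)
  define w where "w = 1 - tt * c"
  have w: "w > 0" unfolding w_def c_def by (rule tt_cos_less)
  define E where "E = 1 - 2 * tt * c + tt\<^sup>2"
  have E: "E = 2 * tt / a * den \<eta>" unfolding E_def c_def by (rule tt_den)
  have E0: "E > 0" unfolding E using tt a_pos den_pos by simp
  have g: "((\<lambda>\<eta>. tt * sin \<eta> / (1 - tt * cos \<eta>)) has_real_derivative
      (tt * c * w - tt * s * (tt * s)) / (w * w)) (at \<eta>)"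
    using w by (auto intro!: derivative_eq_intros simp: w_def c_def s_def)
  have "((\<lambda>\<eta>. \<eta> + 2 * arctan (tt * sin \<eta> / (1 - tt * cos \<eta>))) has_real_derivative
      1 + 2 * (inverse (1 + (tt * s / w)\<^sup>2) * ((tt * c * w - tt * s * (tt * s)) / (w * w)))) (at \<eta>)"
    unfolding w_def c_def s_def
    by (intro DERIV_add DERIV_ident DERIV_cmult DERIV_chain2[OF DERIV_arctan] g[unfolded w_def c_def s_def])
  also have "1 + 2 * (inverse (1 + (tt * s / w)\<^sup>2) * ((tt * c * w - tt * s * (tt * s)) / (w * w))) = (1 - tt\<^sup>2) / E"
  proof -
    have 1: "w * w + tt * s * (tt * s) = E"
    proof -
      have "w * w + tt * s * (tt * s) = w * w + tt\<^sup>2 * (s * s)" by (simp add: power2_eq_square)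
      then show ?thesis unfolding s2 w_def E_def by (simp add: power2_eq_square algebra_simps)
    qed
    have 2: "tt * c * w - tt * s * (tt * s) = tt * c - tt\<^sup>2"
    proof -
      have "tt * c * w - tt * s * (tt * s) = tt * c * w - tt\<^sup>2 * (s * s)" by (simp add: power2_eq_square)
      then show ?thesis unfolding s2 w_def by (simp add: power2_eq_square algebra_simps)
    qed
    have "1 + (tt * s / w)\<^sup>2 = E / (w * w)"
      using w unfolding 1[symmetric] by (simp add: power2_eq_square add_divide_distrib)
    then have "inverse (1 + (tt * s / w)\<^sup>2) * ((tt * c * w - tt * s * (tt * s)) / (w * w)) = (tt * c - tt\<^sup>2) / E"
      using w unfolding 2 by simp
    then have "1 + 2 * (inverse (1 + (tt * s / w)\<^sup>2) * ((tt * c * w - tt * s * (tt * s)) / (w * w)))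
        = (E + 2 * (tt * c - tt\<^sup>2)) / E" using E0 by (simp add: add_divide_distrib)
    also have "E + 2 * (tt * c - tt\<^sup>2) = 1 - tt\<^sup>2" by (simp add: E_def)
    finally show ?thesis .
  qed
  also have "(1 - tt\<^sup>2) / E = rho (tor_angle \<eta>) / R0"
    unfolding tt(4) E rho_tor_angle using tt(1) a_pos R0_pos by (simp add: power2_eq_square)
  finally show ?thesis unfolding tor_angle_def[abs_def] .
qed

lemma tor_angle_measurable [measurable]: "tor_angle \<in> borel_measurable borel"
  by (intro borel_measurable_continuous_onI continuous_at_imp_continuous_on ballI
      DERIV_isCont[OF DERIV_tor_angle])

lemma tor_angle_0 [simp]: "tor_angle 0 = 0" "tor_angle (2 * pi) = 2 * pi"
  by (simp_all add: tor_angle_def)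

text \<open>Matching sine and cosine suffices, as points of the torus see the angle only through
  them. The witness comes from the inverse automorphism: cos \<eta> = (r0 cos \<phi> + a) / rho and
  sin \<eta> = R0 sin \<phi> / rho.\<close>

lemma tor_angle_surj: "\<exists>\<eta>. cos (tor_angle \<eta>) = cos \<phi> \<and> sin (tor_angle \<eta>) = sin \<phi>"
proof -
  define c s where "c = cos \<phi>" and "s = sin \<phi>"
  have s2: "s\<^sup>2 = 1 - c\<^sup>2" by (simp add: c_def s_def sin_squared_eq)
  define r where "r = rho \<phi>"
  have r: "r > 0" unfolding r_def by (rule rho_pos)
  have r_eq: "r = r0 + a * c" by (simp add: r_def rho_def c_def)
  have "((r0 * c + a) / r)\<^sup>2 + (R0 * s / r)\<^sup>2 = ((r0 * c + a)\<^sup>2 + R0\<^sup>2 * s\<^sup>2) / r\<^sup>2"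
    unfolding power_divide power_mult_distrib by (rule add_divide_distrib[symmetric])
  also have "(r0 * c + a)\<^sup>2 + R0\<^sup>2 * s\<^sup>2 = r\<^sup>2"
    unfolding R0_sq s2 r_eq by (simp add: power2_eq_square algebra_simps)
  finally have "((r0 * c + a) / r)\<^sup>2 + (R0 * s / r)\<^sup>2 = 1" using r by simp
  then obtain \<eta> where \<eta>: "(r0 * c + a) / r = cos \<eta>" "R0 * s / r = sin \<eta>"
    using sincos_total_2pi by metis
  have den: "den \<eta> = R0\<^sup>2 / r"
  proof -
    have "den \<eta> = (r0 * r - a * (r0 * c + a)) / r" unfolding den_def \<eta>(1)[symmetric] using r by (simp add: diff_divide_distrib)
    also have "r0 * r - a * (r0 * c + a) = R0\<^sup>2" unfolding R0_sq r_eq by (simp add: power2_eq_square algebra_simps)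
    finally show ?thesis .
  qed
  have "cos (tor_angle \<eta>) = (r0 * ((r0 * c + a) / r) - a) / (R0\<^sup>2 / r)"
    unfolding cos_sin_tor_angle den \<eta>(1) ..
  also have "r0 * ((r0 * c + a) / r) - a = (r0 * (r0 * c + a) - a * r) / r" using r by (simp add: diff_divide_distrib)
  also have "\<dots> / (R0\<^sup>2 / r) = (r0 * (r0 * c + a) - a * r) / R0\<^sup>2" using r by simp
  also have "r0 * (r0 * c + a) - a * r = R0\<^sup>2 * c" unfolding R0_sq r_eq by (simp add: power2_eq_square algebra_simps)
  finally have "cos (tor_angle \<eta>) = c" using R0_pos by simp
  moreover have "sin (tor_angle \<eta>) = R0 * (R0 * s / r) / (R0\<^sup>2 / r)"
    unfolding cos_sin_tor_angle den \<eta>(2) ..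
  then have "sin (tor_angle \<eta>) = s" using r R0_pos by (simp add: power2_eq_square)
  ultimately show ?thesis by (auto simp: c_def s_def)
qed

text \<open>A disc automorphism multiplies the squared chord between two boundary points by the
  product of the moduli of its derivatives there. Both summands of the squared distance on the torus
  thereby acquire the common factor rho rho'.\<close>

lemma ku_tor_angle:
  "a\<^sup>2 * ku (tor_angle \<eta> - tor_angle \<eta>')
    = rho (tor_angle \<eta>) * rho (tor_angle \<eta>') * (qq\<^sup>2 * ku (\<eta> - \<eta>'))"
proof -
  let ?D = "den \<eta>" and ?D' = "den \<eta>'"
  have D: "?D > 0" "?D' > 0" by (rule den_pos)+
  have "1 - cos (tor_angle \<eta> - tor_angle \<eta>')
      = 1 - (r0 * cos \<eta> - a) / ?D * ((r0 * cos \<eta>' - a) / ?D') - R0 * sin \<eta> / ?D * (R0 * sin \<eta>' / ?D')"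
    unfolding cos_diff cos_sin_tor_angle by simp
  also have "\<dots> = (?D * ?D' - (r0 * cos \<eta> - a) * (r0 * cos \<eta>' - a) - R0\<^sup>2 * (sin \<eta> * sin \<eta>')) / (?D * ?D')"
  proof -
    have "1 - x / d * (y / d') - R * u / d * (R * v / d') = (d * d' - x * y - R\<^sup>2 * (u * v)) / (d * d')"
      if "d > 0" "d' > 0" for x y u v d d' R :: real
      using that by (simp add: field_simps power2_eq_square)
    then show ?thesis using D .
  qed
  also have "?D * ?D' - (r0 * cos \<eta> - a) * (r0 * cos \<eta>' - a) - R0\<^sup>2 * (sin \<eta> * sin \<eta>')
      = R0\<^sup>2 * (1 - cos (\<eta> - \<eta>'))"
    unfolding R0_sq cos_diff den_def by (simp add: power2_eq_square algebra_simps)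
  finally have "1 - cos (tor_angle \<eta> - tor_angle \<eta>') = R0\<^sup>2 * (1 - cos (\<eta> - \<eta>')) / (?D * ?D')" .
  then show ?thesis
    unfolding ku_def rho_tor_angle qq_def using D R0_pos
    by (simp add: power2_eq_square mult_ac)
qed

end

section \<open>Absolutely convergent sine series\<close>

definition sine_series :: "(nat \<Rightarrow> real) \<Rightarrow> real \<Rightarrow> real" where
  "sine_series f x = (\<Sum>n. f n * sin (real (Suc n) * x))"

lemma sine_series_summable:
  assumes "summable (\<lambda>n. \<bar>f n\<bar>)"
  shows "summable (\<lambda>n. norm (f n * sin (real (Suc n) * x)))"
  by (rule summable_comparison_test'[OF assms, of 0]) (auto simp: abs_mult mult_left_le)

lemma sine_series_sums:
  "summable (\<lambda>n. \<bar>f n\<bar>) \<Longrightarrow> (\<lambda>n. f n * sin (real (Suc n) * x)) sums sine_series f x"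
  unfolding sine_series_def by (intro summable_sums summable_norm_cancel[OF sine_series_summable])

lemma abs_sine_series_le:
  assumes "summable (\<lambda>n. \<bar>f n\<bar>)"
  shows "\<bar>sine_series f x\<bar> \<le> (\<Sum>n. \<bar>f n\<bar>)"
proof -
  have "norm (sine_series f x) \<le> (\<Sum>n. norm (f n * sin (real (Suc n) * x)))"
    unfolding sine_series_def by (rule summable_norm[OF sine_series_summable[OF assms]])
  also have "\<dots> \<le> (\<Sum>n. \<bar>f n\<bar>)"
    by (intro suminf_le sine_series_summable assms) (auto simp: abs_mult mult_left_le)
  finally show ?thesis by simp
qed

lemma sine_series_measurable [measurable]: "sine_series f \<in> borel_measurable borel"
  unfolding sine_series_def by measurable

text \<open>Integrability of \<open>A\<close> and absolute summability of \<open>f\<close> allow sum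
  and integral to be exchanged; each term is then an eigenfunction of the convolution.\<close>

lemma sine_series_convolution:
  fixes A :: "real \<Rightarrow> real"
  assumes meas [measurable]: "A \<in> borel_measurable borel" and A: "integrable circ A"
    and per: "\<And>x. A (x + 2 * pi) = A x" and even: "\<And>x. A (- x) = A x"
    and f: "summable (\<lambda>n. \<bar>f n\<bar>)"
  shows "integrable circ (\<lambda>y. A (x - y) * sine_series f y)"
    and "(LINT y|circ. A (x - y) * sine_series f y)
       = sine_series (\<lambda>n. (LINT y|circ. A y * cos (real (Suc n) * y)) * f n) x"
proof -
  have iA: "integrable circ (\<lambda>y. A (x - y))" by (rule even_convolution_sin(2)[OF meas A per even])
  define h where "h n y = f n * (A (x - y) * sin (real (Suc n) * y))" for n y
  have h: "integrable circ (h n)" for n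
    unfolding h_def
    by (intro integrable_mult_right Bochner_Integration.integrable_bound[OF iA])
      (auto simp: abs_mult mult_left_le)
  have h_le: "norm (h n y) \<le> \<bar>f n\<bar> * \<bar>A (x - y)\<bar>" for n y
    by (simp add: h_def abs_mult mult_left_le mult_left_mono)
  have summ_h: "summable (\<lambda>n. norm (h n y))" for y
    by (rule summable_comparison_test'[OF summable_mult2[OF f, of "\<bar>A (x - y)\<bar>"], of 0]) (use h_le in auto)
  have summ_int: "summable (\<lambda>n. LINT y|circ. norm (h n y))"
  proof (rule summable_comparison_test')
    show "summable (\<lambda>n. \<bar>f n\<bar> * (LINT y|circ. \<bar>A (x - y)\<bar>))" by (rule summable_mult2[OF f])
    fix n
    have "(LINT y|circ. norm (h n y)) \<le> (LINT y|circ. \<bar>f n\<bar> * \<bar>A (x - y)\<bar>)"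
      by (intro integral_mono integrable_norm h integrable_mult_right integrable_abs iA h_le)
    then show "norm (LINT y|circ. norm (h n y)) \<le> \<bar>f n\<bar> * (LINT y|circ. \<bar>A (x - y)\<bar>)"
      by simp
  qed
  have sum_h: "(\<Sum>n. h n y) = A (x - y) * sine_series f y" for y
  proof -
    have "(\<lambda>n. A (x - y) * (f n * sin (real (Suc n) * y))) sums (A (x - y) * sine_series f y)"
      by (intro sums_mult sine_series_sums f)
    then show ?thesis by (simp add: h_def sums_iff mult_ac)
  qed
  have AE: "AE y in circ. summable (\<lambda>n. norm (h n y))" using summ_h by simp
  show "integrable circ (\<lambda>y. A (x - y) * sine_series f y)"
    using integrable_suminf[OF h AE summ_int] by (simp add: sum_h)
  have "(LINT y|circ. A (x - y) * sine_series f y) = (\<Sum>n. LINT y|circ. h n y)"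
    using integral_suminf[OF h AE summ_int] by (simp add: sum_h)
  also have "\<dots> = (\<Sum>n. (LINT y|circ. A y * cos (real (Suc n) * y)) * f n * sin (real (Suc n) * x))"
    unfolding h_def integral_mult_right_zero even_convolution_sin(1)[OF meas A per even]
    by (simp add: mult_ac)
  finally show "(LINT y|circ. A (x - y) * sine_series f y)
       = sine_series (\<lambda>n. (LINT y|circ. A y * cos (real (Suc n) * y)) * f n) x"
    by (simp add: sine_series_def)
qed

text \<open>Uniqueness of coefficients, read off the convolution lemma: convolving with the cosine
  of frequency \<open>m + 1\<close> isolates the term \<open>n = m\<close>.\<close>

lemma sine_series_nonzero:
  assumes f: "summable (\<lambda>n. \<bar>f n\<bar>)" and m: "f m \<noteq> 0"
  shows "\<exists>x. sine_series f x \<noteq> 0"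
proof (rule ccontr)
  assume "\<not> ?thesis"
  then have zero: "sine_series f x = 0" for x by simp
  let ?M = "real (Suc m)"
  define A where "A y = cos (?M * y)" for y
  \<comment> \<open>The sine of frequency \<open>m + 1\<close> equals 1 at this point.\<close>
  define x where "x = pi / (2 * ?M)"
  have cont: "continuous_on UNIV A" unfolding A_def by (intro continuous_intros)
  have meas: "A \<in> borel_measurable borel" using cont by (rule borel_measurable_continuous_onI)
  have int: "integrable circ A" by (rule integrable_circ_continuous[OF cont])
  have coeff: "(LINT y|circ. A y * cos (real (Suc n) * y)) = (if n = m then pi else 0)" for n
  proof -
    have "A y * cos (real (Suc n) * y)
        = (cos (real (nat \<bar>int n - int m\<bar>) * y) + cos (real (Suc n + Suc m) * y)) / 2" for y
    proof -
      have "cos (real (nat \<bar>int n - int m\<bar>) * y) = cos ((real (Suc n) - ?M) * y)"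
      proof (cases "m \<le> n")
        case True
        then show ?thesis by (simp add: of_nat_diff nat_diff_distrib)
      next
        case False
        then have "real (nat \<bar>int n - int m\<bar>) * y = - ((real (Suc n) - ?M) * y)" by (simp add: algebra_simps)
        then show ?thesis by simp
      qed
      also have "(real (Suc n) - ?M) * y = real (Suc n) * y - ?M * y" by (rule left_diff_distrib)
      finally have 1: "cos (real (nat \<bar>int n - int m\<bar>) * y) = cos (real (Suc n) * y - ?M * y)" .
      have 2: "cos (real (Suc n + Suc m) * y) = cos (real (Suc n) * y + ?M * y)"
        by (simp only: of_nat_add distrib_right)
      show ?thesis unfolding A_def 1 2 cos_add cos_diff by (simp add: mult.commute)
    qed
    then have "(LINT y|circ. A y * cos (real (Suc n) * y))
        = (LINT y|circ. (cos (real (nat \<bar>int n - int m\<bar>) * y) + cos (real (Suc n + Suc m) * y)) / 2)"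
      by (simp only:)
    also have "\<dots> = ((LINT y|circ. cos (real (nat \<bar>int n - int m\<bar>) * y)) + (LINT y|circ. cos (real (Suc n + Suc m) * y))) / 2"
      by (subst Bochner_Integration.integral_add[symmetric])
        (auto intro!: integrable_circ_continuous continuous_intros)
    also have "(LINT y|circ. cos (real (Suc n + Suc m) * y)) = 0" by (rule integral_circ_cos) simp
    also have "(LINT y|circ. cos (real (nat \<bar>int n - int m\<bar>) * y)) = (if n = m then 2 * pi else 0)"
      using integral_circ_cos[of "nat \<bar>int n - int m\<bar>"] by (auto simp: measure_circ_space)
    finally show ?thesis by (cases "n = m") simp_all
  qed
  have "(LINT y|circ. A (x - y) * sine_series f y)
       = sine_series (\<lambda>n. (LINT y|circ. A y * cos (real (Suc n) * y)) * f n) x"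
    by (rule sine_series_convolution(2)[OF meas int _ _ f])
      (simp_all add: A_def sin_multiple_periodic del: of_nat_Suc)
  then have "sine_series (\<lambda>n. (if n = m then pi else 0) * f n) x = 0"
    unfolding coeff by (simp add: zero)
  moreover have "(\<lambda>n. (if n = m then pi else 0) * f n * sin (real (Suc n) * x)) sums (pi * f m * sin (?M * x))"
    using sums_single[of m "\<lambda>n. pi * f n * sin (real (Suc n) * x)"]
    by (rule sums_cong[THEN iffD1, rotated]) auto
  moreover have "?M * x = pi / 2" by (simp add: x_def del: of_nat_Suc)
  ultimately show False using m unfolding sine_series_def sums_iff by (simp del: of_nat_Suc)
qed

text \<open>The coefficient relation is multiplication by \<open>r - a * cos x\<close>. The two
  neighbour sums are shifted copies of one series each, with sin 0 = 0 absorbing the missing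
  boundary term.\<close>

lemma sine_series_jacobi:
  assumes p: "summable (\<lambda>n. \<bar>p n\<bar>)"
    and eq: "\<And>n. r * p n - a * ((p (Suc n) + (case n of 0 \<Rightarrow> 0 | Suc m \<Rightarrow> p m)) / 2) = h n"
  shows "sine_series h x = (r - a * cos x) * sine_series p x"
proof -
  let ?e = "\<lambda>n. sin (real n * x)"
  have P: "(\<lambda>n. p n * ?e (Suc n)) sums sine_series p x" by (rule sine_series_sums[OF p])
  have shift: "summable (\<lambda>n. p n * ?e n)" "summable (\<lambda>n. p n * ?e (Suc (Suc n)))"
    by (rule summable_norm_cancel, rule summable_comparison_test'[OF p, of 0], simp add: abs_mult mult_left_le)+
  have up: "(\<lambda>n. p (Suc n) * ?e (Suc n)) sums (\<Sum>n. p n * ?e n)"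
    using summable_sums[OF shift(1)] by (subst sums_Suc_iff) simp
  have "(\<lambda>n. (case Suc n of 0 \<Rightarrow> 0 | Suc m \<Rightarrow> p m) * ?e (Suc (Suc n))) sums (\<Sum>n. p n * ?e (Suc (Suc n)))"
    using summable_sums[OF shift(2)] by simp
  from sums_Suc[OF this]
  have down: "(\<lambda>n. (case n of 0 \<Rightarrow> 0 | Suc m \<Rightarrow> p m) * ?e (Suc n)) sums (\<Sum>n. p n * ?e (Suc (Suc n)))"
    by simp
  have "(\<lambda>n. p n * ?e n + p n * ?e (Suc (Suc n))) sums ((\<Sum>n. p n * ?e n) + (\<Sum>n. p n * ?e (Suc (Suc n))))"
    by (intro sums_add summable_sums shift)
  moreover have "p n * ?e n + p n * ?e (Suc (Suc n)) = 2 * cos x * (p n * ?e (Suc n))" for n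
  proof -
    have "?e n + ?e (Suc (Suc n)) = 2 * cos x * ?e (Suc n)"
      using sin_add[of "real (Suc n) * x" x] sin_diff[of "real (Suc n) * x" x] by (simp add: algebra_simps)
    then show ?thesis by (simp add: distrib_left[symmetric])
  qed
  ultimately have "(\<lambda>n. 2 * cos x * (p n * ?e (Suc n))) sums ((\<Sum>n. p n * ?e n) + (\<Sum>n. p n * ?e (Suc (Suc n))))"
    by simp
  from sums_unique2[OF this sums_mult[OF P]]
  have tot: "(\<Sum>n. p n * ?e n) + (\<Sum>n. p n * ?e (Suc (Suc n))) = 2 * cos x * sine_series p x" .
  have "(\<lambda>n. r * (p n * ?e (Suc n)) - a / 2 * (p (Suc n) * ?e (Suc n) + (case n of 0 \<Rightarrow> 0 | Suc m \<Rightarrow> p m) * ?e (Suc n)))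
      sums (r * sine_series p x - a / 2 * ((\<Sum>n. p n * ?e n) + (\<Sum>n. p n * ?e (Suc (Suc n)))))"
    by (intro sums_diff sums_mult sums_add P up down)
  moreover have "r * (p n * ?e (Suc n)) - a / 2 * (p (Suc n) * ?e (Suc n) + (case n of 0 \<Rightarrow> 0 | Suc m \<Rightarrow> p m) * ?e (Suc n))
      = h n * ?e (Suc n)" for n
    unfolding eq[symmetric] by (simp only: distrib_right left_diff_distrib add_divide_distrib) (simp add: algebra_simps)
  ultimately have "(\<lambda>n. h n * ?e (Suc n)) sums (r * sine_series p x - a / 2 * (2 * cos x * sine_series p x))"
    unfolding tot by simp
  then have "sine_series h x = r * sine_series p x - a / 2 * (2 * cos x * sine_series p x)"
    by (simp only: sine_series_def sums_iff)
  then show ?thesis by (simp add: algebra_simps)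
qed

text \<open>Extends the sine series from the unit circle to the closed disc, so that densities on
  the surface become continuous functions of Cartesian coordinates and no branch of the angle is
  chosen.\<close>

lemma continuous_sine_series_disc:
  assumes f: "summable (\<lambda>n. \<bar>f n\<bar>)"
  shows "continuous_on (cball 0 1) (\<lambda>z. \<Sum>n. f n * Im (z ^ Suc n))"
proof (rule uniform_limit_theorem)
  show "uniform_limit (cball 0 1) (\<lambda>N z. \<Sum>n<N. f n * Im (z ^ Suc n)) (\<lambda>z. \<Sum>n. f n * Im (z ^ Suc n)) sequentially"
  proof (rule Weierstrass_m_test[OF _ f])
    fix n and z :: complex assume "z \<in> cball 0 1"
    then have "cmod z ^ Suc n \<le> 1" by (intro power_le_one) auto
    then have "\<bar>Im (z ^ Suc n)\<bar> \<le> 1" using abs_Im_le_cmod[of "z ^ Suc n"] by (simp only: norm_power)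
    then show "norm (f n * Im (z ^ Suc n)) \<le> \<bar>f n\<bar>" 
      unfolding real_norm_def abs_mult by (intro mult_left_le) auto
  qed
qed (auto intro!: always_eventually continuous_intros)

lemma sine_series_cis: "sine_series f \<eta> = (\<Sum>n. f n * Im (Complex (cos \<eta>) (sin \<eta>) ^ Suc n))"
proof -
  have "Complex (cos \<eta>) (sin \<eta>) = cis \<eta>" by (simp add: complex_eq_iff)
  then have "Im (Complex (cos \<eta>) (sin \<eta>) ^ Suc n) = sin (real (Suc n) * \<eta>)" for n
    by (simp add: Complex.DeMoivre del: power_Suc of_nat_Suc)
  then show ?thesis unfolding sine_series_def by (simp only:)
qed

section \<open>The Neumann--Poincare operator on axisymmetric densities\<close>

lemma set_integral_square_eq_circ:
  fixes H :: "real \<times> real \<Rightarrow> real"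
  assumes [measurable]: "H \<in> borel_measurable borel"
  shows "(LINT s : {0..2*pi} \<times> {0..2*pi} | lborel. H s) = integral\<^sup>L (circ \<Otimes>\<^sub>M circ) H"
proof -
  let ?i = "\<lambda>x. ennreal (indicator {0..2*pi} x)"
  have [measurable]: "{0..2*pi} \<times> {0..2*pi} \<in> sets (borel :: (real \<times> real) measure)"
    by (intro borel_closed closed_Times) auto
  have "circ \<Otimes>\<^sub>M circ = density (lborel \<Otimes>\<^sub>M lborel) (\<lambda>(x, y). ?i x * ?i y)"
    unfolding circ_def
    by (rule pair_measure_density)
      (auto intro!: sigma_finite_lborel circ.sigma_finite_measure_axioms[unfolded circ_def])
  also have "\<dots> = density lborel (\<lambda>s. ennreal (indicator ({0..2*pi} \<times> {0..2*pi}) s))"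
    unfolding lborel_prod
    by (intro arg_cong[where f = "density lborel"]) (auto simp: fun_eq_iff indicator_def)
  finally have "integral\<^sup>L (circ \<Otimes>\<^sub>M circ) H = integral\<^sup>L lborel (\<lambda>s. indicator ({0..2*pi} \<times> {0..2*pi}) s *\<^sub>R H s)"
    by (simp only:) (subst integral_density, auto)
  then show ?thesis by (simp add: set_lebesgue_integral_def)
qed

text \<open>The rigid motion drops out because \<open>g\<close> preserves inner products and norms;
  the remaining trigonometry expresses numerator and distance through squared half-angle
  sines.\<close>

lemma NP_kernel_torus:
  assumes g: "orthogonal_transformation g"
  shows "NP_kernel (tor_point g b r0 a (\<theta>, \<phi>)) (tor_point g b r0 a (\<theta>', \<phi>')) (tor_normal g (\<theta>, \<phi>))
     = (2 * a * ku (\<phi> - \<phi>') + 2 * (r0 + a * cos \<phi>') * cos \<phi> * ku (\<theta> - \<theta>'))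
       / (4 * pi * (2 * sqrt (a\<^sup>2 * ku (\<phi> - \<phi>') + (r0 + a * cos \<phi>) * (r0 + a * cos \<phi>') * ku (\<theta> - \<theta>'))) ^ 3)"
proof -
  define x y \<nu> where "x = torus_param r0 a (\<theta>, \<phi>)" and "y = torus_param r0 a (\<theta>', \<phi>')"
    and "\<nu> = torus_normal (\<theta>, \<phi>)"
  have lin: "linear g" using g by (rule orthogonal_transformation_linear)
  have diff: "tor_point g b r0 a (\<theta>, \<phi>) - tor_point g b r0 a (\<theta>', \<phi>') = g (x - y)"
    by (simp add: tor_point_def x_def y_def linear_diff[OF lin])
  have inner: "g (x - y) \<bullet> tor_normal g (\<theta>, \<phi>) = (x - y) \<bullet> \<nu>"
    using g by (simp add: tor_normal_def \<nu>_def orthogonal_transformation_def)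
  have norm: "norm (g (x - y)) = norm (x - y)" using g by (simp add: orthogonal_transformation)
  have ct: "cos (\<theta> - \<theta>') = cos \<theta> * cos \<theta>' + sin \<theta> * sin \<theta>'"
    and cp: "cos (\<phi> - \<phi>') = cos \<phi> * cos \<phi>' + sin \<phi> * sin \<phi>'" by (rule cos_diff)+
  have tht: "sin \<theta> * sin \<theta> = 1 - cos \<theta> * cos \<theta>" "sin \<theta>' * sin \<theta>' = 1 - cos \<theta>' * cos \<theta>'"
    "sin \<phi> * sin \<phi> = 1 - cos \<phi> * cos \<phi>" "sin \<phi>' * sin \<phi>' = 1 - cos \<phi>' * cos \<phi>'"
    using sin_squared_eq[of \<theta>] sin_squared_eq[of \<theta>'] sin_squared_eq[of \<phi>] sin_squared_eq[of \<phi>']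
    by (simp_all add: power2_eq_square)
  define c s c' s' p z p' z' where "c = cos \<theta>" and "s = sin \<theta>" and "c' = cos \<theta>'" and "s' = sin \<theta>'"
    and "p = cos \<phi>" and "z = sin \<phi>" and "p' = cos \<phi>'" and "z' = sin \<phi>'"
  note defs = c_def s_def c'_def s'_def p_def z_def p'_def z'_def
  note sq = tht[folded defs]
  have comp: "(x - y) $ 1 = (r0 + a * p) * c - (r0 + a * p') * c'"
    "(x - y) $ 2 = (r0 + a * p) * s - (r0 + a * p') * s'" "(x - y) $ 3 = a * z - a * z'"
    "\<nu> $ 1 = p * c" "\<nu> $ 2 = p * s" "\<nu> $ 3 = z"
    by (simp_all add: x_def y_def \<nu>_def torus_param_def torus_normal_def vector_3 defs)
  have "(x - y) \<bullet> \<nu> = 2 * a * ku (\<phi> - \<phi>') + 2 * (r0 + a * cos \<phi>') * cos \<phi> * ku (\<theta> - \<theta>')"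
  proof -
    have "(x - y) \<bullet> \<nu> = (x - y) $ 1 * \<nu> $ 1 + (x - y) $ 2 * \<nu> $ 2 + (x - y) $ 3 * \<nu> $ 3"
      by (simp add: inner_vec_def sum_3)
    also have "\<dots> = (r0 + a * p) * p * (c * c + s * s) - (r0 + a * p') * p * (c * c' + s * s') + a * (z * z) - a * z * z'"
      unfolding comp by (simp add: algebra_simps)
    also have "\<dots> = a * (1 - (p * p' + z * z')) + (r0 + a * p') * p * (1 - (c * c' + s * s'))"
      unfolding sq by (simp add: algebra_simps)
    also have "\<dots> = 2 * a * ((1 - (p * p' + z * z')) / 2) + 2 * (r0 + a * p') * p * ((1 - (c * c' + s * s')) / 2)"
    proof -
      have "a * A + B * P * T = 2 * a * (A / 2) + 2 * B * P * (T / 2)" for A B P T :: real by simp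
      then show ?thesis .
    qed
    finally show ?thesis unfolding ku_def ct cp defs .
  qed
  moreover have "norm (x - y) = 2 * sqrt (a\<^sup>2 * ku (\<phi> - \<phi>') + (r0 + a * cos \<phi>) * (r0 + a * cos \<phi>') * ku (\<theta> - \<theta>'))"
  proof -
    have "(norm (x - y))\<^sup>2 = (x - y) $ 1 * (x - y) $ 1 + (x - y) $ 2 * (x - y) $ 2 + (x - y) $ 3 * (x - y) $ 3"
      by (simp only: power2_norm_eq_inner inner_vec_def sum_3 inner_real_def)
    also have "\<dots> = (r0 + a * p)\<^sup>2 * (c * c + s * s) + (r0 + a * p')\<^sup>2 * (c' * c' + s' * s')
        - 2 * (r0 + a * p) * (r0 + a * p') * (c * c' + s * s') + a\<^sup>2 * (z * z + z' * z' - 2 * z * z')"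
      unfolding comp by (simp add: power2_eq_square algebra_simps)
    also have "\<dots> = 2 * a\<^sup>2 * (1 - (p * p' + z * z')) + 2 * ((r0 + a * p) * (r0 + a * p')) * (1 - (c * c' + s * s'))"
      unfolding sq by (simp add: power2_eq_square algebra_simps)
    also have "\<dots> = 4 * (a\<^sup>2 * ((1 - (p * p' + z * z')) / 2) + (r0 + a * p) * (r0 + a * p') * ((1 - (c * c' + s * s')) / 2))"
    proof -
      have "2 * a\<^sup>2 * A + 2 * B * T = 4 * (a\<^sup>2 * (A / 2) + B * (T / 2))" for A B T :: real by simp
      then show ?thesis .
    qed
    also have "\<dots> = 4 * (a\<^sup>2 * ku (\<phi> - \<phi>') + (r0 + a * cos \<phi>) * (r0 + a * cos \<phi>') * ku (\<theta> - \<theta>'))"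
      unfolding ku_def ct cp defs ..
    finally have "sqrt ((norm (x - y))\<^sup>2) = sqrt (4 * (a\<^sup>2 * ku (\<phi> - \<phi>') + (r0 + a * cos \<phi>) * (r0 + a * cos \<phi>') * ku (\<theta> - \<theta>')))"
      by simp
    then show ?thesis by (simp only: real_sqrt_mult real_sqrt_four real_sqrt_abs abs_norm_cancel)
  qed
  ultimately show ?thesis unfolding NP_kernel_def diff inner norm by simp
qed

context ring_torus
begin

definition chordN :: "real \<Rightarrow> real \<Rightarrow> real \<Rightarrow> real \<Rightarrow> real" where
  "chordN \<theta> \<phi> \<theta>' \<phi>' = a\<^sup>2 * ku (\<phi> - \<phi>') + rho \<phi> * rho \<phi>' * ku (\<theta> - \<theta>')"

text \<open>The surface element \<open>a * rho \<phi>'\<close> is absorbed into the kernel;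
  \<open>chordN\<close> is a quarter of the squared distance.\<close>

definition axiK :: "real \<Rightarrow> real \<Rightarrow> real \<Rightarrow> real \<Rightarrow> real" where
  "axiK \<theta> \<phi> \<theta>' \<phi>' = (2 * a * ku (\<phi> - \<phi>') + 2 * rho \<phi>' * cos \<phi> * ku (\<theta> - \<theta>'))
     / (4 * pi * (2 * sqrt (chordN \<theta> \<phi> \<theta>' \<phi>')) ^ 3) * (a * rho \<phi>')"

lemma rho_measurable [measurable]: "rho \<in> borel_measurable borel"
  unfolding rho_def by measurable

text \<open>The numerator is at most a multiple of \<open>chordN\<close>, which leaves a single
  inverse square root; \<open>m\<close> bounds both coefficients of \<open>chordN\<close> from
  below. The resulting majorant is what licenses Fubini for the kernel.\<close>

lemma axiK_bound: "\<exists>C. \<forall>\<theta>' \<phi>'. \<bar>axiK \<theta> \<phi> \<theta>' \<phi>'\<bar> \<le> C * kA 1 (\<theta>' - \<theta>) (\<phi>' - \<phi>)"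
proof -
  define m where "m = min (a\<^sup>2) ((r0 - a)\<^sup>2)"
  have m: "m > 0" using a_pos a_less by (simp add: m_def)
  define M where "M = 2 * (r0 + a) / m"
  have M: "M \<ge> 0" using a_pos a_less m by (simp add: M_def)
  define C where "C = M * (a * (r0 + a)) / (32 * pi * sqrt m)"
  have "\<bar>axiK \<theta> \<phi> \<theta>' \<phi>'\<bar> \<le> C * kA 1 (\<theta>' - \<theta>) (\<phi>' - \<phi>)" for \<theta>' \<phi>'
  proof -
    define u w where "u = ku (\<theta> - \<theta>')" and "w = ku (\<phi> - \<phi>')"
    have uw: "u \<ge> 0" "w \<ge> 0" by (simp_all add: u_def w_def)
    define N where "N = chordN \<theta> \<phi> \<theta>' \<phi>'"
    have flip: "ku (\<theta>' - \<theta>) = u" "ku (\<phi>' - \<phi>) = w"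
      using ku_minus[of "\<theta> - \<theta>'"] ku_minus[of "\<phi> - \<phi>'"] by (simp_all add: u_def w_def)
    then have kX: "kX 1 (\<theta>' - \<theta>) (\<phi>' - \<phi>) = u + w" by (simp add: kX_def)
    have N_eq: "N = a\<^sup>2 * w + rho \<phi> * rho \<phi>' * u" by (simp add: N_def chordN_def u_def w_def)
    have "(r0 - a)\<^sup>2 \<le> rho \<phi> * rho \<phi>'"
      unfolding power2_eq_square using rho_ge rho_pos a_less by (intro mult_mono) (auto intro: less_imp_le)
    then have "m * u \<le> rho \<phi> * rho \<phi>' * u" "m * w \<le> a\<^sup>2 * w"
      using uw by (auto simp: m_def intro!: mult_right_mono)
    then have N_ge: "m * (u + w) \<le> N" unfolding N_eq by (simp add: distrib_left)
    show ?thesis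
    proof (cases "u + w = 0")
      case True
      then have "u = 0" "w = 0" using uw by auto
      then show ?thesis by (simp add: axiK_def kA_def kX u_def w_def)
    next
      case False
      then have uw0: "u + w > 0" using uw by simp
      then have N0: "N > 0" using N_ge m by (meson less_le_trans mult_pos_pos)
      have num: "\<bar>2 * a * w + 2 * rho \<phi>' * cos \<phi> * u\<bar> \<le> M * N"
      proof -
        have "\<bar>rho \<phi>' * cos \<phi>\<bar> \<le> (r0 + a) * 1"
          unfolding abs_mult using rho_le[of \<phi>'] rho_pos[of \<phi>'] by (intro mult_mono) auto
        then have "\<bar>rho \<phi>' * cos \<phi>\<bar> * u \<le> (r0 + a) * u" using uw by (intro mult_right_mono) auto
        moreover have "\<bar>2 * rho \<phi>' * cos \<phi> * u\<bar> = 2 * (\<bar>rho \<phi>' * cos \<phi>\<bar> * u)"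
          using uw by (simp add: abs_mult)
        ultimately have 1: "\<bar>2 * rho \<phi>' * cos \<phi> * u\<bar> \<le> 2 * ((r0 + a) * u)" by linarith
        have "a * w \<le> (r0 + a) * w" using uw a_less a_pos by (intro mult_right_mono) auto
        then have 2: "\<bar>2 * a * w\<bar> \<le> 2 * ((r0 + a) * w)"
          using uw a_pos by (simp add: abs_mult)
        have "\<bar>2 * a * w + 2 * rho \<phi>' * cos \<phi> * u\<bar> \<le> 2 * (r0 + a) * (u + w)"
        proof -
          have "2 * (r0 + a) * (u + w) = 2 * ((r0 + a) * u) + 2 * ((r0 + a) * w)" by (simp add: algebra_simps)
          then show ?thesis
            using 1 2 abs_triangle_ineq[of "2 * a * w" "2 * rho \<phi>' * cos \<phi> * u"] by linarith
        qed
        also have "\<dots> = M * (m * (u + w))" using m by (simp add: M_def)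
        also have "\<dots> \<le> M * N" using N_ge M by (rule mult_left_mono)
        finally show ?thesis .
      qed
      have cube: "(2 * sqrt N) ^ 3 = 8 * (N * sqrt N)"
        using N0 by (simp add: power_mult_distrib power3_eq_cube)
      have "\<bar>axiK \<theta> \<phi> \<theta>' \<phi>'\<bar> = \<bar>2 * a * w + 2 * rho \<phi>' * cos \<phi> * u\<bar> / (4 * pi * (8 * (N * sqrt N))) * (a * rho \<phi>')"
        unfolding axiK_def u_def[symmetric] w_def[symmetric] N_def[symmetric] cube
        using N0 a_pos rho_pos[of \<phi>'] by (simp add: abs_mult)
      also have "\<dots> \<le> M * N / (4 * pi * (8 * (N * sqrt N))) * (a * (r0 + a))"
        using num N0 a_pos a_less rho_le[of \<phi>'] rho_pos[of \<phi>'] M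
        by (intro mult_mono divide_right_mono mult_left_mono) auto
      also have "\<dots> = M * (a * (r0 + a)) / (32 * pi) * (1 / sqrt N)" using N0 by simp
      also have "\<dots> \<le> M * (a * (r0 + a)) / (32 * pi) * (1 / sqrt (m * (u + w)))"
        using N_ge m uw0 M a_pos a_less N0 by (intro mult_left_mono divide_left_mono mult_pos_pos) auto
      also have "\<dots> = C * kA 1 (\<theta>' - \<theta>) (\<phi>' - \<phi>)" by (simp add: C_def kA_def kX real_sqrt_mult)
      finally show ?thesis .
    qed
  qed
  then show ?thesis by blast
qed

text \<open>Because \<open>a * cos \<phi> = \<rho> - r0\<close>, the numerator times
  \<open>a\<close> equals \<open>2 * \<rho>' * (\<rho> * X - r0 * u)\<close>. Division by X to the
  power 3/2 turns the first part into \<open>kA\<close> and the second into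
  \<open>kB\<close>.\<close>

lemma axiK_conformal:
  "axiK \<theta> (tor_angle \<eta>) \<theta>' (tor_angle \<eta>')
    = sqrt (rho (tor_angle \<eta>')) / (16 * pi * sqrt (rho (tor_angle \<eta>)) ^ 3)
      * (rho (tor_angle \<eta>) * kA qq (\<theta>' - \<theta>) (\<eta> - \<eta>') - r0 * kB qq (\<theta>' - \<theta>) (\<eta> - \<eta>'))"
proof -
  define \<phi> \<phi>' where "\<phi> = tor_angle \<eta>" and "\<phi>' = tor_angle \<eta>'"
  define u X where "u = ku (\<theta> - \<theta>')" and "X = kX qq (\<theta>' - \<theta>) (\<eta> - \<eta>')"
  have flip: "ku (\<theta>' - \<theta>) = u" using ku_minus[of "\<theta> - \<theta>'"] by (simp add: u_def)
  have X: "X = u + qq\<^sup>2 * ku (\<eta> - \<eta>')" by (simp add: X_def kX_def flip)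
  define \<rho> \<rho>' where "\<rho> = rho \<phi>" and "\<rho>' = rho \<phi>'"
  have \<rho>: "\<rho> > 0" "\<rho>' > 0" by (simp_all add: \<rho>_def \<rho>'_def rho_pos)
  have w: "a\<^sup>2 * ku (\<phi> - \<phi>') = \<rho> * \<rho>' * (X - u)"
    unfolding \<phi>_def \<phi>'_def ku_tor_angle by (simp add: X \<rho>_def \<rho>'_def \<phi>_def \<phi>'_def)
  have N: "chordN \<theta> \<phi> \<theta>' \<phi>' = \<rho> * \<rho>' * X"
    unfolding chordN_def w u_def[symmetric] \<rho>_def[symmetric] \<rho>'_def[symmetric] by (simp add: algebra_simps)
  have num: "a * (2 * a * ku (\<phi> - \<phi>') + 2 * \<rho>' * cos \<phi> * u) = 2 * \<rho>' * (\<rho> * X - r0 * u)"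
  proof -
    have "a * cos \<phi> = \<rho> - r0" by (simp add: \<rho>_def rho_def)
    have "a * (2 * a * ku (\<phi> - \<phi>') + 2 * \<rho>' * cos \<phi> * u) = 2 * (a\<^sup>2 * ku (\<phi> - \<phi>')) + 2 * \<rho>' * (a * cos \<phi>) * u"
      by (simp add: power2_eq_square algebra_simps)
    also have "\<dots> = 2 * \<rho>' * (\<rho> * X - r0 * u)"
      unfolding w \<open>a * cos \<phi> = \<rho> - r0\<close> by (simp add: algebra_simps)
    finally show ?thesis .
  qed
  define \<sigma> \<sigma>' S where "\<sigma> = sqrt \<rho>" and "\<sigma>' = sqrt \<rho>'" and "S = sqrt X"
  have sig: "\<sigma> > 0" "\<sigma>' > 0" "\<rho> = \<sigma>\<^sup>2" "\<rho>' = \<sigma>'\<^sup>2" using \<rho> by (simp_all add: \<sigma>_def \<sigma>'_def)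
  have X0: "X \<ge> 0" by (simp add: X_def)
  have XS: "X = S\<^sup>2" using X0 by (simp add: S_def)
  have S0: "S \<ge> 0" using X0 by (simp add: S_def)
  have "axiK \<theta> \<phi> \<theta>' \<phi>' = a * (2 * a * ku (\<phi> - \<phi>') + 2 * \<rho>' * cos \<phi> * u) * \<rho>' / (4 * pi * (2 * (\<sigma> * \<sigma>' * S)) ^ 3)"
    unfolding axiK_def N u_def[symmetric] \<rho>'_def[symmetric]
    by (simp add: real_sqrt_mult \<sigma>_def \<sigma>'_def S_def mult_ac)
  also have "\<dots> = 2 * \<rho>' * (\<rho> * X - r0 * u) * \<rho>' / (4 * pi * (2 * (\<sigma> * \<sigma>' * S)) ^ 3)"
    unfolding num ..
  also have "\<dots> = \<sigma>' / (16 * pi * \<sigma> ^ 3) * (\<rho> * (1 / S) - r0 * (u / S ^ 3))"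
  proof (cases "S = 0")
    case False
    have "2 * \<sigma>'\<^sup>2 * (\<rho> * S\<^sup>2 - r0 * u) * \<sigma>'\<^sup>2 / (4 * pi * (2 * (\<sigma> * \<sigma>' * S)) ^ 3)
        = \<sigma>' / (16 * pi * \<sigma> ^ 3) * ((\<rho> * S\<^sup>2 - r0 * u) / S ^ 3)"
      using sig(1,2) False by (simp add: power_mult_distrib power2_eq_square power3_eq_cube divide_simps)
    also have "(\<rho> * S\<^sup>2 - r0 * u) / S ^ 3 = \<rho> * (1 / S) - r0 * (u / S ^ 3)"
      using False by (simp add: diff_divide_distrib power2_eq_square power3_eq_cube)
    finally show ?thesis unfolding sig(4) XS by (simp add: sig(4)[symmetric])
  qed simp
  finally show ?thesis
    by (simp add: kA_def kB_def flip X_def[symmetric] S_def \<sigma>_def \<sigma>'_def \<rho>_def \<rho>'_def \<phi>_def \<phi>'_def)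
qed

end

lemma integrable_kernel_slice:
  assumes q: "q > 0" and w: "ku \<eta> > 0"
  shows "integrable circ (\<lambda>\<theta>. kA q \<theta> \<eta>)" "integrable circ (\<lambda>\<theta>. kB q \<theta> \<eta>)"
proof -
  have X0: "kX q \<theta> \<eta> \<noteq> 0" for \<theta> using kX_pos'[OF q w, of \<theta>] by simp
  have ku: "continuous_on UNIV ku" unfolding ku_def by (intro continuous_intros) simp
  note cont = continuous_kX(2)[OF q, of \<eta>]
  show "integrable circ (\<lambda>\<theta>. kA q \<theta> \<eta>)" "integrable circ (\<lambda>\<theta>. kB q \<theta> \<eta>)"
    unfolding kA_def kB_def
    by (safe intro!: integrable_circ_continuous continuous_intros cont ku) (simp_all add: X0)
qed

lemma kernel_convolution:
  assumes q: "q > 0" and f: "summable (\<lambda>n. \<bar>f n\<bar>)"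
  shows "integrable circ (\<lambda>y. (LINT \<theta>|circ. kA q \<theta> (x - y)) * sine_series f y)"
    and "integrable circ (\<lambda>y. (LINT \<theta>|circ. kB q \<theta> (x - y)) * sine_series f y)"
    and "(LINT y|circ. (LINT \<theta>|circ. kA q \<theta> (x - y)) * sine_series f y) = sine_series (\<lambda>n. acoef q (Suc n) * f n) x"
    and "(LINT y|circ. (LINT \<theta>|circ. kB q \<theta> (x - y)) * sine_series f y) = sine_series (\<lambda>n. bcoef q (Suc n) * f n) x"
proof -
  have "integrable circ (\<lambda>z. LINT \<theta>|circ. kA q \<theta> z)" "integrable circ (\<lambda>z. LINT \<theta>|circ. kB q \<theta> z)"
    using circ2.integrable_snd[OF integrable_kA_0[OF q]] circ2.integrable_snd[OF integrable_kB_0[OF q]] by simp_all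
  moreover have "(\<lambda>z. LINT \<theta>|circ. kA q \<theta> z) \<in> borel_measurable borel" "(\<lambda>z. LINT \<theta>|circ. kB q \<theta> z) \<in> borel_measurable borel"
    by measurable
  ultimately show "integrable circ (\<lambda>y. (LINT \<theta>|circ. kA q \<theta> (x - y)) * sine_series f y)"
    "integrable circ (\<lambda>y. (LINT \<theta>|circ. kB q \<theta> (x - y)) * sine_series f y)"
    "(LINT y|circ. (LINT \<theta>|circ. kA q \<theta> (x - y)) * sine_series f y) = sine_series (\<lambda>n. acoef q (Suc n) * f n) x"
    "(LINT y|circ. (LINT \<theta>|circ. kB q \<theta> (x - y)) * sine_series f y) = sine_series (\<lambda>n. bcoef q (Suc n) * f n) x"
    unfolding acoef_def bcoef_def
    using sine_series_convolution[of "\<lambda>z. LINT \<theta>|circ. kA q \<theta> z" f x] sine_series_convolution[of "\<lambda>z. LINT \<theta>|circ. kB q \<theta> z" f x] f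
    by simp_all
qed

context ring_torus
begin

text \<open>The power 3/2 is forced by counting powers of rho at the integration point: the kernel
  contributes 1/2, the density -3/2 and the change to the conformal angle 1, so the integrand
  becomes a pure convolution.\<close>

lemma NP_torus_axisymmetric:
  assumes g: "orthogonal_transformation g" and f: "summable (\<lambda>n. \<bar>f n\<bar>)"
    and h [measurable]: "h \<in> borel_measurable borel" and h_bd: "\<And>\<phi>. \<bar>h \<phi>\<bar> \<le> K"
    and psi: "\<And>\<theta> \<phi>. psi (tor_point g b r0 a (\<theta>, \<phi>)) = h \<phi>"
    and h_eq: "\<And>\<eta>. h (tor_angle \<eta>) = sine_series f \<eta> / sqrt (rho (tor_angle \<eta>)) ^ 3"
  shows "NP_torus g b r0 a psi (\<theta>, tor_angle \<eta>)
    = 1 / (16 * pi * R0 * sqrt (rho (tor_angle \<eta>)) ^ 3)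
      * (rho (tor_angle \<eta>) * sine_series (\<lambda>n. acoef qq (Suc n) * f n) \<eta>
         - r0 * sine_series (\<lambda>n. bcoef qq (Suc n) * f n) \<eta>)"
proof -
  define \<phi> where "\<phi> = tor_angle \<eta>"
  define \<sigma> where "\<sigma> = sqrt (rho \<phi>)"
  define H where "H \<theta>' \<phi>' = axiK \<theta> \<phi> \<theta>' \<phi>' * h \<phi>'" for \<theta>' \<phi>'
  have H_meas [measurable]: "case_prod H \<in> borel_measurable (borel \<Otimes>\<^sub>M borel)"
    unfolding H_def axiK_def chordN_def by measurable
  have "NP_torus g b r0 a psi (\<theta>, \<phi>) = (LINT s : {0..2*pi} \<times> {0..2*pi} | lborel. case_prod H s)"
    unfolding NP_torus_def
  proof (intro arg_cong2[where f = "set_lebesgue_integral lborel"] refl ext)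
    fix s :: "real \<times> real"
    obtain \<theta>' \<phi>' where s: "s = (\<theta>', \<phi>')" by (cases s)
    show "NP_kernel (tor_point g b r0 a (\<theta>, \<phi>)) (tor_point g b r0 a s) (tor_normal g (\<theta>, \<phi>))
        * psi (tor_point g b r0 a s) * torus_jac r0 a s = case_prod H s"
      unfolding s psi NP_kernel_torus[OF g]
      by (simp add: H_def axiK_def chordN_def torus_jac_def rho_def)
  qed
  also have "\<dots> = integral\<^sup>L (circ \<Otimes>\<^sub>M circ) (case_prod H)"
    by (rule set_integral_square_eq_circ) (use H_meas in \<open>simp add: borel_prod\<close>)
  finally have NP: "NP_torus g b r0 a psi (\<theta>, \<phi>) = integral\<^sup>L (circ \<Otimes>\<^sub>M circ) (case_prod H)" .
  have H_int: "integrable (circ \<Otimes>\<^sub>M circ) (case_prod H)"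
  proof -
    obtain C where C: "\<And>\<theta>' \<phi>'. \<bar>axiK \<theta> \<phi> \<theta>' \<phi>'\<bar> \<le> C * kA 1 (\<theta>' - \<theta>) (\<phi>' - \<phi>)"
      using axiK_bound[of \<theta> \<phi>] by blast
    show ?thesis
    proof (rule Bochner_Integration.integrable_bound)
      show "integrable (circ \<Otimes>\<^sub>M circ) (\<lambda>s. C * K * (case s of (x, y) \<Rightarrow> kA 1 (x - \<theta>) (y - \<phi>)))"
        by (intro integrable_mult_right integrable_kA) simp
      show "AE s in circ \<Otimes>\<^sub>M circ. norm (case_prod H s) \<le> norm (C * K * (case s of (x, y) \<Rightarrow> kA 1 (x - \<theta>) (y - \<phi>)))"
      proof (rule AE_I2)
        fix s :: "real \<times> real"
        obtain \<theta>' \<phi>' where s: "s = (\<theta>', \<phi>')" by (cases s)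
        have "\<bar>H \<theta>' \<phi>'\<bar> \<le> C * kA 1 (\<theta>' - \<theta>) (\<phi>' - \<phi>) * K"
          unfolding H_def abs_mult
          by (intro mult_mono C h_bd) (auto intro: order_trans[OF abs_ge_zero C])
        then show "norm (case_prod H s) \<le> norm (C * K * (case s of (x, y) \<Rightarrow> kA 1 (x - \<theta>) (y - \<phi>)))"
          unfolding s by (simp add: mult_ac)
      qed
    qed measurable
  qed
  \<comment> \<open>Integrating over \<theta>' first leaves a function of one angle, to which the
    one-dimensional substitution \<phi>' = \<open>tor_angle y\<close> applies.\<close>
  define Z where "Z \<phi>' = (LINT \<theta>'|circ. H \<theta>' \<phi>')" for \<phi>'
  have Z_meas [measurable]: "Z \<in> borel_measurable borel" unfolding Z_def by measurable
  have Z_int: "integrable circ Z" unfolding Z_def by (rule circ2.integrable_snd[OF H_int])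
  have "integral\<^sup>L (circ \<Otimes>\<^sub>M circ) (case_prod H) = (LINT \<phi>'|circ. Z \<phi>')"
    unfolding Z_def by (rule circ2.integral_snd[OF H_int, symmetric])
  also have "\<dots> = (LBINT x. Z x * indicator {tor_angle 0..tor_angle (2*pi)} x)"
    unfolding tor_angle_0 integral_circ[OF Z_meas] set_lebesgue_integral_def
    by (simp only: real_scaleR_def mult.commute)
  also have "\<dots> = (LBINT x. Z (tor_angle x) * (rho (tor_angle x) / R0) * indicator {0..2*pi} x)"
  proof (rule integral_substitution(2))
    show "set_integrable lborel {tor_angle 0..tor_angle (2*pi)} Z"
      using Z_int unfolding tor_angle_0 integrable_circ[OF Z_meas] .
    show "continuous_on {0..2*pi} (\<lambda>x. rho (tor_angle x) / R0)"
    proof -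
      have "den x \<noteq> 0" for x using den_pos[of x] by simp
      then show ?thesis
        unfolding rho_tor_angle den_def using R0_pos by (intro continuous_intros) auto
    qed
    show "0 \<le> rho (tor_angle x) / R0" for x using rho_pos[of "tor_angle x"] R0_pos by (simp add: less_imp_le)
  qed (auto intro: DERIV_tor_angle)
  also have "\<dots> = (LINT x|circ. Z (tor_angle x) * (rho (tor_angle x) / R0))"
    by (simp add: integral_circ set_lebesgue_integral_def mult.commute)
  also have "\<dots> = (LINT y|circ. 1 / (16 * pi * R0 * \<sigma> ^ 3)
      * (rho \<phi> * ((LINT \<theta>|circ. kA qq \<theta> (\<eta> - y)) * sine_series f y)
         - r0 * ((LINT \<theta>|circ. kB qq \<theta> (\<eta> - y)) * sine_series f y)))"
  proof (rule integral_cong_AE)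
    show "(\<lambda>x. Z (tor_angle x) * (rho (tor_angle x) / R0)) \<in> borel_measurable circ" by measurable
    show "(\<lambda>y. 1 / (16 * pi * R0 * \<sigma> ^ 3)
      * (rho \<phi> * ((LINT \<theta>|circ. kA qq \<theta> (\<eta> - y)) * sine_series f y)
         - r0 * ((LINT \<theta>|circ. kB qq \<theta> (\<eta> - y)) * sine_series f y))) \<in> borel_measurable circ" by measurable
    show "AE y in circ. Z (tor_angle y) * (rho (tor_angle y) / R0) = 1 / (16 * pi * R0 * \<sigma> ^ 3)
      * (rho \<phi> * ((LINT \<theta>|circ. kA qq \<theta> (\<eta> - y)) * sine_series f y)
         - r0 * ((LINT \<theta>|circ. kB qq \<theta> (\<eta> - y)) * sine_series f y))"
      \<comment> \<open>For \<open>y\<close> different from \<open>\<eta>\<close> modulo the period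
        the slices of both kernels are integrable in \<theta>', and periodicity removes the shift by
        \<theta>.\<close>
      using AE_circ_sin_nonzero[of \<eta>]
    proof eventually_elim
      case (elim y)
      have "ku (y - \<eta>) > 0" using elim by (simp add: ku_sin)
      then have w: "ku (\<eta> - y) > 0" using ku_minus[of "y - \<eta>"] by simp
      define \<sigma>' where "\<sigma>' = sqrt (rho (tor_angle y))"
      have \<sigma>': "\<sigma>' > 0" "rho (tor_angle y) = \<sigma>'\<^sup>2" using rho_pos[of "tor_angle y"] by (simp_all add: \<sigma>'_def)
      define IA IB where "IA = (LINT \<theta>|circ. kA qq \<theta> (\<eta> - y))" and "IB = (LINT \<theta>|circ. kB qq \<theta> (\<eta> - y))"
      have sh: "(LINT \<theta>'|circ. kA qq (\<theta>' - \<theta>) (\<eta> - y)) = IA" "integrable circ (\<lambda>\<theta>'. kA qq (\<theta>' - \<theta>) (\<eta> - y))"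
        "(LINT \<theta>'|circ. kB qq (\<theta>' - \<theta>) (\<eta> - y)) = IB" "integrable circ (\<lambda>\<theta>'. kB qq (\<theta>' - \<theta>) (\<eta> - y))"
        using integral_circ_shift[of "\<lambda>\<theta>. kA qq \<theta> (\<eta> - y)" "- \<theta>"] integral_circ_shift[of "\<lambda>\<theta>. kB qq \<theta> (\<eta> - y)" "- \<theta>"]
          integrable_kernel_slice[OF qq_pos w] by (simp_all add: IA_def IB_def)
      define k where "k = \<sigma>' / (16 * pi * \<sigma> ^ 3) * (sine_series f y / \<sigma>' ^ 3)"
      have "Z (tor_angle y) = (LINT \<theta>'|circ. k * (rho \<phi> * kA qq (\<theta>' - \<theta>) (\<eta> - y) - r0 * kB qq (\<theta>' - \<theta>) (\<eta> - y)))"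
        unfolding Z_def H_def \<phi>_def axiK_conformal h_eq
        by (intro Bochner_Integration.integral_cong refl) (simp add: k_def \<sigma>'_def \<sigma>_def \<phi>_def)
      also have "\<dots> = k * (rho \<phi> * IA - r0 * IB)" using sh by simp
      finally have "Z (tor_angle y) * (rho (tor_angle y) / R0) = k * (\<sigma>'\<^sup>2 / R0) * (rho \<phi> * IA - r0 * IB)"
        unfolding \<sigma>'(2) by simp
      also have "k * (\<sigma>'\<^sup>2 / R0) = 1 / (16 * pi * R0 * \<sigma> ^ 3) * sine_series f y"
        using \<sigma>'(1) by (simp add: k_def power2_eq_square power3_eq_cube)
      finally show ?case unfolding IA_def[symmetric] IB_def[symmetric] by (simp add: algebra_simps)
    qed
  qed
  also have "\<dots> = 1 / (16 * pi * R0 * \<sigma> ^ 3)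
      * (rho \<phi> * sine_series (\<lambda>n. acoef qq (Suc n) * f n) \<eta> - r0 * sine_series (\<lambda>n. bcoef qq (Suc n) * f n) \<eta>)"
    using kernel_convolution[OF qq_pos f, of \<eta>] by (simp only: integral_mult_right_zero) simp
  finally have "integral\<^sup>L (circ \<Otimes>\<^sub>M circ) (case_prod H) = 1 / (16 * pi * R0 * \<sigma> ^ 3)
      * (rho \<phi> * sine_series (\<lambda>n. acoef qq (Suc n) * f n) \<eta> - r0 * sine_series (\<lambda>n. bcoef qq (Suc n) * f n) \<eta>)" .
  then show ?thesis using NP by (simp add: \<phi>_def \<sigma>_def)
qed

end

section \<open>From solutions of the pencil to eigenfunctions on the surface\<close>

context ring_torus
begin

text \<open>Recovers cos \<eta> and sin \<eta> from the distance to the axis and the height, that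
  is, from Cartesian coordinates of the point.\<close>

lemma conformal_coordinates:
  "(r0 * rho (tor_angle \<eta>) - R0\<^sup>2) / (a * rho (tor_angle \<eta>)) = cos \<eta>"
  "R0 * sin (tor_angle \<eta>) / rho (tor_angle \<eta>) = sin \<eta>"
proof -
  have D: "den \<eta> > 0" by (rule den_pos)
  have R: "R0\<^sup>2 > 0" using R0_pos by simp
  have "r0 * rho (tor_angle \<eta>) - R0\<^sup>2 = R0\<^sup>2 * (r0 - den \<eta>) / den \<eta>"
    unfolding rho_tor_angle using D by (simp add: field_simps)
  also have "\<dots> = a * rho (tor_angle \<eta>) * cos \<eta>"
    unfolding rho_tor_angle by (simp add: den_def)
  finally show "(r0 * rho (tor_angle \<eta>) - R0\<^sup>2) / (a * rho (tor_angle \<eta>)) = cos \<eta>"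
    using a_pos rho_pos[of "tor_angle \<eta>"] by simp
  show "R0 * sin (tor_angle \<eta>) / rho (tor_angle \<eta>) = sin \<eta>"
    unfolding rho_tor_angle cos_sin_tor_angle using D R0_pos by (simp add: power2_eq_square)
qed

text \<open>The density is \<open>F\<close> over rho to the power 3/2, expressed by \<open>G\<close>
  in axis distance and height. The second relation says that \<open>p\<close> has the sine series A
  F / \<open>den\<close>, which is rho A F / \<open>R0\<^sup>2\<close>; inserted into the first it
  gives the conjugated eigenvalue equation.\<close>

lemma eigenvalue_of_pencil:
  assumes g: "orthogonal_transformation g"
    and f: "summable (\<lambda>n. \<bar>f n\<bar>)" "f m \<noteq> 0" and p: "summable (\<lambda>n. \<bar>p n\<bar>)"
    and eq1: "\<And>n. lam * f n = (r0\<^sup>2 - a\<^sup>2) * p n - r0 * bcoef qq (Suc n) * f n"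
    and eq2: "\<And>n. r0 * p n - a * ((p (Suc n) + (case n of 0 \<Rightarrow> 0 | Suc m \<Rightarrow> p m)) / 2) = acoef qq (Suc n) * f n"
  shows "NP_torus_eigenvalue g b r0 a (lam / (16 * pi * R0))"
proof -
  define F where "F = sine_series f"
  define Fz where "Fz z = (\<Sum>n. f n * Im (z ^ Suc n))" for z :: complex
  have F_Fz: "F \<eta> = Fz (Complex (cos \<eta>) (sin \<eta>))" for \<eta>
    unfolding F_def Fz_def by (rule sine_series_cis)
  have Fz_cont: "continuous_on (cball 0 1) Fz"
    unfolding Fz_def by (rule continuous_sine_series_disc[OF f(1)])
  have eigen: "lam * F \<eta> = rho (tor_angle \<eta>) * sine_series (\<lambda>n. acoef qq (Suc n) * f n) \<eta>
      - r0 * sine_series (\<lambda>n. bcoef qq (Suc n) * f n) \<eta>" for \<eta>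
  proof -
    let ?e = "\<lambda>n. sin (real (Suc n) * \<eta>)"
    have "(\<lambda>n. (R0\<^sup>2 * (p n * ?e n) - lam * (f n * ?e n)) / r0) sums ((R0\<^sup>2 * sine_series p \<eta> - lam * F \<eta>) / r0)"
      unfolding F_def by (intro sums_divide sums_diff sums_mult sine_series_sums f p)
    moreover have "(R0\<^sup>2 * (p n * ?e n) - lam * (f n * ?e n)) / r0 = bcoef qq (Suc n) * f n * ?e n" for n
    proof -
      have "R0\<^sup>2 * p n - lam * f n = r0 * (bcoef qq (Suc n) * f n)"
        using eq1[of n] by (simp add: R0_sq mult.assoc)
      then have "(R0\<^sup>2 * p n - lam * f n) * ?e n = r0 * (bcoef qq (Suc n) * f n) * ?e n" by simp
      moreover have "R0\<^sup>2 * (p n * ?e n) - lam * (f n * ?e n) = (R0\<^sup>2 * p n - lam * f n) * ?e n"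
        by (simp only: left_diff_distrib mult.assoc)
      ultimately have "R0\<^sup>2 * (p n * ?e n) - lam * (f n * ?e n) = r0 * (bcoef qq (Suc n) * f n * ?e n)"
        by (simp only: mult.assoc)
      moreover have "r0 * v / r0 = v" for v using a_pos a_less by simp
      ultimately show ?thesis by (simp only:)
    qed
    ultimately have "sine_series (\<lambda>n. bcoef qq (Suc n) * f n) \<eta> = (R0\<^sup>2 * sine_series p \<eta> - lam * F \<eta>) / r0"
      unfolding sine_series_def sums_iff by simp
    then have "r0 * sine_series (\<lambda>n. bcoef qq (Suc n) * f n) \<eta> = R0\<^sup>2 * sine_series p \<eta> - lam * F \<eta>"
      using a_pos a_less by simp
    moreover have "sine_series (\<lambda>n. acoef qq (Suc n) * f n) \<eta> = den \<eta> * sine_series p \<eta>"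
      unfolding den_def by (rule sine_series_jacobi[OF p eq2])
    then have "rho (tor_angle \<eta>) * sine_series (\<lambda>n. acoef qq (Suc n) * f n) \<eta> = R0\<^sup>2 * sine_series p \<eta>"
      using den_pos[of \<eta>] by (simp add: rho_tor_angle)
    ultimately show ?thesis by simp
  qed
  define G where "G w z = Fz (Complex ((r0 * w - R0\<^sup>2) / (a * w)) (R0 * z / (a * w))) / sqrt w ^ 3" for w z
  define h where "h \<phi> = G (rho \<phi>) (a * sin \<phi>)" for \<phi>
  have coord: "\<exists>\<eta>. cos (tor_angle \<eta>) = cos \<phi> \<and> sin (tor_angle \<eta>) = sin \<phi> \<and> rho (tor_angle \<eta>) = rho \<phi> \<and>
      Complex ((r0 * rho \<phi> - R0\<^sup>2) / (a * rho \<phi>)) (R0 * (a * sin \<phi>) / (a * rho \<phi>)) = Complex (cos \<eta>) (sin \<eta>)" for \<phi>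
  proof -
    obtain \<eta> where \<eta>: "cos (tor_angle \<eta>) = cos \<phi>" "sin (tor_angle \<eta>) = sin \<phi>" using tor_angle_surj by blast
    then have r: "rho (tor_angle \<eta>) = rho \<phi>" by (simp add: rho_def)
    have "R0 * (a * sin \<phi>) / (a * rho \<phi>) = R0 * sin \<phi> / rho \<phi>" using a_pos by simp
    then show ?thesis using conformal_coordinates[of \<eta>] \<eta> r by (intro exI[of _ \<eta>]) simp
  qed
  have h_eq: "h (tor_angle \<eta>) = sine_series f \<eta> / sqrt (rho (tor_angle \<eta>)) ^ 3" for \<eta>
  proof -
    have "R0 * (a * sin (tor_angle \<eta>)) / (a * rho (tor_angle \<eta>)) = R0 * sin (tor_angle \<eta>) / rho (tor_angle \<eta>)"
      using a_pos by simp
    then show ?thesis unfolding h_def G_def conformal_coordinates F_def[symmetric] F_Fz by simp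
  qed
  have h_val: "\<exists>\<eta>. cos (tor_angle \<eta>) = cos \<phi> \<and> sin (tor_angle \<eta>) = sin \<phi> \<and> h \<phi> = h (tor_angle \<eta>)" for \<phi>
  proof -
    obtain \<eta> where "cos (tor_angle \<eta>) = cos \<phi>" "sin (tor_angle \<eta>) = sin \<phi>" using tor_angle_surj by blast
    then show ?thesis by (intro exI[of _ \<eta>]) (simp add: h_def rho_def)
  qed
  have h_bd: "\<bar>h \<phi>\<bar> \<le> (\<Sum>n. \<bar>f n\<bar>) / sqrt (r0 - a) ^ 3" for \<phi>
  proof -
    obtain \<eta> where \<eta>: "h \<phi> = h (tor_angle \<eta>)" using h_val by blast
    have "sqrt (r0 - a) ^ 3 \<le> sqrt (rho (tor_angle \<eta>)) ^ 3"
      using rho_ge[of "tor_angle \<eta>"] a_less by (intro power_mono) auto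
    moreover have "0 < sqrt (r0 - a) ^ 3" using a_less by simp
    moreover have "0 \<le> (\<Sum>n. \<bar>f n\<bar>)" by (intro suminf_nonneg f) simp
    ultimately show ?thesis
      unfolding \<eta> h_eq abs_divide using abs_sine_series_le[OF f(1), of \<eta>] by (intro frac_le) auto
  qed
  \<comment> \<open>A domain on which \<open>G\<close> is visibly continuous: positive axis
    distance, and the conformal point in the closed disc where the series converges
    uniformly.\<close>
  define U where "U = {(w, z). w > 0 \<and> Complex ((r0 * w - R0\<^sup>2) / (a * w)) (R0 * z / (a * w)) \<in> cball 0 1}"
  have G_cont: "continuous_on U (\<lambda>(w, z). G w z)"
  proof -
    have "continuous_on U (\<lambda>s. Fz (Complex ((r0 * fst s - R0\<^sup>2) / (a * fst s)) (R0 * snd s / (a * fst s))))"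
      by (rule continuous_on_compose2[OF Fz_cont])
        (use a_pos in \<open>auto simp: U_def intro!: continuous_intros continuous_on_Complex\<close>)
    then show ?thesis
      unfolding G_def split_beta
      by (intro continuous_intros) (auto simp: U_def)
  qed
  have U_rho: "(rho \<phi>, a * sin \<phi>) \<in> U" for \<phi>
  proof -
    obtain \<eta> where \<eta>: "Complex ((r0 * rho \<phi> - R0\<^sup>2) / (a * rho \<phi>)) (R0 * (a * sin \<phi>) / (a * rho \<phi>)) = Complex (cos \<eta>) (sin \<eta>)"
      using coord by blast
    have "cmod (Complex (cos \<eta>) (sin \<eta>)) = 1" by (simp add: cmod_def)
    then show ?thesis unfolding U_def using rho_pos[of \<phi>] \<eta> by simp
  qed
  have "continuous_on UNIV h"
  proof -
    have "continuous_on UNIV (\<lambda>\<phi>. (\<lambda>(w, z). G w z) (rho \<phi>, a * sin \<phi>))"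
      by (rule continuous_on_compose2[OF G_cont])
        (use U_rho in \<open>auto simp: rho_def intro!: continuous_intros\<close>)
    then show ?thesis by (simp add: h_def[abs_def])
  qed
  then have h_meas: "h \<in> borel_measurable borel" by (rule borel_measurable_continuous_onI)
  \<comment> \<open>Undoes the rigid motion, so that \<open>w\<close> and the third coordinate of
    \<open>y\<close> are axis distance and height for the torus in standard position.\<close>
  define y where "y x = inv g (x - b)" for x
  define w where "w x = sqrt ((y x $ 1)\<^sup>2 + (y x $ 2)\<^sup>2)" for x
  define psi where "psi x = G (w x) (y x $ 3)" for x
  have y_pt: "y (tor_point g b r0 a t) = torus_param r0 a t" for t
    using orthogonal_transformation_inj[OF g] by (simp add: y_def tor_point_def)
  have w_pt: "w (tor_point g b r0 a (\<theta>, \<phi>)) = rho \<phi>" for \<theta> \<phi>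
  proof -
    have "(rho \<phi> * cos \<theta>)\<^sup>2 + (rho \<phi> * sin \<theta>)\<^sup>2 = (rho \<phi>)\<^sup>2 * ((cos \<theta>)\<^sup>2 + (sin \<theta>)\<^sup>2)"
      by (simp only: power_mult_distrib distrib_left)
    then show ?thesis
      using rho_pos[of \<phi>] by (simp add: w_def y_pt torus_param_def vector_3 rho_def[symmetric])
  qed
  have y3: "y (tor_point g b r0 a (\<theta>, \<phi>)) $ 3 = a * sin \<phi>" for \<theta> \<phi>
    by (simp add: y_pt torus_param_def vector_3)
  have psi_pt: "psi (tor_point g b r0 a (\<theta>, \<phi>)) = h \<phi>" for \<theta> \<phi>
    by (simp add: psi_def w_pt y3 h_def)
  have "continuous_on (torus_surface g b r0 a) psi"
  proof -
    have "linear (inv g)" by (rule orthogonal_transformation_linear[OF orthogonal_transformation_inv[OF g]])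
    then have "continuous_on UNIV (inv g)" by (simp add: linear_continuous_on linear_conv_bounded_linear)
    then have yc: "continuous_on S y" for S
      unfolding y_def by (rule continuous_on_compose2) (auto intro!: continuous_intros)
    have "continuous_on (torus_surface g b r0 a) (\<lambda>x. (\<lambda>(w, z). G w z) (w x, y x $ 3))"
    proof (rule continuous_on_compose2[OF G_cont])
      show "continuous_on (torus_surface g b r0 a) (\<lambda>x. (w x, y x $ 3))"
        unfolding w_def by (intro continuous_intros yc)
      show "(\<lambda>x. (w x, y x $ 3)) ` torus_surface g b r0 a \<subseteq> U"
        unfolding torus_surface_def using U_rho by (auto simp: w_pt y3)
    qed
    then show ?thesis by (simp add: psi_def[abs_def])
  qed
  moreover have "\<exists>x\<in>torus_surface g b r0 a. psi x \<noteq> 0"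
  proof -
    obtain \<eta> where "sine_series f \<eta> \<noteq> 0" using sine_series_nonzero[OF f] by blast
    then have "psi (tor_point g b r0 a (0, tor_angle \<eta>)) \<noteq> 0"
      using rho_pos[of "tor_angle \<eta>"] by (simp add: psi_pt h_eq)
    then show ?thesis unfolding torus_surface_def by blast
  qed
  moreover have "NP_torus g b r0 a psi t = lam / (16 * pi * R0) * psi (tor_point g b r0 a t)" for t
  proof -
    obtain \<theta> \<phi> where t: "t = (\<theta>, \<phi>)" by (cases t)
    obtain \<eta> where \<eta>: "cos (tor_angle \<eta>) = cos \<phi>" "sin (tor_angle \<eta>) = sin \<phi>" "h \<phi> = h (tor_angle \<eta>)"
      using h_val by blast
    \<comment> \<open>The operator sees \<phi> only through sine and cosine, so \<phi> may be
      replaced by the equivalent angle \<open>tor_angle \<eta>\<close>.\<close>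
    have "NP_torus g b r0 a psi t = NP_torus g b r0 a psi (\<theta>, tor_angle \<eta>)"
      unfolding t NP_torus_def tor_point_def tor_normal_def torus_param_def torus_normal_def prod.case \<eta> ..
    also have "\<dots> = 1 / (16 * pi * R0 * sqrt (rho (tor_angle \<eta>)) ^ 3) * (lam * F \<eta>)"
      unfolding eigen by (rule NP_torus_axisymmetric[OF g f(1) h_meas h_bd psi_pt h_eq])
    also have "\<dots> = lam / (16 * pi * R0) * h (tor_angle \<eta>)" unfolding h_eq F_def by simp
    finally show ?thesis unfolding t psi_pt \<eta>(3) .
  qed
  ultimately show ?thesis unfolding NP_torus_eigenvalue_def by blast
qed

text \<open>The pencil is applied with frequencies shifted by one. Distinct positive \<mu> stay
  distinct under the rescaling by \<open>s / (16 * pi * R0)\<close>, which restores the sign and the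
  normalisation of the kernel.\<close>

lemma infinitely_many_eigenvalues_of_sign:
  assumes g: "orthogonal_transformation g" and s: "s = 1 \<or> s = (-1::real)"
  shows "infinite {lam. 0 < s * lam \<and> NP_torus_eigenvalue g b r0 a lam}"
proof -
  let ?c = "s / (16 * pi * R0)"
  have c: "?c \<noteq> 0" using s R0_pos by auto
  let ?M = "{\<mu>. \<mu> > 0 \<and> (\<exists>f p. (\<exists>n. f n \<noteq> 0) \<and> summable (\<lambda>n. \<bar>f n\<bar>) \<and> summable (\<lambda>n. \<bar>p n\<bar>) \<and>
     (\<forall>n. s * \<mu> * f n = (r0\<^sup>2 - a\<^sup>2) * p n - r0 * bcoef qq (Suc n) * f n) \<and>
     (\<forall>n. r0 * p n - a * ((p (Suc n) + (case n of 0 \<Rightarrow> 0 | Suc m \<Rightarrow> p m)) / 2) = acoef qq (Suc n) * f n))}"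
  have "infinite ?M"
  proof (rule jacobi_pencil_infinitely_many_eigenvalues[OF a_pos a_less s])
    show "0 < acoef qq (Suc n)" for n by (rule acoef_pos[OF qq_pos]) simp
    show "(\<lambda>n. acoef qq (Suc n)) \<longlonglongrightarrow> 0" by (rule LIMSEQ_Suc[OF acoef_tendsto_0[OF qq_pos]])
    show "(\<lambda>n. bcoef qq (Suc n) / acoef qq (Suc n)) \<longlonglongrightarrow> 1" by (rule bcoef_acoef_ratio[OF qq_pos])
  qed
  then have "infinite ((\<lambda>\<mu>. ?c * \<mu>) ` ?M)"
    using c by (subst finite_image_iff) (auto intro!: inj_onI)
  moreover have "(\<lambda>\<mu>. ?c * \<mu>) ` ?M \<subseteq> {lam. 0 < s * lam \<and> NP_torus_eigenvalue g b r0 a lam}"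
  proof
    fix l assume "l \<in> (\<lambda>\<mu>. ?c * \<mu>) ` ?M"
    then obtain \<mu> f p n where l: "l = ?c * \<mu>" and \<mu>: "\<mu> > 0" and fp: "f n \<noteq> 0" "summable (\<lambda>n. \<bar>f n\<bar>)" "summable (\<lambda>n. \<bar>p n\<bar>)"
      "\<And>n. s * \<mu> * f n = (r0\<^sup>2 - a\<^sup>2) * p n - r0 * bcoef qq (Suc n) * f n"
      "\<And>n. r0 * p n - a * ((p (Suc n) + (case n of 0 \<Rightarrow> 0 | Suc m \<Rightarrow> p m)) / 2) = acoef qq (Suc n) * f n"
      by blast
    have "s * l = \<mu> / (16 * pi * R0)" using s by (auto simp: l)
    then have "0 < s * l" using \<mu> R0_pos by simp
    moreover have "NP_torus_eigenvalue g b r0 a (s * \<mu> / (16 * pi * R0))"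
      by (rule eigenvalue_of_pencil[OF g fp(2,1,3,4,5)])
    ultimately show "l \<in> {lam. 0 < s * lam \<and> NP_torus_eigenvalue g b r0 a lam}" by (simp add: l)
  qed
  ultimately show ?thesis by (rule infinite_super[rotated])
qed

end

theorem theorem1p1:
  fixes g :: "real^3 \<Rightarrow> real^3" and b :: "real^3" and r0 a :: real
  assumes "0 < a" and "a < r0" and "orthogonal_transformation g"
  shows "infinite {lam. lam < 0 \<and> NP_torus_eigenvalue g b r0 a lam}
       \<and> infinite {lam. 0 < lam \<and> NP_torus_eigenvalue g b r0 a lam}"
proof -
  interpret ring_torus r0 a using assms by unfold_locales
  show ?thesis
    using infinitely_many_eigenvalues_of_sign[OF assms(3), of "-1" b]
      infinitely_many_eigenvalues_of_sign[OF assms(3), of 1 b] by simp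
qed

end
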